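(* Let $f$ be a non-constant entire function with hyper-order $\rho_1(f)<1$, let $c\in\mathbb{C}\setminus\{0\}$, and let $a_1,a_2\in\mathbb{C}$ be distinct. Let $k$ be a positive integer and let $b_0,b_1,\ldots,b_k\in\mathbb{C}$ with $(b_0,b_1,\ldots,b_k)\neq(0,0,\ldots,0)$. Put $$\mathscr{L}_k(f(z+c))=b_0f(z+c)+b_1f'(z+c)+\cdots+b_kf^{(k)}(z+c)$$ and $$\phi(z)=\frac{\Big((a_1'-a_2')(f(z)-a_1)-(a_1-a_2)(f'(z)-a_1')\Big)\Big(f(z)-\mathscr{L}_k(f(z+c))\Big)}{(f(z)-a_1)(f(z)-a_2)}$$ (here $a_1'=a_2'=0$ since $a_1,a_2$ are constants). If $f(z)$ and $\mathscr{L}_k(f(z+c))$ share $a_1$ and $a_2$ IM, then either $f(z)\equiv\mathscr{L}_k(f(z+c))$ or $$\sum_{i=1}^k b_i\psi_i=-b_0,$$ where $\psi_1(z)=-\phi(z+c)/(a_1-a_2)$ is a constant and $\psi_{i+1}=\psi_i'+\psi_1\psi_i$ for $i=1,2,\ldots,k-1$.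
   Context: $T(r,f)$ is the Nevanlinna characteristic of a meromorphic function $f$ on $\mathbb{C}$, and the hyper-order of $f$ is $\rho_1(f)=\limsup_{r\to\infty}\frac{\log\log T(r,f)}{\log r}$. Two meromorphic functions $f,g$ share a value $a$ IM (ignoring multiplicities) if $f-a$ and $g-a$ have the same zeros, multiplicities being ignored. *)

theory Defs
  imports "HOL-Complex_Analysis.Complex_Analysis"
begin

definition log_plus :: "real \<Rightarrow> real" where
  "log_plus x = max 0 (ln x)"

definition proximity :: "real \<Rightarrow> (complex \<Rightarrow> complex) \<Rightarrow> real" where
  "proximity r f =
     1 / (2 * pi) * integral {0..2 * pi} (\<lambda>\<theta>. log_plus (norm (f (of_real r * cis \<theta>))))"

definition pole_count :: "real \<Rightarrow> (complex \<Rightarrow> complex) \<Rightarrow> nat" where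
  "pole_count t f = (\<Sum>z | norm z \<le> t \<and> is_pole f z. nat (- zorder f z))"

definition pole_counting :: "real \<Rightarrow> (complex \<Rightarrow> complex) \<Rightarrow> real" where
  "pole_counting r f =
     integral {0..r} (\<lambda>t. (real (pole_count t f) - real (pole_count 0 f)) / t)
       + real (pole_count 0 f) * ln r"

definition nevanlinna_T :: "real \<Rightarrow> (complex \<Rightarrow> complex) \<Rightarrow> real" where
  "nevanlinna_T r f = proximity r f + pole_counting r f"

text \<open>
  The limsup is taken in the extended reals, so that an infinite hyper-order is possible.
  For non-constant \<open>f\<close> the characteristic tends to infinity, so the values of \<^const>\<open>ln\<close> at
  non-positive arguments play no role in the limit.
\<close>
definition hyper_order :: "(complex \<Rightarrow> complex) \<Rightarrow> ereal" where
  "hyper_order f = Limsup at_top (\<lambda>r. ereal (ln (ln (nevanlinna_T r f)) / ln r))"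

text \<open>
  Meant for functions without poles, where the zeros of \<open>f - a\<close> are the points at which the
  HOL function \<open>f\<close> takes the value \<open>a\<close>.
\<close>
definition share_IM :: "(complex \<Rightarrow> complex) \<Rightarrow> (complex \<Rightarrow> complex) \<Rightarrow> complex \<Rightarrow> bool" where
  "share_IM f g a \<longleftrightarrow> {z. f z - a = 0} = {z. g z - a = 0}"

definition shift_diff_op ::
    "nat \<Rightarrow> (nat \<Rightarrow> complex) \<Rightarrow> complex \<Rightarrow> (complex \<Rightarrow> complex) \<Rightarrow> complex \<Rightarrow> complex" where
  "shift_diff_op k b c f = (\<lambda>z. \<Sum>i\<le>k. b i * (deriv ^^ i) f (z + c))"

text \<open>
  As a quotient of total HOL functions the expression takes the value \<open>0\<close> wherever its
  denominator vanishes; \<^const>\<open>remove_sings\<close> replaces this by the value of the meromorphic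
  function at removable singularities.
\<close>
definition aux_phi ::
    "(complex \<Rightarrow> complex) \<Rightarrow> (complex \<Rightarrow> complex) \<Rightarrow> (complex \<Rightarrow> complex) \<Rightarrow> (complex \<Rightarrow> complex)
      \<Rightarrow> complex \<Rightarrow> complex" where
  "aux_phi a1 a2 f g = remove_sings (\<lambda>z.
     (((deriv a1 z - deriv a2 z) * (f z - a1 z) - (a1 z - a2 z) * (deriv f z - deriv a1 z))
        * (f z - g z))
     / ((f z - a1 z) * (f z - a2 z)))"

end

theory Submission
  imports Defs
begin

text \<open>Write \<open>g\<close> for the shifted differential polynomial of \<open>f\<close> and \<open>\<alpha> = f'(f - g) / ((f - a1)(f - a2))\<close>,
  which is entire by the sharing hypothesis. Only means of truncated logarithms over circles about
  \<open>0\<close> are used. Composing with Moebius automorphisms of a disc gives a Harnack inequality, by which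
  \<open>ln |X(z + v) / X(z)|\<close> is bounded in the mean by the increment of the mean of \<open>ln |X|\<close> between
  two nearby radii; since the hyper-order is less than 1, there are radii at which all these increments
  are \<open>o(T(r, f))\<close>. An entire function which is \<open>O(exp(o(T)) / |f|)\<close> on such circles vanishes.

  Suppose that \<open>f \<noteq> g\<close> and \<open>Q = \<Sum>i\<le>k. b i * \<psi> i\<close>, with \<open>\<psi> 0 = 1\<close>, is not identically zero. Differentiating
  \<open>f' = \<alpha> (f - a1) + R\<close>, with \<open>R\<close> small, shows \<open>g \<approx> Q f(z + c)\<close>, so \<open>f\<close> and \<open>g\<close> have comparable size on
  the circles, and both \<open>\<alpha>\<close> and \<open>\<beta> = g'(g - f) / ((g - a1)(g - a2))\<close> are small. If \<open>f\<close> and \<open>g\<close> take a shared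
  value with multiplicities \<open>m\<close> and \<open>n\<close>, then \<open>n\<alpha> + m\<beta>\<close> vanishes there. With \<open>E\<close> the product of these
  functions for \<open>m, n \<le> 4\<close>, the function \<open>(f'E)^5 (g - a1)(g - a2) / ((f - a1)(f - a2))^4\<close> is entire and
  too small, so some \<open>n\<alpha> + m\<beta>\<close> vanishes identically. Then \<open>((f - a1) / (f - a2))^n\<close> is a constant multiple of
  \<open>((g - a1) / (g - a2))^m\<close>, which contradicts \<open>f \<noteq> g\<close> and the comparable size. Hence
  \<open>Q\<close> vanishes, which says that \<open>exp (\<integral> \<psi> 1)\<close> solves a linear equation with constant coefficients; it is
  therefore of exponential type, and since it has no zeros, \<open>\<psi> 1\<close> is constant.\<close>

section \<open>Means over circles\<close>

text \<open>The obstacle is that sharing ignores multiplicities: the order of a zero of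
  \<open>g - a1\<close> says nothing about that of \<open>f - a1\<close>. The product
  \<open>E\<close> repairs the finitely many pairs of low orders; for the others the quotient is
  regular because \<open>5 (M - 1) + N >= 4 M\<close> just means \<open>M + N >= 5\<close>. The same
  exponents balance the growth: if \<open>f\<close>, \<open>f'\<close> and \<open>g\<close> have
  size \<open>s\<close>, the quotient has size \<open>s ^ (5 + 2 - 8) = 1 / s\<close>, just enough
  to contradict the growth of \<open>f\<close>. Truncated logarithms are continuous, so every mean
  is an ordinary integral and no counting function of zeros appears; Jensen's formula is replaced by
  a lower bound for the means that is uniform in the level of truncation. Hyper-order below 1 makes
  \<open>ln T\<close> sublinear in \<open>r\<close>, so along radii in arithmetic progression
  \<open>T\<close> cannot grow by a fixed factor at every step. Smallness is recorded pointwise, by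
  a function \<open>e\<close> with mean \<open>o(T)\<close> on the circle, because pointwise bounds
  can be multiplied and raised to powers.\<close>

definition cmean :: "(complex \<Rightarrow> real) \<Rightarrow> complex \<Rightarrow> real \<Rightarrow> real" where
  "cmean u z r = 1 / (2 * pi) * integral {0..2 * pi} (\<lambda>t. u (z + of_real r * cis t))"

lemma continuous_on_circle:
  assumes "continuous_on (sphere z r) u" "r \<ge> 0"
  shows "continuous_on A (\<lambda>t. u (z + of_real r * cis t))"
proof -
  have "continuous_on A (\<lambda>t. z + of_real r * cis t)"
    by (intro continuous_intros)
  moreover have "(\<lambda>t. z + of_real r * cis t) ` A \<subseteq> sphere z r"
    using assms(2) by (auto simp: dist_norm norm_mult)
  ultimately show ?thesis
    using assms(1) continuous_on_compose2 by blast
qed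

lemma circle_integrable:
  assumes "continuous_on (sphere z r) u" "r \<ge> 0"
  shows "(\<lambda>t. u (z + of_real r * cis t) :: real) integrable_on {a..b}"
  by (intro integrable_continuous_interval continuous_on_circle assms)

lemma cmean_mono:
  assumes "continuous_on (sphere z r) u" "continuous_on (sphere z r) v" "r \<ge> 0"
    and "\<And>w. w \<in> sphere z r \<Longrightarrow> u w \<le> v w"
  shows "cmean u z r \<le> cmean v z r"
  unfolding cmean_def
proof (intro mult_left_mono integral_le circle_integrable assms(1-3))
  fix t :: real
  show "u (z + of_real r * cis t) \<le> v (z + of_real r * cis t)"
    by (rule assms(4)) (use \<open>r \<ge> 0\<close> in \<open>auto simp: dist_norm norm_mult\<close>)
qed auto

lemma cmean_cong:
  assumes "r \<ge> 0" "\<And>w. w \<in> sphere z r \<Longrightarrow> u w = v w"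
  shows "cmean u z r = cmean v z r"
proof -
  have "(\<lambda>t. u (z + of_real r * cis t)) = (\<lambda>t. v (z + of_real r * cis t))"
    using assms by (intro ext assms(2)) (auto simp: dist_norm norm_mult)
  then show ?thesis by (simp add: cmean_def)
qed

lemma cmean_const [simp]: "cmean (\<lambda>_. c) z r = c"
  by (simp add: cmean_def)

lemma cmean_add:
  assumes "continuous_on (sphere z r) u" "continuous_on (sphere z r) v" "r \<ge> 0"
  shows "cmean (\<lambda>w. u w + v w) z r = cmean u z r + cmean v z r"
  using circle_integrable[OF assms(1,3)] circle_integrable[OF assms(2,3)]
  by (simp add: cmean_def integral_add add_divide_distrib)

lemma cmean_diff:
  assumes "continuous_on (sphere z r) u" "continuous_on (sphere z r) v" "r \<ge> 0"
  shows "cmean (\<lambda>w. u w - v w) z r = cmean u z r - cmean v z r"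
  using circle_integrable[OF assms(1,3)] circle_integrable[OF assms(2,3)]
  by (simp add: cmean_def integral_diff diff_divide_distrib)

lemma cmean_cmult: "cmean (\<lambda>w. c * u w) z r = c * cmean u z r"
  by (simp add: cmean_def)

lemma cmean_sum:
  assumes "finite I" "\<And>i. i \<in> I \<Longrightarrow> continuous_on (sphere z r) (u i)" "r \<ge> 0"
  shows "cmean (\<lambda>w. \<Sum>i\<in>I. u i w) z r = (\<Sum>i\<in>I. cmean (u i) z r)"
  using assms by (induction I) (simp_all add: cmean_add continuous_on_sum)

lemma cmean_nonneg:
  assumes "continuous_on (sphere z r) u" "r \<ge> 0" "\<And>w. w \<in> sphere z r \<Longrightarrow> 0 \<le> u w"
  shows "0 \<le> cmean u z r"
  using cmean_mono[of z r "\<lambda>_. 0" u] assms by simp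

section \<open>Integrals over a period and their Riemann sums\<close>

lemma periodic_integral_aux:
  fixes h :: "real \<Rightarrow> real"
  assumes cont: "continuous_on UNIV h" and per: "\<And>t. h (t + 2 * pi) = h t" and s: "s \<ge> 0"
  shows "integral {s..s + 2 * pi} h = integral {0..2 * pi} h"
proof -
  have ii: "h integrable_on {a..b}" for a b
    by (meson cont continuous_on_subset integrable_continuous_interval subset_UNIV)
  \<comment> \<open>Both decompositions cover \<open>{0..s + 2 * pi}\<close>, and the leftover
    pieces over \<open>{0..s}\<close> and \<open>{2 * pi..s + 2 * pi}\<close> are translates of each
    other.\<close>
  have "integral {0..s} h + integral {s..s + 2 * pi} h = integral {0..s + 2 * pi} h"
    by (rule Henstock_Kurzweil_Integration.integral_combine) (use s ii in auto)
  moreover have "integral {0..2 * pi} h + integral {2 * pi..s + 2 * pi} h = integral {0..s + 2 * pi} h"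
    by (rule Henstock_Kurzweil_Integration.integral_combine) (use s ii in auto)
  moreover have "integral {0..s} (h \<circ> (\<lambda>x. x + 2 * pi)) = integral {0 + 2 * pi..s + 2 * pi} h"
    by (rule integral_shift) (meson cont continuous_on_subset subset_UNIV)
  moreover have "h \<circ> (\<lambda>x. x + 2 * pi) = h"
    using per by (auto simp: o_def)
  ultimately show ?thesis by simp
qed

lemma periodic_integral:
  fixes h :: "real \<Rightarrow> real"
  assumes cont: "continuous_on UNIV h" and per: "\<And>t. h (t + 2 * pi) = h t"
  shows "integral {s..s + 2 * pi} h = integral {0..2 * pi} h"
proof (cases "s \<ge> 0")
  case True
  then show ?thesis using periodic_integral_aux[OF assms] by blast
next
  case False
  \<comment> \<open>For the translate by \<open>s\<close>, the window in question is reached by the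
    positive shift \<open>-s\<close>.\<close>
  define k where "k = (\<lambda>t. h (t + s))"
  have ck: "continuous_on UNIV k"
    unfolding k_def by (intro continuous_on_compose2[OF cont] continuous_intros) auto
  have pk: "k (t + 2 * pi) = k t" for t
    using per[of "t + s"] by (simp add: k_def algebra_simps)
  have sh: "integral {a..b} k = integral {a + s..b + s} h" for a b
    using integral_shift[of a s b h] cont continuous_on_subset by (fastforce simp: k_def o_def)
  show ?thesis
    using periodic_integral_aux[OF ck pk, of "-s"] sh[of 0 "2*pi"] sh[of "-s" "-s + 2*pi"] False
    by (simp add: add.commute)
qed

lemma cmean_shift_angle:
  assumes "continuous_on (sphere z r) u" "r \<ge> 0"
  shows "cmean u z r = 1 / (2 * pi) * integral {0..2 * pi} (\<lambda>t. u (z + of_real r * cis (s + t)))"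
proof -
  define h where "h = (\<lambda>t. u (z + of_real r * cis t))"
  have ch: "continuous_on A h" for A
    unfolding h_def by (rule continuous_on_circle[OF assms])
  have "integral {s..s + 2 * pi} h = integral {0..2 * pi} h"
    by (rule periodic_integral[OF ch]) (simp add: h_def flip: cis_mult)
  moreover have "integral {0..2*pi} (h \<circ> (\<lambda>x. x + s)) = integral {0 + s..2*pi + s} h"
    by (rule integral_shift[OF ch])
  ultimately show ?thesis
    by (simp add: cmean_def h_def o_def add.commute)
qed

lemma cmean_rotate:
  assumes "continuous_on (sphere 0 r) u" "r \<ge> 0"
  shows "cmean (\<lambda>z. u (cis s * z)) 0 r = cmean u 0 r"
  using cmean_shift_angle[OF assms, of s] by (simp add: cmean_def mult_ac flip: cis_mult)

text \<open>Uniform continuity gives one \<open>n\<close> for all starting angles \<open>s\<close>.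
  In \<open>lmax_mono_radius\<close> this bounds an average over \<open>n\<close>-th roots of unity
  at every boundary point at once, as the maximum principle requires.\<close>

lemma riemann_sum_periodic:
  fixes h :: "real \<Rightarrow> real"
  assumes cont: "continuous_on UNIV h" and per: "\<And>t. h (t + 2 * pi) = h t" and e: "e > 0"
  obtains n :: nat where "n > 0"
    "\<And>s. s \<in> {0..2 * pi} \<Longrightarrow>
       \<bar>(\<Sum>j<n. h (s + 2 * pi * j / n)) / n - 1 / (2 * pi) * integral {0..2 * pi} h\<bar> \<le> e"
proof -
  have ii: "h integrable_on {a..b}" for a b
    by (meson cont continuous_on_subset integrable_continuous_interval subset_UNIV)
  \<comment> \<open>The sample points start in \<open>{0..2 * pi}\<close> and run through one
    further period, hence \<open>4 * pi\<close>.\<close>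
  have "uniformly_continuous_on {0..4 * pi} h"
    by (meson cont continuous_on_subset compact_uniformly_continuous compact_Icc subset_UNIV)
  then obtain d where d: "d > 0" "\<And>x y. x \<in> {0..4*pi} \<Longrightarrow> y \<in> {0..4*pi} \<Longrightarrow> dist y x < d \<Longrightarrow> dist (h y) (h x) < e"
    using e unfolding uniformly_continuous_on_def by metis
  obtain n :: nat where n: "n > 2 * pi / d" using reals_Archimedean2 by blast
  with d(1) have n0: "n > 0"
    by (smt (verit) divide_nonneg_pos of_nat_0_less_iff pi_gt_zero)
  define a where "a = 2 * pi / n"
  have a: "a > 0" "a < d" "n * a = 2 * pi"
    using n n0 d(1) by (auto simp: a_def field_simps)
  show ?thesis
  proof (rule that[OF n0])
    fix s assume s: "s \<in> {0..2 * pi}"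
    have split: "integral {s..s + m * a} h = (\<Sum>j<m. integral {s + j * a..s + (j + 1) * a} h)" for m :: nat
    proof (induction m)
      case (Suc m)
      have "integral {s..s + m * a} h + integral {s + m * a..s + Suc m * a} h = integral {s..s + Suc m * a} h"
        by (rule Henstock_Kurzweil_Integration.integral_combine) (use a(1) ii in \<open>auto simp: algebra_simps\<close>)
      then show ?case using Suc by (simp add: add.commute)
    qed simp
    have piece: "\<bar>integral {s + j * a..s + (j + 1) * a} h - a * h (s + j * a)\<bar> \<le> a * e" if j: "j < n" for j :: nat
    proof -
      have ub: "(real j + 1) * a \<le> 2 * pi"
        using j a by (metis Suc_leI add.commute mult_right_mono of_nat_Suc of_nat_mono less_imp_le)
      have "norm (integral {s + j * a..s + (j + 1) * a} (\<lambda>t. h t - h (s + j * a)))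
              \<le> e * ((s + (j + 1) * a) - (s + j * a))"
      proof (rule integral_bound)
        show "s + j * a \<le> s + (j + 1) * a" using a by (simp add: algebra_simps)
        show "continuous_on {s + j * a..s + (j + 1) * a} (\<lambda>t. h t - h (s + j * a))"
          by (intro continuous_intros continuous_on_subset[OF cont]) auto
        fix t assume t: "t \<in> {s + j * a..s + (j + 1) * a}"
        have "dist (h t) (h (s + j * a)) < e"
        proof (rule d(2))
          have "0 \<le> real j * a" using a by simp
          with ub s t a show "s + real j * a \<in> {0..4 * pi}"
            unfolding atLeastAtMost_iff distrib_right by linarith
          from \<open>0 \<le> real j * a\<close> ub s t a show "t \<in> {0..4 * pi}"
            unfolding atLeastAtMost_iff of_nat_add of_nat_1 distrib_right by linarith
          show "dist t (s + real j * a) < d"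
            using t a by (auto simp: dist_real_def algebra_simps)
        qed
        then show "norm (h t - h (s + j * a)) \<le> e" by (simp add: dist_real_def)
      qed
      moreover have "integral {s + j * a..s + (j + 1) * a} (\<lambda>t. h t - h (s + j * a))
          = integral {s + j * a..s + (j + 1) * a} h - a * h (s + j * a)"
        using ii a by (subst integral_diff) (auto simp: algebra_simps)
      ultimately show ?thesis by (simp add: algebra_simps)
    qed
    have "integral {0..2 * pi} h = integral {s..s + n * a} h"
      using periodic_integral[OF cont per, of s] a by simp
    also have "\<dots> = (\<Sum>j<n. integral {s + j * a..s + (j + 1) * a} h)"
      by (rule split)
    finally have "\<bar>integral {0..2 * pi} h - (\<Sum>j<n. a * h (s + j * a))\<bar>
        = \<bar>\<Sum>j<n. integral {s + j * a..s + (j + 1) * a} h - a * h (s + j * a)\<bar>"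
      by (simp add: sum_subtractf)
    also have "\<dots> \<le> (\<Sum>j<n. a * e)"
      by (rule order_trans[OF sum_abs sum_mono]) (use piece in auto)
    also have "\<dots> = 2 * pi * e" using a by simp
    finally have *: "\<bar>integral {0..2 * pi} h - a * (\<Sum>j<n. h (s + j * a))\<bar> \<le> 2 * pi * e"
      by (simp add: sum_distrib_left)
    have "(\<Sum>j<n. h (s + 2 * pi * j / n)) = (\<Sum>j<n. h (s + j * a))"
      by (simp add: a_def mult_ac)
    then have "(\<Sum>j<n. h (s + 2 * pi * j / n)) / n - 1 / (2 * pi) * integral {0..2 * pi} h
       = - (integral {0..2 * pi} h - a * (\<Sum>j<n. h (s + j * a))) / (2 * pi)"
      using n0 by (simp add: a_def field_simps)
    then show "\<bar>(\<Sum>j<n. h (s + 2 * pi * j / n)) / n - 1 / (2 * pi) * integral {0..2 * pi} h\<bar> \<le> e"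
      using * by (simp add: abs_minus_commute field_simps)
  qed
qed

section \<open>Truncated logarithms and Harnack's inequality\<close>

text \<open>For holomorphic \<open>f\<close> this is subharmonic, and it stays continuous at the
  zeros of \<open>f\<close>. For \<open>\<epsilon> = 1\<close> it is the positive part of
  \<open>ln |f|\<close>.\<close>

definition lmax :: "real \<Rightarrow> (complex \<Rightarrow> complex) \<Rightarrow> complex \<Rightarrow> real" where
  "lmax \<epsilon> f z = ln (max (norm (f z)) \<epsilon>)"

lemma continuous_on_lmax [continuous_intros]:
  assumes "continuous_on S f" "\<epsilon> > 0"
  shows "continuous_on S (lmax \<epsilon> f)"
proof -
  have "continuous_on S (\<lambda>z. ln (max (norm (f z)) \<epsilon>))"
    by (intro continuous_intros assms(1)) (use assms(2) in \<open>auto simp: max_def\<close>)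
  then show ?thesis by (simp add: lmax_def[abs_def])
qed

lemma exp_lmax: "\<epsilon> > 0 \<Longrightarrow> exp (lmax \<epsilon> f z) = max (norm (f z)) \<epsilon>"
  by (simp add: lmax_def less_max_iff_disj)

text \<open>The integral over the circle is replaced by the sum over \<open>n\<close> rotated points
  \<open>om j * z\<close>. At a given \<open>z\<close> that sum is \<open>ln |F z|\<close> for a
  holomorphic \<open>F\<close> with \<open>ln |F|\<close> below the sum everywhere, so the maximum
  modulus principle moves the bound from the boundary to \<open>z\<close>.\<close>

lemma lmax_mono_radius:
  assumes hol: "f holomorphic_on ball 0 R" and cont: "continuous_on (cball 0 R) f"
    and R: "0 \<le> t" "t \<le> R" "0 < R" and eps: "\<epsilon> > 0"
  shows "cmean (lmax \<epsilon> f) 0 t \<le> cmean (lmax \<epsilon> f) 0 R"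
proof (rule field_le_epsilon)
  fix e :: real assume e: "e > 0"
  have cl: "continuous_on (sphere 0 s) (lmax \<epsilon> f)" if "s \<le> R" for s
    by (intro continuous_intros eps continuous_on_subset[OF cont]) (use that in auto)
  define h where "h = (\<lambda>s. lmax \<epsilon> f (of_real R * cis s))"
  have ch: "continuous_on UNIV h"
    using continuous_on_circle[OF cl, of R UNIV] R by (simp add: h_def)
  have ph: "h (s + 2 * pi) = h s" for s
    by (simp add: h_def flip: cis_mult)
  obtain n :: nat where n: "n > 0" "\<And>s. s \<in> {0..2 * pi} \<Longrightarrow>
       \<bar>(\<Sum>j<n. h (s + 2 * pi * j / n)) / n - 1 / (2 * pi) * integral {0..2 * pi} h\<bar> \<le> e"
    using riemann_sum_periodic[OF ch ph e] by blast
  define om where "om = (\<lambda>j::nat. cis (2 * pi * j / n))"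
  define B where "B = n * (cmean (lmax \<epsilon> f) 0 R + e)"
  have bd: "(\<Sum>j<n. lmax \<epsilon> f (om j * w)) \<le> B" if w: "norm w = R" for w
  proof -
    obtain s where s: "0 \<le> s" "s < 2 * pi" "w = R * cis s"
      using w Arg2pi[of w] by (metis cis_conv_exp is_Arg_def)
    have "om j * w = R * cis (s + 2 * pi * j / n)" for j
      by (simp add: om_def s mult_ac cis_mult add_ac)
    then have "(\<Sum>j<n. lmax \<epsilon> f (om j * w)) = (\<Sum>j<n. h (s + 2 * pi * j / n))"
      by (simp add: h_def)
    also have "\<dots> \<le> B"
      using n(2)[of s] n(1) s by (simp add: B_def cmean_def h_def abs_le_iff field_simps)
    finally show ?thesis .
  qed
  have main: "(\<Sum>j<n. lmax \<epsilon> f (om j * z)) \<le> B" if z: "norm z \<le> R" for z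
  proof -
    \<comment> \<open>The factors above the level at this particular \<open>z\<close> are kept and
      the others replaced by \<open>\<epsilon>\<close>; this gives equality at \<open>z\<close> and
      an inequality elsewhere.\<close>
    define S where "S = {j. j < n \<and> norm (f (om j * z)) \<ge> \<epsilon>}"
    define F where "F = (\<lambda>w. of_real \<epsilon> ^ (n - card S) * (\<Prod>j\<in>S. f (om j * w)))"
    have S: "S \<subseteq> {..<n}" "finite S" by (auto simp: S_def)
    have cardS: "card ({..<n} - S) = n - card S" using S by (simp add: card_Diff_subset)
    have nom: "norm (om j) = 1" for j by (simp add: om_def)
    have prod: "exp (\<Sum>j<n. lmax \<epsilon> f (om j * w)) = (\<Prod>j<n. max (norm (f (om j * w))) \<epsilon>)" for w
      by (simp add: exp_sum exp_lmax eps)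
    have split: "(\<Prod>j<n. max (norm (f (om j * w))) \<epsilon>)
        = (\<Prod>j\<in>{..<n} - S. max (norm (f (om j * w))) \<epsilon>) * (\<Prod>j\<in>S. max (norm (f (om j * w))) \<epsilon>)" for w
      using S by (subst prod.subset_diff[of S]) auto
    have le: "norm (F w) \<le> exp (\<Sum>j<n. lmax \<epsilon> f (om j * w))" for w
    proof -
      have "\<epsilon> ^ (n - card S) = (\<Prod>j\<in>{..<n} - S. \<epsilon>)" using cardS by simp
      also have "\<dots> \<le> (\<Prod>j\<in>{..<n} - S. max (norm (f (om j * w))) \<epsilon>)"
        using eps by (intro prod_mono) auto
      finally have 1: "\<epsilon> ^ (n - card S) \<le> (\<Prod>j\<in>{..<n} - S. max (norm (f (om j * w))) \<epsilon>)" .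
      have 2: "(\<Prod>j\<in>S. norm (f (om j * w))) \<le> (\<Prod>j\<in>S. max (norm (f (om j * w))) \<epsilon>)"
        by (intro prod_mono) auto
      show ?thesis
        unfolding prod split F_def norm_mult
        using eps by (auto simp: norm_power prod_norm[symmetric] intro!: mult_mono 1 2 prod_nonneg)
    qed
    have eq: "norm (F z) = exp (\<Sum>j<n. lmax \<epsilon> f (om j * z))"
    proof -
      have "(\<Prod>j\<in>{..<n} - S. max (norm (f (om j * z))) \<epsilon>) = (\<Prod>j\<in>{..<n} - S. \<epsilon>)"
        by (intro prod.cong) (auto simp: S_def)
      moreover have "(\<Prod>j\<in>S. max (norm (f (om j * z))) \<epsilon>) = (\<Prod>j\<in>S. norm (f (om j * z)))"
        by (intro prod.cong) (auto simp: S_def)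
      ultimately show ?thesis
        unfolding prod split F_def norm_mult using eps cardS by (simp add: norm_power prod_norm)
    qed
    have "norm (F z) \<le> exp B"
    proof (rule maximum_modulus_frontier[where S = "cball 0 R" and f = F and \<xi> = z])
      have im: "(\<lambda>w. om j * w) ` ball 0 R \<subseteq> ball 0 R" for j
        by (auto simp: norm_mult nom)
      have "(f \<circ> (\<lambda>w. om j * w)) holomorphic_on ball 0 R" for j
        by (rule holomorphic_on_compose_gen[OF _ hol im]) (intro holomorphic_intros)
      then show "F holomorphic_on interior (cball 0 R)"
        unfolding F_def by (auto simp: o_def intro!: holomorphic_intros)
      show "continuous_on (closure (cball 0 R)) F"
        unfolding F_def
        by (simp, intro continuous_intros continuous_on_compose2[OF cont])
           (auto simp: norm_mult nom)
      fix w assume "w \<in> frontier (cball (0::complex) R)"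
      then have "norm w = R" using R by simp
      then show "norm (F w) \<le> exp B"
        using le[of w] bd[of w] by (meson exp_le_cancel_iff order_trans)
    qed (use z in auto)
    then show ?thesis using eq by simp
  qed
  \<comment> \<open>Each rotation preserves the mean over the circle of radius
    \<open>t\<close>.\<close>
  have "n * cmean (lmax \<epsilon> f) 0 t = (\<Sum>j<n. cmean (\<lambda>z. lmax \<epsilon> f (om j * z)) 0 t)"
    unfolding om_def using R by (subst cmean_rotate[OF cl]) auto
  also have "\<dots> = cmean (\<lambda>z. \<Sum>j<n. lmax \<epsilon> f (om j * z)) 0 t"
    using R by (subst cmean_sum) (auto intro!: continuous_on_compose2[OF cl[of t]] continuous_intros simp: om_def norm_mult)
  also have "\<dots> \<le> cmean (\<lambda>_. B) 0 t"
    using R main by (intro cmean_mono) (auto intro!: continuous_on_compose2[OF cl[of t]] continuous_intros simp: om_def norm_mult)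
  finally have "n * cmean (lmax \<epsilon> f) 0 t \<le> B" by simp
  then show "cmean (lmax \<epsilon> f) 0 t \<le> cmean (lmax \<epsilon> f) 0 R + e"
    using n(1) by (simp add: B_def)
qed

section \<open>The Moebius change of variable on the circle\<close>

definition moebius_disc :: "complex \<Rightarrow> complex \<Rightarrow> complex" where
  "moebius_disc w s = (s + w) / (1 + cnj w * s)"

lemma moebius_disc_denom_nz:
  assumes "norm w < 1" "norm s \<le> 1"
  shows "1 + cnj w * s \<noteq> 0"
proof
  assume "1 + cnj w * s = 0"
  then have "norm (cnj w * s) = 1"
    by (metis add_eq_0_iff norm_minus_cancel norm_one)
  moreover have "norm (cnj w * s) \<le> norm w * 1"
    unfolding norm_mult complex_mod_cnj using assms(2) by (intro mult_left_mono) auto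
  ultimately show False using assms(1) by simp
qed

text \<open>On the unit circle the automorphism is a change of the angle whose derivative is the
  Poisson kernel.\<close>

lemma moebius_mean_le:
  fixes v :: "complex \<Rightarrow> real"
  assumes v: "continuous_on (sphere 0 1) v" and w: "norm w \<le> k" "k < 1"
  shows "cmean (\<lambda>s. v (moebius_disc w s)) 0 1 \<le> cmean v 0 1 + 2 * k / (1 - k) * cmean (\<lambda>s. \<bar>v s\<bar>) 0 1"
proof -
  define y where "y = (\<lambda>t. w * cis (- t))"
  \<comment> \<open>With \<open>q = 1 + y t\<close>, the automorphism sends \<open>cis t\<close> to
    \<open>cis t * q / cnj q\<close>, and \<open>2 * Im (Ln q)\<close> is an argument of
    \<open>q / cnj q\<close>. As \<open>Re q > 0\<close>, the branch cut is avoided and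
    \<open>\<psi>\<close> is a smooth lift of the angle.\<close>
  define \<psi> where "\<psi> = (\<lambda>t. t + 2 * Im (Ln (1 + y t)))"
  define \<psi>' where "\<psi>' = (\<lambda>t. 1 - 2 * Re (y t / (1 + y t)))"
  define \<delta> where "\<delta> = 2 * k / (1 - k)"
  have k: "0 \<le> k" using w norm_ge_zero order_trans by blast
  have ny: "norm (y t) \<le> k" for t using w by (simp add: y_def norm_mult)
  have Re_pos: "Re (1 + y t) > 0" for t
    using abs_Re_le_cmod[of "y t"] ny[of t] w by simp
  have nz: "1 + y t \<noteq> 0" for t
    using Re_pos[of t] by (metis less_irrefl zero_complex.sel(1))
  have nr: "1 + y t \<notin> \<real>\<^sub>\<le>\<^sub>0" for t
    using Re_pos[of t] by (auto simp: complex_nonpos_Reals_iff)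
  have cis_psi: "cis (\<psi> t) = moebius_disc w (cis t)" for t
  proof -
    define q where "q = 1 + y t"
    have "exp (Ln q) = q" using nz by (simp add: q_def)
    then have "exp (cnj (Ln q)) = cnj q" by (metis exp_cnj)
    moreover have "Ln q - cnj (Ln q) = \<i> * complex_of_real (2 * Im (Ln q))"
      by (simp add: complex_eq_iff)
    ultimately have "cis (2 * Im (Ln q)) = q / cnj q"
      using \<open>exp (Ln q) = q\<close> by (metis cis_conv_exp exp_diff)
    then have "cis (\<psi> t) = cis t * q / cnj q"
      by (simp add: \<psi>_def q_def flip: cis_mult)
    also have "cis t * q = cis t + w"
      by (simp add: q_def y_def algebra_simps cis_mult)
    also have "cnj q = 1 + cnj w * cis t"
      by (simp add: q_def y_def cis_cnj)
    finally show ?thesis by (simp add: moebius_disc_def)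
  qed
  have der: "(\<psi> has_field_derivative \<psi>' t) (at t within A)" for t A
  proof -
    define G where "G = (\<lambda>\<zeta>. Ln (1 + w * exp (- (\<i> * \<zeta>))))"
    have yt: "y t = w * exp (- (\<i> * of_real t))" for t
      by (simp add: y_def cis_conv_exp)
    have "(G has_field_derivative - \<i> * (y t / (1 + y t))) (at (of_real t))"
      unfolding G_def using nr[of t] nz[of t]
      by (auto intro!: derivative_eq_intros simp: yt field_simps)
    then have "((\<lambda>t. G (of_real t)) has_vector_derivative - \<i> * (y t / (1 + y t))) (at t within A)"
      by (rule has_vector_derivative_real_field)
    then have "((\<lambda>t. Im (G (of_real t))) has_field_derivative Im (- \<i> * (y t / (1 + y t)))) (at t within A)"
      by (rule has_field_derivative_Im)
    then have "((\<lambda>t. t + 2 * Im (G (of_real t))) has_field_derivative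
                  1 + 2 * Im (- \<i> * (y t / (1 + y t)))) (at t within A)"
      by (rule DERIV_add[OF DERIV_ident DERIV_cmult])
    moreover have "1 + 2 * Im (- \<i> * (y t / (1 + y t))) = \<psi>' t"
      by (simp only: \<psi>'_def) (simp del: times_divide_eq_right)
    moreover have "(\<lambda>t. t + 2 * Im (G (of_real t))) = \<psi>" by (simp add: \<psi>_def G_def yt)
    ultimately show ?thesis by metis
  qed
  have cont_psi: "continuous_on A \<psi>" for A
    by (rule DERIV_continuous_on[OF der])
  \<comment> \<open>\<open>\<psi>'\<close> is the Poisson kernel
    \<open>(1 - |Y|^2) / |1 + Y|^2\<close>. Measuring its deviation from 1 relative to
    \<open>\<psi>'\<close> itself allows the substitution to be applied to the error term as
    well.\<close>
  have dbound: "\<bar>1 - \<psi>' t\<bar> \<le> \<delta> * \<psi>' t" for t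
  proof -
    define Y where "Y = y t"
    define m where "m = (norm (1 + Y))\<^sup>2"
    have m: "m > 0" using nz[of t] by (simp add: m_def Y_def)
    have m_eq: "m = 1 + 2 * Re Y + (norm Y)\<^sup>2"
      unfolding m_def cmod_power2 by (simp add: power2_eq_square algebra_simps)
    have r: "Re (Y / (1 + Y)) = (Re Y + (norm Y)\<^sup>2) / m"
      unfolding m_def cmod_power2 Re_divide by (simp add: power2_eq_square algebra_simps)
    have 1: "1 - \<psi>' t = 2 * (Re Y + (norm Y)\<^sup>2) / m"
      by (simp add: \<psi>'_def r flip: Y_def)
    have 2: "\<psi>' t = (1 - (norm Y)\<^sup>2) / m"
      using 1 m m_eq by (simp add: field_simps)
    have nY: "norm Y \<le> k" using ny by (simp add: Y_def)
    have "\<bar>2 * (Re Y + (norm Y)\<^sup>2)\<bar> \<le> 2 * norm Y * (1 + norm Y)"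
    proof -
      have "\<bar>Re Y + (norm Y)\<^sup>2\<bar> \<le> \<bar>Re Y\<bar> + (norm Y)\<^sup>2" using abs_triangle_ineq[of "Re Y" "(norm Y)\<^sup>2"] by simp
      also have "\<dots> \<le> norm Y * (1 + norm Y)"
        using abs_Re_le_cmod[of Y] by (simp add: power2_eq_square algebra_simps)
      finally show ?thesis by (simp add: abs_mult mult.assoc)
    qed
    also have "\<dots> = 2 * norm Y / (1 - norm Y) * (1 - (norm Y)\<^sup>2)"
      using nY w by (simp add: field_simps power2_eq_square)
    also have "\<dots> \<le> \<delta> * (1 - (norm Y)\<^sup>2)"
      unfolding \<delta>_def using nY w
      by (intro mult_right_mono frac_le) (auto simp: abs_square_le_1 k)
    finally have "\<bar>2 * (Re Y + (norm Y)\<^sup>2)\<bar> \<le> \<delta> * (1 - (norm Y)\<^sup>2)" .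
    then show ?thesis
      unfolding 1 unfolding 2 abs_divide using m by (simp add: divide_right_mono)
  qed
  have subst: "((\<lambda>t. \<psi>' t * h (cis (\<psi> t))) has_integral integral {0..2 * pi} (\<lambda>t. h (cis t))) {0..2 * pi}"
    if h: "continuous_on (sphere 0 1) h" for h :: "complex \<Rightarrow> real"
  proof -
    have ch: "continuous_on A (\<lambda>t. h (cis t))" for A
      using continuous_on_circle[OF h, of A] by simp
    have per: "\<psi> (2 * pi) = \<psi> 0 + 2 * pi" by (simp add: \<psi>_def y_def flip: cis_inverse)
    have "compact (\<psi> ` {0..2 * pi})"
      by (rule compact_continuous_image[OF cont_psi compact_Icc])
    then obtain B where B0: "\<forall>t\<in>\<psi> ` {0..2 * pi}. norm t \<le> B"
      by (meson bounded_iff compact_imp_bounded)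
    have B: "\<psi> ` {0..2 * pi} \<subseteq> {-B..B}"
    proof
      fix t assume "t \<in> \<psi> ` {0..2 * pi}"
      with B0 have "norm t \<le> B" by (rule bspec)
      then show "t \<in> {-B..B}" by (simp add: abs_le_iff minus_le_iff)
    qed
    have "((\<lambda>t. \<psi>' t *\<^sub>R h (cis (\<psi> t))) has_integral integral {\<psi> 0..\<psi> (2 * pi)} (\<lambda>t. h (cis t))) {0..2 * pi}"
      by (rule has_integral_substitution[where c = "-B" and d = B, OF _ _ B ch der])
         (auto simp: per)
    moreover have "integral {\<psi> 0..\<psi> 0 + 2 * pi} (\<lambda>t. h (cis t)) = integral {0..2 * pi} (\<lambda>t. h (cis t))"
      by (rule periodic_integral[OF ch]) (simp flip: cis_mult)
    ultimately show ?thesis by (simp add: per)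
  qed
  have cv: "continuous_on (sphere 0 1) (\<lambda>s. \<bar>v s\<bar>)" by (intro continuous_intros v)
  have I: "((\<lambda>t. \<psi>' t * v (cis (\<psi> t)) + \<delta> * (\<psi>' t * \<bar>v (cis (\<psi> t))\<bar>)) has_integral
        integral {0..2 * pi} (\<lambda>t. v (cis t)) + \<delta> * integral {0..2 * pi} (\<lambda>t. \<bar>v (cis t)\<bar>)) {0..2 * pi}"
    by (rule has_integral_add[OF subst[OF v] has_integral_mult_right[OF subst[OF cv]]])
  have "integral {0..2 * pi} (\<lambda>t. v (cis (\<psi> t)))
      \<le> integral {0..2 * pi} (\<lambda>t. v (cis t)) + \<delta> * integral {0..2 * pi} (\<lambda>t. \<bar>v (cis t)\<bar>)"
  proof (rule has_integral_le[OF _ I])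
    have "continuous_on {0..2 * pi} (\<lambda>t. v (cis (\<psi> t)))"
      by (rule continuous_on_compose2[OF v continuous_on_compose2[OF _ cont_psi]])
         (auto intro!: continuous_intros)
    then show "((\<lambda>t. v (cis (\<psi> t))) has_integral integral {0..2 * pi} (\<lambda>t. v (cis (\<psi> t)))) {0..2 * pi}"
      by (meson integrable_continuous_interval integrable_integral)
    fix t
    define a where "a = v (cis (\<psi> t))"
    have "a * (1 - \<psi>' t) \<le> \<bar>a\<bar> * \<bar>1 - \<psi>' t\<bar>" by (metis abs_ge_self abs_mult)
    also have "\<dots> \<le> \<bar>a\<bar> * (\<delta> * \<psi>' t)" by (intro mult_left_mono dbound) auto
    finally show "v (cis (\<psi> t)) \<le> \<psi>' t * v (cis (\<psi> t)) + \<delta> * (\<psi>' t * \<bar>v (cis (\<psi> t))\<bar>)"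
      by (simp add: a_def algebra_simps)
  qed
  from divide_right_mono[OF this, of "2 * pi"] show ?thesis
    by (simp add: cmean_def cis_psi \<delta>_def add_divide_distrib)
qed

text \<open>The Moebius map carrying 0 to \<open>v / \<rho>\<close> turns the value at
  \<open>z + v\<close> into one at the centre, which is at most the mean over the unit circle.
  Undoing the change of angle costs the deviation of the Poisson kernel from 1, weighted by the
  absolute value since the function has no sign.\<close>

lemma lmax_le_cmean:
  assumes hol: "X holomorphic_on UNIV" and eps: "\<epsilon> > 0" and v: "norm v \<le> K" "K < \<rho>"
  shows "lmax \<epsilon> X (z + v) \<le> cmean (lmax \<epsilon> X) z \<rho> + 2 * K / (\<rho> - K) * cmean (\<lambda>w. \<bar>lmax \<epsilon> X w\<bar>) z \<rho>"
proof -
  have K: "0 \<le> K" "0 < \<rho>" using v norm_ge_zero order_trans by (blast, smt (verit) norm_ge_zero)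
  define w where "w = v / of_real \<rho>"
  have w: "norm w \<le> K / \<rho>" "K / \<rho> < 1" "norm w < 1"
    using v K by (auto simp: w_def norm_divide divide_simps)
  define F where "F = (\<lambda>s. X (z + of_real \<rho> * moebius_disc w s))"
  have holF: "F holomorphic_on cball 0 1"
  proof -
    have "(X \<circ> (\<lambda>s. z + of_real \<rho> * moebius_disc w s)) holomorphic_on cball 0 1"
      unfolding moebius_disc_def
      by (rule holomorphic_on_compose_gen[OF _ hol])
         (use w moebius_disc_denom_nz in \<open>auto intro!: holomorphic_intros\<close>)
    then show ?thesis by (simp add: F_def o_def)
  qed
  have cu: "continuous_on A (lmax \<epsilon> X)" for A
    using holomorphic_on_imp_continuous_on[OF hol] continuous_on_subset eps
    by (blast intro: continuous_on_lmax)
  define u where "u = (\<lambda>s. lmax \<epsilon> X (z + of_real \<rho> * s))"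
  \<comment> \<open>The mean over a circle of radius 0 is the value at the centre, so monotonicity
    between the radii 0 and 1 is the sub-mean-value inequality.\<close>
  have "lmax \<epsilon> X (z + v) = cmean (lmax \<epsilon> F) 0 0"
    using K by (simp add: cmean_def lmax_def F_def moebius_disc_def w_def)
  also have "\<dots> \<le> cmean (lmax \<epsilon> F) 0 1"
    by (rule lmax_mono_radius) (use holF eps holomorphic_on_subset holomorphic_on_imp_continuous_on in auto)
  also have "\<dots> = cmean (\<lambda>s. u (moebius_disc w s)) 0 1"
    by (intro cmean_cong) (auto simp: u_def F_def lmax_def)
  also have "\<dots> \<le> cmean u 0 1 + 2 * (K / \<rho>) / (1 - K / \<rho>) * cmean (\<lambda>s. \<bar>u s\<bar>) 0 1"
    by (intro moebius_mean_le w)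
       (auto simp: u_def intro!: continuous_intros continuous_on_compose2[OF cu[of UNIV]])
  also have "2 * (K / \<rho>) / (1 - K / \<rho>) = 2 * K / (\<rho> - K)"
    using K v by (simp add: field_simps)
  finally show ?thesis
    by (simp add: u_def cmean_def)
qed

section \<open>Iterated circle means\<close>

lemma continuous_on_cmean:
  assumes "continuous_on UNIV u"
  shows "continuous_on A (\<lambda>z. cmean u z \<rho>)"
proof -
  have "continuous_on A (\<lambda>z. integral (cbox 0 (2 * pi)) (\<lambda>t. u (z + of_real \<rho> * cis t)))"
    by (rule integral_continuous_on_param)
       (auto intro!: continuous_intros continuous_on_compose2[OF assms] simp: case_prod_unfold)
  then show ?thesis
    by (auto simp: cmean_def intro!: continuous_intros)
qed

text \<open>Turning the inner angle by the outer one pulls out the factor \<open>cis s\<close>;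
  exchanging the integrals then leaves only means over circles about 0. These are monotone in the
  radius for truncated logarithms, unlike means about moving centres.\<close>

lemma cmean_cmean:
  assumes u: "continuous_on UNIV u" and \<rho>: "\<rho> \<ge> 0"
  shows "cmean (\<lambda>z. cmean u z \<rho>) 0 r
     = 1 / (2 * pi) * integral {0..2 * pi} (\<lambda>t. cmean u 0 (norm (of_real r + of_real \<rho> * cis t)))"
proof -
  define I where "I = (\<lambda>f. integral {0..2 * pi} f :: real)"
  have c2: "continuous_on B (\<lambda>(s, t). u (cis s * (of_real r + of_real \<rho> * cis t)))" for B
    by (auto intro!: continuous_intros continuous_on_compose2[OF u] simp: case_prod_unfold)
  have 1: "cmean u (of_real r * cis s) \<rho> = 1 / (2 * pi) * I (\<lambda>t. u (cis s * (of_real r + of_real \<rho> * cis t)))" for s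
  proof -
    have "cmean u (of_real r * cis s) \<rho> = 1 / (2 * pi) * I (\<lambda>t. u (of_real r * cis s + of_real \<rho> * cis (s + t)))"
      unfolding I_def
      by (rule cmean_shift_angle) (auto intro!: continuous_on_subset[OF u] \<rho>)
    moreover have "of_real r * cis s + of_real \<rho> * cis (s + t) = cis s * (of_real r + of_real \<rho> * cis t)" for t
      by (simp add: distrib_left mult_ac flip: cis_mult)
    ultimately show ?thesis by simp
  qed
  have 2: "cmean u 0 (norm (of_real r + of_real \<rho> * cis t)) = 1 / (2 * pi) * I (\<lambda>s. u (cis s * (of_real r + of_real \<rho> * cis t)))" for t
  proof -
    define p where "p = complex_of_real r + of_real \<rho> * cis t"
    have "of_real (norm p) * cis (Arg p) = p" by (metis rcis_cmod_Arg rcis_def)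
    then have "cis s * p = of_real (norm p) * cis (Arg p + s)" for s
      by (simp only: cis_mult[symmetric] mult.assoc[symmetric]) (rule mult.commute)
    moreover have "cmean u 0 (norm p) = 1 / (2 * pi) * I (\<lambda>t. u (0 + of_real (norm p) * cis (Arg p + t)))"
      unfolding I_def by (rule cmean_shift_angle) (auto intro!: continuous_on_subset[OF u])
    ultimately show ?thesis by (simp flip: p_def)
  qed
  have "I (\<lambda>s. I (\<lambda>t. u (cis s * (of_real r + of_real \<rho> * cis t)))) = I (\<lambda>t. I (\<lambda>s. u (cis s * (of_real r + of_real \<rho> * cis t))))"
    using integral_swap_continuous[of 0 0 "2*pi" "2*pi" "\<lambda>s t. u (cis s * (of_real r + of_real \<rho> * cis t))"] c2
    by (simp add: I_def)
  then show ?thesis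
    unfolding 2 by (simp add: cmean_def[of "\<lambda>z. cmean u z \<rho>"] 1 flip: I_def) (simp add: I_def)
qed

section \<open>Orders of zeros\<close>

text \<open>Order at least \<open>m\<close>, the zero function included: this is what is asked of
  numerators. Denominators need the exact order, \<open>zero_order\<close>.\<close>

definition vanishes_to :: "nat \<Rightarrow> complex \<Rightarrow> (complex \<Rightarrow> complex) \<Rightarrow> bool" where
  "vanishes_to m z0 X \<longleftrightarrow>
     (\<exists>h. h analytic_on {z0} \<and> (\<forall>\<^sub>F z in nhds z0. X z = (z - z0) ^ m * h z))"

definition zero_order :: "nat \<Rightarrow> complex \<Rightarrow> (complex \<Rightarrow> complex) \<Rightarrow> bool" where
  "zero_order m z0 X \<longleftrightarrow>
     (\<exists>h. h analytic_on {z0} \<and> h z0 \<noteq> 0 \<and> (\<forall>\<^sub>F z in nhds z0. X z = (z - z0) ^ m * h z))"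

lemma zero_order_imp_vanishes_to: "zero_order m z0 X \<Longrightarrow> vanishes_to m z0 X"
  by (auto simp: zero_order_def vanishes_to_def)

lemma vanishes_to_mult:
  assumes "vanishes_to m z0 X" "vanishes_to n z0 Y"
  shows "vanishes_to (m + n) z0 (\<lambda>z. X z * Y z)"
proof -
  obtain h where h: "h analytic_on {z0}" "\<forall>\<^sub>F z in nhds z0. X z = (z - z0) ^ m * h z"
    using assms(1) by (auto simp: vanishes_to_def)
  obtain k where k: "k analytic_on {z0}" "\<forall>\<^sub>F z in nhds z0. Y z = (z - z0) ^ n * k z"
    using assms(2) by (auto simp: vanishes_to_def)
  have "\<forall>\<^sub>F z in nhds z0. X z * Y z = (z - z0) ^ (m + n) * (h z * k z)"
    using h(2) k(2) by eventually_elim (simp add: power_add mult_ac)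
  then show ?thesis
    unfolding vanishes_to_def using h(1) k(1) analytic_on_mult by blast
qed

lemma zero_order_mult:
  assumes "zero_order m z0 X" "zero_order n z0 Y"
  shows "zero_order (m + n) z0 (\<lambda>z. X z * Y z)"
proof -
  obtain h where h: "h analytic_on {z0}" "h z0 \<noteq> 0" "\<forall>\<^sub>F z in nhds z0. X z = (z - z0) ^ m * h z"
    using assms(1) by (auto simp: zero_order_def)
  obtain k where k: "k analytic_on {z0}" "k z0 \<noteq> 0" "\<forall>\<^sub>F z in nhds z0. Y z = (z - z0) ^ n * k z"
    using assms(2) by (auto simp: zero_order_def)
  have "\<forall>\<^sub>F z in nhds z0. X z * Y z = (z - z0) ^ (m + n) * (h z * k z)"
    using h(3) k(3) by eventually_elim (simp add: power_add mult_ac)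
  then show ?thesis
    unfolding zero_order_def using h(1,2) k(1,2)
    by (intro exI[of _ "\<lambda>z. h z * k z"]) (auto intro: analytic_on_mult)
qed

lemma vanishes_to_0: "X analytic_on {z0} \<Longrightarrow> vanishes_to 0 z0 X"
  by (auto simp: vanishes_to_def)

lemma zero_order_0: "X analytic_on {z0} \<Longrightarrow> X z0 \<noteq> 0 \<Longrightarrow> zero_order 0 z0 X"
  by (auto simp: zero_order_def)

lemma vanishes_to_power: "vanishes_to m z0 X \<Longrightarrow> vanishes_to (k * m) z0 (\<lambda>z. X z ^ k)"
proof (induction k)
  case 0
  show ?case by (simp add: vanishes_to_0)
next
  case (Suc k)
  then show ?case using vanishes_to_mult[of m z0 X "k * m" "\<lambda>z. X z ^ k"] by simp
qed

lemma zero_order_power: "zero_order m z0 X \<Longrightarrow> zero_order (k * m) z0 (\<lambda>z. X z ^ k)"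
proof (induction k)
  case 0
  show ?case by (simp add: zero_order_0)
next
  case (Suc k)
  then show ?case using zero_order_mult[of m z0 X "k * m" "\<lambda>z. X z ^ k"] by simp
qed

lemma entire_imp_analytic_at: "X holomorphic_on UNIV \<Longrightarrow> X analytic_on {z0}"
  by (simp add: analytic_on_holomorphic) blast

lemma zero_order_exists:
  assumes hol: "X holomorphic_on UNIV" and nz: "X z1 \<noteq> 0"
  obtains m where "zero_order m z0 X" "m > 0 \<longleftrightarrow> X z0 = 0"
proof (cases "X z0 = 0")
  case True
  then have "\<not> X constant_on UNIV" using nz by (metis UNIV_I constant_on_def)
  then obtain g r n where g: "0 < n" "0 < r" "g holomorphic_on ball z0 r"
    "\<And>w. w \<in> ball z0 r \<Longrightarrow> X w = (w - z0) ^ n * g w" "\<And>w. w \<in> ball z0 r \<Longrightarrow> g w \<noteq> 0"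
    by (rule holomorphic_factor_zero_nonconstant[OF hol open_UNIV connected_UNIV UNIV_I True]) blast
  have "\<forall>\<^sub>F w in nhds z0. w \<in> ball z0 r"
    using g(2) by (intro eventually_nhds_in_open) auto
  then have "\<forall>\<^sub>F w in nhds z0. X w = (w - z0) ^ n * g w"
    by eventually_elim (rule g(4))
  moreover have "g analytic_on {z0}"
    using g(2,3) by (meson analytic_at centre_in_ball open_ball)
  ultimately have "zero_order n z0 X"
    using g(2,5) by (auto simp: zero_order_def)
  then show ?thesis using that g(1) True by blast
next
  case False
  then show ?thesis using that[of 0] zero_order_0[of X z0] entire_imp_analytic_at[OF hol] by blast
qed

lemma vanishes_to_zero:
  assumes hol: "X holomorphic_on UNIV" and "X z0 = 0"
  shows "vanishes_to 1 z0 X"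
proof (cases "\<exists>z1. X z1 \<noteq> 0")
  case True
  then obtain z1 where "X z1 \<noteq> 0" by blast
  then obtain m where "zero_order m z0 X" "m > 0"
    using zero_order_exists[OF hol, of z1 z0] assms(2) by blast
  then obtain h where h: "m > 0" "h analytic_on {z0}" "\<forall>\<^sub>F z in nhds z0. X z = (z - z0) ^ m * h z"
    unfolding zero_order_def by blast
  have "(\<lambda>z. (z - z0) ^ (m - 1) * h z) analytic_on {z0}"
    using h(2) by (intro analytic_intros)
  moreover have "\<forall>\<^sub>F z in nhds z0. X z = (z - z0) ^ 1 * ((z - z0) ^ (m - 1) * h z)"
    using h(3) by eventually_elim (use h(1) in \<open>simp add: power_eq_if\<close>)
  ultimately show ?thesis unfolding vanishes_to_def by blast
next
  case False
  then show ?thesis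
    unfolding vanishes_to_def by (intro exI[of _ "\<lambda>_. 0"]) auto
qed

lemma vanishes_to_deriv:
  assumes "vanishes_to m z0 X"
  shows "vanishes_to (m - 1) z0 (deriv X)"
proof -
  obtain h where h: "h analytic_on {z0}" "\<forall>\<^sub>F z in nhds z0. X z = (z - z0) ^ m * h z"
    using assms by (auto simp: vanishes_to_def)
  have dh: "deriv h analytic_on {z0}" using h(1) by (rule analytic_deriv)
  obtain r where r: "r > 0" "h holomorphic_on ball z0 r"
    using h(1) analytic_at_ball by blast
  have "h analytic_on {z}" if "z \<in> ball z0 r" for z
    using that r(2) analytic_at open_ball by blast
  then have "\<forall>\<^sub>F z in nhds z0. h analytic_on {z}"
    using r(1) by (auto simp: eventually_nhds intro!: exI[of _ "ball z0 r"])
  moreover have "\<forall>\<^sub>F z in nhds z0. \<forall>\<^sub>F z in nhds z. X z = (z - z0) ^ m * h z"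
    using h(2) by (simp add: eventually_eventually)
  ultimately have ev: "\<forall>\<^sub>F z in nhds z0. deriv X z = of_nat m * (z - z0) ^ (m - 1) * h z + (z - z0) ^ m * deriv h z"
  proof eventually_elim
    case (elim z)
    have "deriv X z = deriv (\<lambda>z. (z - z0) ^ m * h z) z"
      by (rule deriv_cong_ev[OF elim(2) refl])
    also have "\<dots> = of_nat m * (z - z0) ^ (m - 1) * h z + (z - z0) ^ m * deriv h z"
      using elim(1)
      by (intro DERIV_imp_deriv)
         (auto intro!: derivative_eq_intros analytic_derivI simp: mult_ac)
    finally show ?case .
  qed
  show ?thesis
  proof (cases m)
    \<comment> \<open>Here \<open>m - 1\<close> is 0, and only analyticity of the derivative is
      claimed.\<close>
    case 0
    have "(\<lambda>z. deriv h z) analytic_on {z0}" using dh .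
    then show ?thesis using ev 0 by (auto simp: vanishes_to_def)
  next
    case (Suc n)
    have "\<forall>\<^sub>F z in nhds z0. deriv X z = (z - z0) ^ (m - 1) * (of_nat m * h z + (z - z0) * deriv h z)"
      using ev by eventually_elim (simp add: Suc algebra_simps)
    moreover have "(\<lambda>z. of_nat m * h z + (z - z0) * deriv h z) analytic_on {z0}"
      using h dh by (intro analytic_intros)
    ultimately show ?thesis unfolding vanishes_to_def by blast
  qed
qed

section \<open>Divisibility of entire functions\<close>

lemma vanishes_to_quotient:
  assumes "vanishes_to m z0 F" "zero_order n z0 G" "n \<le> m"
  obtains q where "q analytic_on {z0}" "\<forall>\<^sub>F z in nhds z0. F z = q z * G z"
proof -
  obtain h where h: "h analytic_on {z0}" "\<forall>\<^sub>F z in nhds z0. F z = (z - z0) ^ m * h z"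
    using assms(1) by (auto simp: vanishes_to_def)
  obtain k where k: "k analytic_on {z0}" "k z0 \<noteq> 0" "\<forall>\<^sub>F z in nhds z0. G z = (z - z0) ^ n * k z"
    using assms(2) by (auto simp: zero_order_def)
  have "\<forall>\<^sub>F z in at z0. k z \<noteq> 0"
    by (rule tendsto_imp_eventually_ne[OF isContD[OF analytic_at_imp_isCont[OF k(1)]] k(2)])
  then have "\<forall>\<^sub>F z in nhds z0. k z \<noteq> 0"
    using k(2) by (simp add: eventually_nhds_conv_at)
  with h(2) k(3) have "\<forall>\<^sub>F z in nhds z0. F z = ((z - z0) ^ (m - n) * h z / k z) * G z"
  proof eventually_elim
    case (elim z)
    have "(z - z0) ^ m = (z - z0) ^ (m - n) * (z - z0) ^ n"
      using assms(3) by (simp flip: power_add)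
    then show ?case using elim by simp
  qed
  moreover have "(\<lambda>z. (z - z0) ^ (m - n) * h z / k z) analytic_on {z0}"
    using h(1) k(1,2) by (auto intro!: analytic_intros)
  ultimately show ?thesis using that by blast
qed

lemma entire_eventually_nonzero:
  assumes "X holomorphic_on UNIV" "X z1 \<noteq> 0"
  shows "\<forall>\<^sub>F w in at z. X w \<noteq> 0"
  using non_zero_neighbour_alt[of X UNIV z z1] assms connected_UNIV by simp

text \<open>Off the zeros of \<open>G\<close> the quotient is analytic as it stands, so orders are
  compared only at those zeros, where the HOL quotient has the default value 0 and
  \<open>remove_sings\<close> supplies the limit.\<close>

lemma entire_quotient:
  assumes F: "F holomorphic_on UNIV" and G: "G holomorphic_on UNIV" "G z1 \<noteq> 0"
    and loc: "\<And>z0. G z0 = 0 \<Longrightarrow> \<exists>m n. vanishes_to m z0 F \<and> zero_order n z0 G \<and> n \<le> m"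
  defines "q \<equiv> remove_sings (\<lambda>z. F z / G z)"
  shows "q holomorphic_on UNIV" "F z = q z * G z"
proof -
  have an: "q analytic_on {z0} \<and> F z0 = q z0 * G z0" for z0
  proof (cases "G z0 = 0")
    case False
    have "(\<lambda>z. F z / G z) analytic_on {z0}"
      using False by (intro analytic_on_divide entire_imp_analytic_at F G) auto
    then show ?thesis
      using remove_sings_analytic_on[of "\<lambda>z. F z / G z" "{z0}"] remove_sings_at_analytic False
      by (simp add: q_def)
  next
    case True
    obtain m n where "vanishes_to m z0 F" "zero_order n z0 G" "n \<le> m" using loc[OF True] by blast
    then obtain p where p: "p analytic_on {z0}" "\<forall>\<^sub>F z in nhds z0. F z = p z * G z"
      by (rule vanishes_to_quotient)
    have "\<forall>\<^sub>F z in at z0. F z = p z * G z"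
      using p(2) by (simp add: eventually_nhds_conv_at)
    moreover have "\<forall>\<^sub>F z in at z0. G z \<noteq> 0" by (rule entire_eventually_nonzero[OF G])
    ultimately have ev: "\<forall>\<^sub>F z in at z0. F z / G z = p z"
      by eventually_elim simp
    have "p \<midarrow>z0\<rightarrow> p z0" by (rule isContD[OF analytic_at_imp_isCont[OF p(1)]])
    then have lim: "(\<lambda>z. F z / G z) \<midarrow>z0\<rightarrow> p z0"
      using ev by (simp cong: tendsto_cong)
    have "isolated_singularity_at p z0" using p(1) by (simp add: isolated_singularity_at_analytic)
    then have "isolated_singularity_at (\<lambda>z. F z / G z) z0"
      using ev isolated_singularity_at_cong[of "\<lambda>z. F z / G z" p z0 z0] by blast
    then have "q analytic_on {z0}" unfolding q_def using lim by (rule remove_sings_analytic_at)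
    moreover have "F z0 = p z0 * G z0"
      using p(2) by (rule eventually_nhds_x_imp_x)
    ultimately show ?thesis using True by simp
  qed
  have "q analytic_on UNIV" using an by (subst analytic_on_analytic_at) blast
  then show "q holomorphic_on UNIV" by (rule analytic_imp_holomorphic)
  show "F z = q z * G z" using an by blast
qed

text \<open>The ring of entire functions has no zero divisors: the zeros of \<open>X\<close> are
  isolated, so \<open>Y\<close> vanishes in a punctured neighbourhood of \<open>z\<close>, and by
  continuity at \<open>z\<close>.\<close>

lemma entire_mult_zero:
  assumes "X holomorphic_on UNIV" "Y holomorphic_on UNIV" "\<And>z. X z * Y z = 0" "X z1 \<noteq> 0"
  shows "Y z = 0"
proof -
  have "\<forall>\<^sub>F w in at z. Y w = 0"
    using entire_eventually_nonzero[OF assms(1,4), of z]  proof eventually_elim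
    case (elim w)
    then show ?case using assms(3)[of w] by simp
  qed
  then have "Y \<midarrow>z\<rightarrow> 0" by (simp add: tendsto_eventually)
  moreover have "Y \<midarrow>z\<rightarrow> Y z"
    by (rule isContD[OF analytic_at_imp_isCont[OF entire_imp_analytic_at[OF assms(2)]]])
  ultimately show ?thesis by (rule LIM_unique[symmetric])
qed

lemma entire_prod_nonzero:
  assumes "finite I" "\<And>i. i \<in> I \<Longrightarrow> X i holomorphic_on UNIV" "\<And>i. i \<in> I \<Longrightarrow> \<exists>z. X i z \<noteq> 0"
  shows "\<exists>z. (\<Prod>i\<in>I. X i z) \<noteq> (0 :: complex)"
  using assms
proof (induction I)
  case (insert i I)
  then obtain z1 where "X i z1 \<noteq> 0" by blast
  moreover have "(\<lambda>z. \<Prod>i\<in>I. X i z) holomorphic_on UNIV"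
    using insert by (intro holomorphic_intros) auto
  moreover have "X i holomorphic_on UNIV" using insert by blast
  moreover obtain z2 where "(\<Prod>i\<in>I. X i z2) \<noteq> 0" using insert by blast
  ultimately have "\<exists>z. X i z * (\<Prod>i\<in>I. X i z) \<noteq> 0"
    using entire_mult_zero[of "X i" "\<lambda>z. \<Prod>i\<in>I. X i z" z1 z2] by blast
  then show ?case using insert by simp
qed simp

section \<open>Growth relative to a given entire function\<close>

abbreviation charT :: "(complex \<Rightarrow> complex) \<Rightarrow> real \<Rightarrow> real" where
  "charT X r \<equiv> cmean (lmax 1 X) 0 r"

lemma nevanlinna_T_entire:
  assumes "X holomorphic_on UNIV"
  shows "nevanlinna_T r X = charT X r"
proof -
  have np: "\<not> is_pole X z" for z
    using assms by (intro not_is_pole_holomorphic[of UNIV]) auto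
  have pc: "pole_count t X = 0" for t by (simp add: pole_count_def np)
  \<comment> \<open>At \<open>w = 0\<close> this depends on the value of \<open>ln\<close> at 0,
    which must not be positive.\<close>
  have lp: "log_plus (norm w) = ln (max (norm w) 1)" for w :: complex
    by (cases "norm w = 0") (auto simp: log_plus_def max_def not_le ln_ge_zero_iff)
  show ?thesis
    by (simp add: nevanlinna_T_def pole_counting_def pc proximity_def cmean_def lmax_def lp)
qed

lemma continuous_on_lmax_entire:
  "X holomorphic_on UNIV \<Longrightarrow> \<epsilon> > 0 \<Longrightarrow> continuous_on A (lmax \<epsilon> X)"
  by (rule continuous_on_lmax) (auto intro: holomorphic_on_imp_continuous_on holomorphic_on_subset)

lemma lmax_mono_radius_entire:
  assumes "X holomorphic_on UNIV" "\<epsilon> > 0" "0 \<le> r" "r \<le> R"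
  shows "cmean (lmax \<epsilon> X) 0 r \<le> cmean (lmax \<epsilon> X) 0 R"
proof (cases "R = 0")
  case False
  then show ?thesis
    using assms by (intro lmax_mono_radius)
      (auto intro: holomorphic_on_imp_continuous_on holomorphic_on_subset)
qed (use assms in auto)

lemma lmax_one_nonneg: "0 \<le> lmax 1 X z"
  by (simp add: lmax_def)

lemma lmax_mono_eps: "0 < \<epsilon> \<Longrightarrow> \<epsilon> \<le> \<epsilon>' \<Longrightarrow> lmax \<epsilon> X z \<le> lmax \<epsilon>' X z"
  by (subst exp_le_cancel_iff[symmetric]) (auto simp: exp_lmax simp del: exp_le_cancel_iff)

lemma charT_nonneg: "X holomorphic_on UNIV \<Longrightarrow> 0 \<le> r \<Longrightarrow> 0 \<le> charT X r"
  by (intro cmean_nonneg continuous_on_lmax_entire lmax_one_nonneg) auto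

text \<open>This is \<open>|u| = 2 u^+ - u\<close>. It bounds the mean of \<open>|u|\<close>, which
  Harnack's inequality asks for, by the characteristic and a lower bound for the mean of
  \<open>u\<close>.\<close>

lemma abs_lmax_le: "0 < \<epsilon> \<Longrightarrow> \<epsilon> \<le> 1 \<Longrightarrow> \<bar>lmax \<epsilon> X z\<bar> \<le> 2 * lmax 1 X z - lmax \<epsilon> X z"
  using lmax_mono_eps[of \<epsilon> 1 X z] lmax_one_nonneg[of X z]
  by (cases "norm (X z) \<le> 1") (auto simp: lmax_def max_def abs_if)

text \<open>Jensen's inequality after division by the zero at 0: \<open>ln |Y 0|\<close> is at most
  the mean for \<open>Y = X / z ^ m\<close>, and for \<open>r >= 1\<close> the factor
  \<open>z ^ m\<close> only enlarges \<open>|X|\<close>. As \<open>C\<close> does not depend on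
  \<open>\<epsilon>\<close>, the level can later be adapted to each circle.\<close>

lemma cmean_lmax_ge:
  assumes hol: "X holomorphic_on UNIV" and nz: "X z1 \<noteq> 0"
  obtains C where "C \<ge> 0" "\<And>r \<epsilon>. r \<ge> 1 \<Longrightarrow> \<epsilon> > 0 \<Longrightarrow> - C \<le> cmean (lmax \<epsilon> X) 0 r"
proof -
  obtain m where m: "zero_order m 0 X" using zero_order_exists[OF hol nz, of 0] by blast
  have zpow: "zero_order m 0 (\<lambda>z. z ^ m)"
    unfolding zero_order_def by (intro exI[of _ "\<lambda>_. 1"]) auto
  define Y where "Y = remove_sings (\<lambda>z. X z / z ^ m)"
  have Y: "Y holomorphic_on UNIV" "\<And>z. X z = Y z * z ^ m"
  proof -
    have *: "\<exists>k n. vanishes_to k z0 X \<and> zero_order n z0 (\<lambda>z. z ^ m) \<and> n \<le> k" if "z0 ^ m = 0" for z0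
    proof -
      have "z0 = 0" using that by simp
      then show ?thesis using zpow zero_order_imp_vanishes_to[OF m] by blast
    qed
    have hp: "(\<lambda>z::complex. z ^ m) holomorphic_on UNIV" by (intro holomorphic_intros)
    show "Y holomorphic_on UNIV"
      unfolding Y_def by (rule entire_quotient(1)[OF hol hp, of 1]) (use * in auto)
    show "\<And>z. X z = Y z * z ^ m"
      unfolding Y_def by (rule entire_quotient(2)[OF hol hp, of 1]) (use * in auto)
  qed
  have "Y 0 \<noteq> 0"
  proof -
    obtain h where h: "h analytic_on {0}" "h 0 \<noteq> 0" "\<forall>\<^sub>F z in nhds 0. X z = z ^ m * h z"
      using m by (auto simp: zero_order_def)
    have "\<forall>\<^sub>F z in at 0. X z = z ^ m * h z" using h(3) by (simp add: eventually_nhds_conv_at)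
    moreover have "\<forall>\<^sub>F z in at 0. z \<noteq> (0::complex)" by (simp add: eventually_at_filter)
    ultimately have "\<forall>\<^sub>F z in at 0. Y z = h z"
      by eventually_elim (simp add: Y(2))
    moreover have "Y \<midarrow>0\<rightarrow> Y 0" by (rule isContD[OF analytic_at_imp_isCont[OF entire_imp_analytic_at[OF Y(1)]]])
    moreover have "h \<midarrow>0\<rightarrow> h 0" by (rule isContD[OF analytic_at_imp_isCont[OF h(1)]])
    ultimately have "h \<midarrow>0\<rightarrow> Y 0" "h \<midarrow>0\<rightarrow> h 0"
      by (simp_all cong: tendsto_cong)
    then have "Y 0 = h 0" by (rule LIM_unique)
    then show ?thesis using h(2) by simp
  qed
  show ?thesis
  proof (rule that[of "\<bar>ln (norm (Y 0))\<bar>"])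
    fix r \<epsilon> :: real assume r: "r \<ge> 1" and e: "\<epsilon> > 0"
    have "- \<bar>ln (norm (Y 0))\<bar> \<le> ln (norm (Y 0))" by simp
    also have "\<dots> \<le> cmean (lmax \<epsilon> Y) 0 0"
      using \<open>Y 0 \<noteq> 0\<close> e by (simp add: cmean_def lmax_def)
    also have "\<dots> \<le> cmean (lmax \<epsilon> Y) 0 r"
      by (rule lmax_mono_radius_entire) (use Y(1) e r in auto)
    also have "\<dots> \<le> cmean (lmax \<epsilon> X) 0 r"
    proof (rule cmean_mono)
      fix w :: complex assume "w \<in> sphere 0 r"
      then have "norm (Y w) * 1 \<le> norm (Y w) * norm w ^ m"
        using r by (intro mult_left_mono one_le_power) auto
      then have "norm (Y w) \<le> norm (X w)" by (simp add: Y(2) norm_mult norm_power)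
      then show "lmax \<epsilon> Y w \<le> lmax \<epsilon> X w"
        using e by (simp add: lmax_def)
    qed (use Y hol e r in \<open>auto intro!: continuous_on_lmax_entire\<close>)
    finally show "- \<bar>ln (norm (Y 0))\<bar> \<le> cmean (lmax \<epsilon> X) 0 r" .
  qed simp
qed

text \<open>The source of all contradictions on size: an entire function that is too small in the
  logarithmic mean on large circles must vanish identically.\<close>

lemma cmean_majorant_ge:
  assumes hol: "X holomorphic_on UNIV" and nz: "X z1 \<noteq> 0"
  obtains C where "\<And>r v. r \<ge> 1 \<Longrightarrow> continuous_on (sphere 0 r) v \<Longrightarrow>
    (\<And>z. z \<in> sphere 0 r \<Longrightarrow> norm (X z) \<le> exp (v z)) \<Longrightarrow> - C \<le> cmean v 0 r"
proof -
  obtain C where C: "\<And>r \<epsilon>. r \<ge> 1 \<Longrightarrow> \<epsilon> > 0 \<Longrightarrow> - C \<le> cmean (lmax \<epsilon> X) 0 r"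
    using cmean_lmax_ge[OF hol nz] by metis
  show ?thesis
  proof (rule that[of C])
    fix r :: real and v :: "complex \<Rightarrow> real"
    assume r: "r \<ge> 1" and v: "continuous_on (sphere 0 r) v"
      and le: "\<And>z. z \<in> sphere 0 r \<Longrightarrow> norm (X z) \<le> exp (v z)"
    have "bounded (v ` sphere 0 r)"
      using compact_continuous_image[OF v compact_sphere] by (rule compact_imp_bounded)
    then obtain B where B: "\<forall>x\<in>v ` sphere 0 r. norm x \<le> B" unfolding bounded_iff by blast
    \<comment> \<open>\<open>B\<close> bounds \<open>|v|\<close> on the circle, so the level
      \<open>exp (- B)\<close> lies below \<open>exp v\<close> and the truncated logarithm is still
      majorised by \<open>v\<close>.\<close>
    have "- C \<le> cmean (lmax (exp (- B)) X) 0 r" by (rule C) (use r in auto)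
    also have "\<dots> \<le> cmean v 0 r"
    proof (rule cmean_mono)
      fix w :: complex assume w: "w \<in> sphere 0 r"
      have "norm (v w) \<le> B" using B w by blast
      then have "exp (- B) \<le> exp (v w)" by (simp add: abs_le_iff)
      then have "exp (lmax (exp (- B)) X w) \<le> exp (v w)"
        using le[OF w] by (simp add: exp_lmax)
      then show "lmax (exp (- B)) X w \<le> v w" by simp
    qed (use hol r v in \<open>auto intro!: continuous_on_lmax_entire\<close>)
    finally show "- C \<le> cmean v 0 r" .
  qed
qed

lemma cmean_cmean_le:
  assumes u: "continuous_on UNIV u" and r: "0 \<le> \<rho>" "0 \<le> r"
    and B: "\<And>s. \<bar>r - \<rho>\<bar> \<le> s \<Longrightarrow> s \<le> r + \<rho> \<Longrightarrow> cmean u 0 s \<le> B"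
  shows "cmean (\<lambda>z. cmean u z \<rho>) 0 r \<le> B"
proof -
  define g where "g = (\<lambda>t. cmean u 0 (norm (of_real r + of_real \<rho> * cis t)))"
  have "continuous_on UNIV (\<lambda>s. cmean u 0 s)"
  proof -
    have "continuous_on UNIV (\<lambda>s. integral (cbox 0 (2 * pi)) (\<lambda>t. u (of_real s * cis t)))"
      by (rule integral_continuous_on_param)
         (auto intro!: continuous_intros continuous_on_compose2[OF u] simp: case_prod_unfold)
    then show ?thesis by (auto simp: cmean_def intro!: continuous_intros)
  qed
  then have cg: "continuous_on {0..2 * pi} g"
    unfolding g_def by (rule continuous_on_compose2) (auto intro!: continuous_intros)
  have "integral {0..2 * pi} g \<le> integral {0..2 * pi} (\<lambda>_. B)"
  proof (rule integral_le)
    fix t :: real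
    have n: "norm (complex_of_real \<rho> * cis t) = \<rho>" "norm (complex_of_real r) = r" using r by (simp_all add: norm_mult)
    have "norm (of_real r + of_real \<rho> * cis t) \<le> r + \<rho>"
      using norm_triangle_ineq[of "of_real r" "of_real \<rho> * cis t"] n by simp
    moreover have "\<bar>r - \<rho>\<bar> \<le> norm (of_real r + of_real \<rho> * cis t)"
      using norm_triangle_ineq3[of "of_real r" "- (of_real \<rho> * cis t)"] n by simp
    ultimately show "g t \<le> B" unfolding g_def by (intro B)
  qed (use cg in \<open>auto intro: integrable_continuous_interval\<close>)
  then show ?thesis
    unfolding cmean_cmean[OF u r(1)] g_def by (simp add: field_simps)
qed

text \<open>Liouville's theorem: if the characteristic were below \<open>B\<close> for arbitrarily
  large radii, Harnack's inequality on those circles would bound \<open>ln |X|\<close> by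
  \<open>3 * B\<close> at every point.\<close>

lemma charT_at_top:
  assumes hol: "X holomorphic_on UNIV" and nc: "\<not> X constant_on UNIV"
  obtains R where "R \<ge> 1" "\<And>r. r \<ge> R \<Longrightarrow> charT X r \<ge> B"
proof -
  have "\<exists>R. \<forall>r\<ge>R. charT X r \<ge> B"
  proof (rule ccontr)
    assume "\<not> ?thesis"
    then have unb: "\<exists>r\<ge>R. charT X r < B" for R by (auto simp: not_le)
    have "norm (X v) \<le> exp (3 * B)" for v
    proof -
      \<comment> \<open>With \<open>K = norm v + 1\<close> and \<open>r >= 2 * K\<close> the Harnack
        factor \<open>2 * K / (r - K)\<close> is at most 2.\<close>
      obtain r where r: "r \<ge> 2 * (norm v + 1)" "charT X r < B" using unb by blast
      have n0: "norm v + 1 < r \<and> 0 \<le> r \<and> 0 < norm v + 1 \<and> 0 < r - (norm v + 1)"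
        using r(1) norm_ge_zero[of v] by argo
      have a0: "charT X r \<ge> 0" by (rule charT_nonneg[OF hol]) (use n0 in blast)
      have "lmax 1 X (0 + v) \<le> cmean (lmax 1 X) 0 r + 2 * (norm v + 1) / (r - (norm v + 1)) * cmean (\<lambda>w. \<bar>lmax 1 X w\<bar>) 0 r"
        by (rule lmax_le_cmean[OF hol]) (use n0 in auto)
      moreover have "cmean (\<lambda>w. \<bar>lmax 1 X w\<bar>) 0 r = charT X r"
        by (simp add: lmax_one_nonneg)
      moreover have "2 * (norm v + 1) / (r - (norm v + 1)) * charT X r \<le> 2 * charT X r"
      proof (rule mult_right_mono[OF _ a0])
        show "2 * (norm v + 1) / (r - (norm v + 1)) \<le> 2"
          using r(1) n0 by (simp add: pos_divide_le_eq)
      qed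
      ultimately have "lmax 1 X v \<le> 3 * charT X r" by simp
      then have "exp (lmax 1 X v) \<le> exp (3 * B)" using r(2) by simp
      then show ?thesis by (simp add: exp_lmax)
    qed
    then have "bounded (range X)" unfolding bounded_iff by blast
    then show False using Liouville_theorem[OF hol] nc by blast
  qed
  then obtain R where "\<forall>r\<ge>R. charT X r \<ge> B" by blast
  then show ?thesis using that[of "max R 1"] by auto
qed

text \<open>Cauchy's estimate on the unit circle about \<open>z\<close>, at a point where
  \<open>|X|\<close> is largest there. Derivatives become values at nearby points, and can be
  treated together with shifts.\<close>

lemma deriv_le_nearby:
  assumes hol: "X holomorphic_on UNIV"
  obtains v where "norm v \<le> 1" "norm ((deriv ^^ n) X z) \<le> fact n * norm (X (z + v))"
proof -
  have cont: "continuous_on A X" for A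
    using hol by (auto intro: holomorphic_on_imp_continuous_on holomorphic_on_subset)
  obtain w where w: "w \<in> sphere z 1" "\<And>y. y \<in> sphere z 1 \<Longrightarrow> norm (X y) \<le> norm (X w)"
    using continuous_attains_sup[of "sphere z 1" "\<lambda>y. norm (X y)"] continuous_on_norm[OF cont] by auto
  have "norm ((deriv ^^ n) X z) \<le> fact n * norm (X w) / 1 ^ n"
    by (rule Cauchy_inequality)
       (use hol cont w(2) in \<open>auto intro: holomorphic_on_subset simp: dist_norm\<close>)
  then show ?thesis
    using that[of "w - z"] w(1) by (simp add: dist_norm norm_minus_commute)
qed

lemma charT_nearby_le:
  assumes X: "X holomorphic_on UNIV" and Y: "Y holomorphic_on UNIV" and B: "B \<ge> 1" and K: "K > 0" and r: "r \<ge> 0"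
    and near: "\<And>z. \<exists>v. norm v \<le> K \<and> norm (Y z) \<le> B * norm (X (z + v))"
  shows "charT Y r \<le> ln B + 3 * charT X (r + 2 * K)"
proof -
  have cu: "continuous_on A (lmax 1 X)" for A using X by (rule continuous_on_lmax_entire) simp
  have cA: "continuous_on A (\<lambda>z. ln B + 3 * cmean (lmax 1 X) z (2 * K))" for A
    by (intro continuous_intros continuous_on_cmean cu)
  have pt: "lmax 1 Y z \<le> ln B + 3 * cmean (lmax 1 X) z (2 * K)" for z
  proof -
    obtain v where v: "norm v \<le> K" "norm (Y z) \<le> B * norm (X (z + v))" using near by blast
    have "max (norm (Y z)) 1 \<le> B * max (norm (X (z + v))) 1"
    proof (rule max.boundedI)
      have "B * norm (X (z + v)) \<le> B * max (norm (X (z + v))) 1"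
        using B by (intro mult_left_mono) auto
      with v(2) show "norm (Y z) \<le> B * max (norm (X (z + v))) 1" by (rule order_trans)
      have "1 * 1 \<le> B * max (norm (X (z + v))) 1"
        using B by (intro mult_mono) auto
      then show "1 \<le> B * max (norm (X (z + v))) 1" by simp
    qed
    then have "ln (max (norm (Y z)) 1) \<le> ln (B * max (norm (X (z + v))) 1)"
      by (rule ln_mono) simp
    also have "\<dots> = ln B + lmax 1 X (z + v)"
      unfolding lmax_def using B by (intro ln_mult_pos) auto
    finally have 1: "lmax 1 Y z \<le> ln B + lmax 1 X (z + v)" by (simp add: lmax_def)
    \<comment> \<open>On the circle of radius \<open>2 * K\<close> the Harnack factor is 2; with the
      mean itself this gives the coefficient 3.\<close>
    have "lmax 1 X (z + v) \<le> cmean (lmax 1 X) z (2 * K) + 2 * K / (2 * K - K) * cmean (\<lambda>w. \<bar>lmax 1 X w\<bar>) z (2 * K)"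
      by (rule lmax_le_cmean[OF X]) (use v K in auto)
    also have "2 * K / (2 * K - K) = 2" using K by simp
    also have "(\<lambda>w. \<bar>lmax 1 X w\<bar>) = lmax 1 X" by (simp add: lmax_one_nonneg)
    finally show ?thesis using 1 by simp
  qed
  have "charT Y r \<le> cmean (\<lambda>z. ln B + 3 * cmean (lmax 1 X) z (2 * K)) 0 r"
    by (intro cmean_mono pt r cA continuous_on_lmax_entire Y) auto
  also have "\<dots> = ln B + 3 * cmean (\<lambda>z. cmean (lmax 1 X) z (2 * K)) 0 r"
    using r by (subst cmean_add) (auto simp: cmean_cmult intro!: continuous_intros continuous_on_cmean cu)
  also have "cmean (\<lambda>z. cmean (lmax 1 X) z (2 * K)) 0 r \<le> charT X (r + 2 * K)"
    by (rule cmean_cmean_le) (use X K r cu in \<open>auto intro!: lmax_mono_radius_entire\<close>)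
  finally show ?thesis by simp
qed

text \<open>The constant is also allowed to enlarge the radius, since shifts and derivatives of
  \<open>X\<close> are estimated on larger circles. The loss is recovered on the regular circles,
  where \<open>charT f\<close> hardly changes over bounded distances.\<close>

definition growth_le :: "(complex \<Rightarrow> complex) \<Rightarrow> (complex \<Rightarrow> complex) \<Rightarrow> bool" where
  "growth_le f X \<longleftrightarrow> X holomorphic_on UNIV \<and>
     (\<exists>C\<ge>0. \<forall>r\<ge>1. charT X r \<le> C * (charT f (r + C) + 1))"

lemma growth_le_hol: "growth_le f X \<Longrightarrow> X holomorphic_on UNIV"
  by (simp add: growth_le_def)

text \<open>Two comparison functions cover sums, products and quotients; operations with a single
  argument take them equal.\<close>

lemma growth_le_dominated:
  assumes f: "f holomorphic_on UNIV" and X: "growth_le f X" and Y: "growth_le f Y" and Z: "Z holomorphic_on UNIV"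
    and a: "a \<ge> 0" and s: "s \<ge> 0"
    and le: "\<And>r. r \<ge> 1 \<Longrightarrow> charT Z r \<le> a * (1 + charT X (r + s) + charT Y (r + s))"
  shows "growth_le f Z"
proof -
  obtain C where C: "C \<ge> 0" "\<And>r. r \<ge> 1 \<Longrightarrow> charT X r \<le> C * (charT f (r + C) + 1)"
    using X by (auto simp: growth_le_def)
  obtain D where D: "D \<ge> 0" "\<And>r. r \<ge> 1 \<Longrightarrow> charT Y r \<le> D * (charT f (r + D) + 1)"
    using Y by (auto simp: growth_le_def)
  define E where "E = a * (1 + C + D) + (s + C + D)"
  have E: "E \<ge> 0" "s + C \<le> E" "s + D \<le> E" "a * (1 + C + D) \<le> E"
    unfolding E_def using a s C(1) D(1) by auto
  have "charT Z r \<le> E * (charT f (r + E) + 1)" if r: "r \<ge> 1" for r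
  proof -
    define t where "t = charT f (r + E) + 1"
    have t: "t \<ge> 1" using charT_nonneg[OF f, of "r + E"] r E by (simp add: t_def)
    have "charT X (r + s) \<le> C * (charT f (r + s + C) + 1)" by (rule C(2)) (use r s in simp)
    also have "charT f (r + s + C) + 1 \<le> t"
      unfolding t_def using r s C E by (intro add_right_mono lmax_mono_radius_entire f) auto
    finally have 1: "charT X (r + s) \<le> C * t" using C(1) by (simp add: mult_left_mono)
    have "charT Y (r + s) \<le> D * (charT f (r + s + D) + 1)" by (rule D(2)) (use r s in simp)
    also have "charT f (r + s + D) + 1 \<le> t"
      unfolding t_def using r s D E by (intro add_right_mono lmax_mono_radius_entire f) auto
    finally have 2: "charT Y (r + s) \<le> D * t" using D(1) by (simp add: mult_left_mono)
    have "charT Z r \<le> a * (1 + charT X (r + s) + charT Y (r + s))" by (rule le[OF r])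
    also have "\<dots> \<le> a * (t + C * t + D * t)"
      using 1 2 t a by (intro mult_left_mono) auto
    also have "\<dots> = (a * (1 + C + D)) * t" by (simp add: algebra_simps)
    also have "\<dots> \<le> E * t" using E(4) t by (intro mult_right_mono) auto
    finally show ?thesis by (simp add: t_def)
  qed
  then show ?thesis unfolding growth_le_def using Z E(1) by blast
qed

context
  fixes f :: "complex \<Rightarrow> complex"
  assumes f: "f holomorphic_on UNIV"
begin

lemma growth_le_self: "growth_le f f"
proof -
  have "charT f r \<le> 1 * (charT f (r + 1) + 1)" if "r \<ge> 1" for r
    using lmax_mono_radius_entire[OF f, of 1 r "r + 1"] that by simp
  then show ?thesis unfolding growth_le_def using f by (intro conjI exI[of _ 1]) auto
qed

lemma growth_le_const: "growth_le f (\<lambda>_. c)"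
proof (rule growth_le_dominated[OF f growth_le_self growth_le_self, of _ "ln (max (norm c) 1)" 0])
  fix r :: real assume r: "r \<ge> 1"
  have l: "0 \<le> ln (max (norm c) 1)" by simp
  have "charT (\<lambda>_. c) r = ln (max (norm c) 1) * 1" by (simp add: lmax_def[abs_def])
  also have "\<dots> \<le> ln (max (norm c) 1) * (1 + charT f (r + 0) + charT f (r + 0))"
    using charT_nonneg[OF f, of r] r l by (intro mult_left_mono) auto
  finally show "charT (\<lambda>_. c) r \<le> ln (max (norm c) 1) * (1 + charT f (r + 0) + charT f (r + 0))" .
qed auto

lemma growth_le_add:
  assumes X: "growth_le f X" and Y: "growth_le f Y"
  shows "growth_le f (\<lambda>z. X z + Y z)"
proof (rule growth_le_dominated[OF f X Y, of _ 1 0])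
  note hol = growth_le_hol[OF X] growth_le_hol[OF Y]
  show "(\<lambda>z. X z + Y z) holomorphic_on UNIV" using hol by (intro holomorphic_intros)
  fix r :: real assume r: "r \<ge> 1"
  have pt: "lmax 1 (\<lambda>z. X z + Y z) z \<le> 1 + (lmax 1 X z + lmax 1 Y z)" for z
  proof -
    define x y where "x = max (norm (X z)) 1" and "y = max (norm (Y z)) 1"
    have xy: "x \<ge> 1" "y \<ge> 1" "norm (X z) \<le> x" "norm (Y z) \<le> y" by (simp_all add: x_def y_def)
    have "norm (X z + Y z) \<le> x + y" using norm_triangle_ineq[of "X z" "Y z"] xy by simp
    moreover have "x + y \<le> 2 * (x * y)"
    proof -
      have "x * 1 \<le> x * y" "1 * y \<le> x * y" using xy by (intro mult_mono; simp)+
      then show ?thesis by simp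
    qed
    ultimately have "max (norm (X z + Y z)) 1 \<le> 2 * (x * y)" using xy by simp
    then have "ln (max (norm (X z + Y z)) 1) \<le> ln (2 * (x * y))"
      by (rule ln_mono) simp
    also have "\<dots> = ln 2 + (ln x + ln y)"
      using xy by (simp add: ln_mult_pos)
    also have "ln 2 \<le> (1::real)" using ln_2_less_1 by simp
    finally show ?thesis by (simp add: lmax_def x_def y_def)
  qed
  have "charT (\<lambda>z. X z + Y z) r \<le> cmean (\<lambda>z. 1 + (lmax 1 X z + lmax 1 Y z)) 0 r"
    using r hol by (intro cmean_mono pt) (auto intro!: continuous_intros continuous_on_lmax_entire holomorphic_intros)
  also have "\<dots> = 1 + (charT X r + charT Y r)"
    using r hol by (subst cmean_add cmean_add; (auto intro!: continuous_intros continuous_on_lmax_entire)?)+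
  finally show "charT (\<lambda>z. X z + Y z) r \<le> 1 * (1 + charT X (r + 0) + charT Y (r + 0))" by simp
qed auto

lemma growth_le_mult:
  assumes X: "growth_le f X" and Y: "growth_le f Y"
  shows "growth_le f (\<lambda>z. X z * Y z)"
proof (rule growth_le_dominated[OF f X Y, of _ 1 0])
  note hol = growth_le_hol[OF X] growth_le_hol[OF Y]
  show "(\<lambda>z. X z * Y z) holomorphic_on UNIV" using hol by (intro holomorphic_intros)
  fix r :: real assume r: "r \<ge> 1"
  have pt: "lmax 1 (\<lambda>z. X z * Y z) z \<le> lmax 1 X z + lmax 1 Y z" for z
  proof -
    define x y where "x = max (norm (X z)) 1" and "y = max (norm (Y z)) 1"
    have xy: "x \<ge> 1" "y \<ge> 1" "norm (X z) \<le> x" "norm (Y z) \<le> y" by (simp_all add: x_def y_def)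
    have "norm (X z * Y z) \<le> x * y" unfolding norm_mult using xy by (intro mult_mono) auto
    moreover have "1 * 1 \<le> x * y" using xy by (intro mult_mono) auto
    ultimately have "max (norm (X z * Y z)) 1 \<le> x * y" by simp
    then have "ln (max (norm (X z * Y z)) 1) \<le> ln (x * y)"
      by (rule ln_mono) simp
    also have "\<dots> = ln x + ln y"
      using xy by (simp add: ln_mult_pos)
    finally show ?thesis by (simp add: lmax_def x_def y_def)
  qed
  have "charT (\<lambda>z. X z * Y z) r \<le> cmean (\<lambda>z. lmax 1 X z + lmax 1 Y z) 0 r"
    using r hol by (intro cmean_mono pt) (auto intro!: continuous_intros continuous_on_lmax_entire holomorphic_intros)
  also have "\<dots> = charT X r + charT Y r"
    using r hol by (subst cmean_add) (auto intro!: continuous_intros continuous_on_lmax_entire)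
  finally show "charT (\<lambda>z. X z * Y z) r \<le> 1 * (1 + charT X (r + 0) + charT Y (r + 0))" by simp
qed auto

lemma growth_le_diff:
  assumes "growth_le f X" "growth_le f Y"
  shows "growth_le f (\<lambda>z. X z - Y z)"
  using growth_le_add[OF assms(1) growth_le_mult[OF growth_le_const[of "-1"] assms(2)]] by simp

lemma growth_le_sum:
  assumes "finite I" "\<And>i. i \<in> I \<Longrightarrow> growth_le f (X i)"
  shows "growth_le f (\<lambda>z. \<Sum>i\<in>I. X i z)"
  using assms by (induction I) (auto intro: growth_le_const growth_le_add)

lemma growth_le_nearby:
  assumes X: "growth_le f X" and Y: "Y holomorphic_on UNIV" and B: "B \<ge> 1" and K: "K > 0"
    and near: "\<And>z. \<exists>v. norm v \<le> K \<and> norm (Y z) \<le> B * norm (X (z + v))"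
  shows "growth_le f Y"
proof (rule growth_le_dominated[OF f X X Y, of "ln B + 3" "2 * K"])
  fix r :: real assume r: "r \<ge> 1"
  have l: "ln B \<ge> 0" using B by simp
  have c: "charT X (r + 2 * K) \<ge> 0" using r K by (intro charT_nonneg growth_le_hol[OF X]) auto
  have "charT Y r \<le> ln B + 3 * charT X (r + 2 * K)"
    by (rule charT_nearby_le[OF growth_le_hol[OF X] Y B K]) (use r near in auto)
  also have "\<dots> \<le> (ln B + 3) * (1 + charT X (r + 2 * K) + charT X (r + 2 * K))"
    using l c mult_nonneg_nonneg[OF l c] by (simp add: algebra_simps)
  finally show "charT Y r \<le> (ln B + 3) * (1 + charT X (r + 2 * K) + charT X (r + 2 * K))" .
qed (use B K in auto)

lemma growth_le_deriv:
  assumes X: "growth_le f X"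
  shows "growth_le f (deriv X)"
proof (rule growth_le_nearby[OF X, of _ 1 1])
  show "deriv X holomorphic_on UNIV" using growth_le_hol[OF X] by (intro holomorphic_deriv) auto
  show "\<exists>v. norm v \<le> 1 \<and> norm (deriv X z) \<le> 1 * norm (X (z + v))" for z
  proof -
    obtain v where "norm v \<le> 1" "norm ((deriv ^^ 1) X z) \<le> fact 1 * norm (X (z + v))"
      by (rule deriv_le_nearby[OF growth_le_hol[OF X]])
    then show ?thesis by auto
  qed
qed auto

lemma growth_le_shift:
  assumes X: "growth_le f X"
  shows "growth_le f (\<lambda>z. X (z + c))"
proof (rule growth_le_nearby[OF X, of _ 1 "norm c + 1"])
  have "(X \<circ> (\<lambda>z. z + c)) holomorphic_on UNIV"
    by (intro holomorphic_on_compose_gen[OF _ growth_le_hol[OF X]] holomorphic_intros) auto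
  then show "(\<lambda>z. X (z + c)) holomorphic_on UNIV" by (simp add: o_def)
  show "\<exists>v. norm v \<le> norm c + 1 \<and> norm (X (z + c)) \<le> 1 * norm (X (z + v))" for z
    by (intro exI[of _ c]) auto
qed (auto intro: add_nonneg_pos)

text \<open>On zeros of \<open>Y\<close> the quotient is estimated through the truncation of \<open>ln |Y|\<close> at a level
  depending on the circle, which is harmless since the lower bound for the means of truncated
  logarithms does not depend on the level.\<close>

lemma growth_le_quotient:
  assumes Y: "growth_le f Y" "Y z1 \<noteq> 0" and Z: "growth_le f Z" and X: "X holomorphic_on UNIV"
    and eq: "\<And>z. X z * Y z = Z z"
  shows "growth_le f X"
proof -
  note hol = growth_le_hol[OF Y(1)] growth_le_hol[OF Z] X
  obtain C where C: "C \<ge> 0" "\<And>r \<epsilon>. r \<ge> 1 \<Longrightarrow> \<epsilon> > 0 \<Longrightarrow> - C \<le> cmean (lmax \<epsilon> Y) 0 r"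
    using cmean_lmax_ge[OF hol(1) Y(2)] by metis
  show ?thesis
  proof (rule growth_le_dominated[OF f Y(1) Z X, of "C + 1" 0])
    fix r :: real assume r: "r \<ge> 1"
    have "continuous_on (sphere 0 r) X"
      using X by (meson holomorphic_on_imp_continuous_on holomorphic_on_subset subset_UNIV)
    then have "compact (X ` sphere 0 r)"
      using compact_sphere by (rule compact_continuous_image)
    then have "bounded (X ` sphere 0 r)" by (rule compact_imp_bounded)
    then obtain M0 where M0: "\<forall>x\<in>X ` sphere 0 r. norm x \<le> M0" unfolding bounded_iff by blast
    define M where "M = max M0 1"
    \<comment> \<open>\<open>M\<close> bounds \<open>|X|\<close> on this circle, so where
      \<open>|Y| <= \<epsilon>\<close> the product of the truncations of \<open>X\<close> and
      \<open>Y\<close> is at most \<open>M * \<epsilon> = 1\<close>.\<close>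
    define \<epsilon> where "\<epsilon> = 1 / M"
    have M1: "M \<ge> 1" by (simp add: M_def)
    have M2: "norm (X z) \<le> M" if "z \<in> sphere 0 r" for z
    proof -
      have "norm (X z) \<le> M0" using M0 that by blast
      then show ?thesis by (simp add: M_def)
    qed
    note M = M1 M2
    have e: "\<epsilon> > 0" "\<epsilon> \<le> 1" "M * \<epsilon> = 1" using M(1) by (auto simp: \<epsilon>_def)
    have pt: "lmax 1 X z \<le> lmax 1 Y z + lmax 1 Z z - lmax \<epsilon> Y z" if z: "z \<in> sphere 0 r" for z
    proof -
      define x y y' w where "x = max (norm (X z)) 1" and "y = max (norm (Y z)) 1"
        and "y' = max (norm (Y z)) \<epsilon>" and "w = max (norm (Z z)) 1"
      have pos: "x \<ge> 1" "y \<ge> 1" "y' > 0" "w \<ge> 1" using e by (auto simp: x_def y_def y'_def w_def less_max_iff_disj)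
      have "x * y' \<le> y * w"
      proof (cases "norm (Y z) \<le> \<epsilon>")
        case True
        have "x * \<epsilon> \<le> M * \<epsilon>" using M z e by (intro mult_right_mono) (auto simp: x_def)
        moreover have "1 * 1 \<le> y * w" using pos by (intro mult_mono) auto
        ultimately show ?thesis using True e by (simp add: y'_def)
      next
        case False
        have "norm (X z) * norm (Y z) = norm (Z z)" by (simp add: eq flip: norm_mult)
        then have "x * y' = max (norm (Z z)) (norm (Y z))"
          using False by (simp add: x_def y'_def max_mult_distrib_right)
        also have "\<dots> \<le> max w y" by (auto simp: w_def y_def)
        also have "\<dots> \<le> y * w"
          using mult_mono[of 1 y w w] mult_mono[of y y 1 w] pos by auto
        finally show ?thesis .
      qed
      then have "ln (x * y') \<le> ln (y * w)" using pos by (intro ln_mono) auto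
      then have "ln x + ln y' \<le> ln y + ln w" using pos by (simp add: ln_mult_pos)
      then show ?thesis by (simp add: lmax_def x_def y_def y'_def w_def)
    qed
    have "charT X r \<le> cmean (\<lambda>z. lmax 1 Y z + lmax 1 Z z - lmax \<epsilon> Y z) 0 r"
      using r hol e by (intro cmean_mono pt) (auto intro!: continuous_intros continuous_on_lmax_entire)
    also have "\<dots> = charT Y r + charT Z r - cmean (lmax \<epsilon> Y) 0 r"
      using r hol e
      by (subst cmean_diff cmean_add; (auto intro!: continuous_intros continuous_on_lmax_entire)?)+
    also have "\<dots> \<le> C + charT Y r + charT Z r"
      using C(2)[OF r e(1)] by simp
    also have "\<dots> \<le> (C + 1) * (1 + charT Y (r + 0) + charT Z (r + 0))"
    proof -
      have "0 \<le> C * (charT Y r + charT Z r)"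
        using C(1) r hol by (intro mult_nonneg_nonneg add_nonneg_nonneg charT_nonneg) auto
      then show ?thesis by (simp add: algebra_simps)
    qed
    finally show "charT X r \<le> (C + 1) * (1 + charT Y (r + 0) + charT Z (r + 0))" .
  qed (use C in auto)
qed

end

section \<open>Regular circles\<close>

lemma hyper_order_less_1:
  assumes f: "f holomorphic_on UNIV" and ho: "hyper_order f < 1"
  obtains s where "s < 1" "\<forall>\<^sub>F r in at_top. ln (charT f r) \<le> r powr s"
proof -
  obtain s :: real where s: "hyper_order f < ereal s" "ereal s < 1"
    using ereal_dense2[OF ho] by blast
  have "\<forall>\<^sub>F r in at_top. ereal (ln (ln (nevanlinna_T r f)) / ln r) < ereal s"
    using s(1) unfolding hyper_order_def by (rule Limsup_lessD)
  then have "\<forall>\<^sub>F r in at_top. ln (charT f r) \<le> r powr s"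
    using eventually_gt_at_top[of 1]
  proof eventually_elim
    case (elim r)
    define L where "L = ln (charT f r)"
    have "ln L / ln r < s" using elim(1) by (simp add: nevanlinna_T_entire[OF f] L_def)
    then have "ln L < s * ln r" using elim(2) by (simp add: divide_less_eq)
    show ?case
    proof (cases "L > 0")
      case True
      then have "L = exp (ln L)" by simp
      also have "\<dots> \<le> exp (s * ln r)" using \<open>ln L < s * ln r\<close> by simp
      also have "\<dots> = r powr s" using elim(2) by (simp add: powr_def)
      finally show ?thesis by (simp add: L_def)
    next
      \<comment> \<open>Here \<open>ln L\<close> is a value by convention, but a nonpositive
        \<open>L\<close> lies below every power.\<close>
      case False
      then show ?thesis using powr_ge_zero[of r s] unfolding L_def by linarith
    qed
  qed
  moreover have "s < 1" using s(2) by simp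
  ultimately show ?thesis using that by blast
qed

lemma sublinear_powr:
  fixes A B c \<rho> s :: real
  assumes "s < 1" "c > 0" "\<rho> > 0"
  shows "\<forall>\<^sub>F x in at_top. (A + x * \<rho>) powr s + B < c * x"
proof -
  have top: "filterlim (\<lambda>x. A + x * \<rho>) at_top at_top"
    using assms(3)
    by (intro filterlim_tendsto_add_at_top[OF tendsto_const]
        filterlim_at_top_mult_tendsto_pos[OF tendsto_const _ filterlim_ident])
  have "((\<lambda>x. (A + x * \<rho>) powr (s - 1)) \<longlongrightarrow> 0) at_top"
    by (rule tendsto_neg_powr[OF _ top]) (use assms(1) in simp)
  then have "\<forall>\<^sub>F x in at_top. (A + x * \<rho>) powr (s - 1) < c / (2 * \<rho>)"
    by (rule order_tendstoD) (use assms in simp)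
  moreover have "\<forall>\<^sub>F x in at_top. A + x * \<rho> \<ge> max 1 ((B + c * A / \<rho>) * (2 * \<rho>) / c)"
    using top unfolding filterlim_at_top by blast
  ultimately show ?thesis
  proof eventually_elim
    case (elim x)
    define y where "y = A + x * \<rho>"
    have y: "y \<ge> 1" "y \<ge> (B + c * A / \<rho>) * (2 * \<rho>) / c" using elim(2) by (simp_all add: y_def)
    have "y powr s = y powr (s - 1) * y" using y(1) by (simp add: powr_diff)
    also have "\<dots> < c / (2 * \<rho>) * y" using elim(1) y(1) by (intro mult_strict_right_mono) (auto simp: y_def)
    finally have "y powr s + B < c / (2 * \<rho>) * y + B" by simp
    also have "B + c * A / \<rho> \<le> c / (2 * \<rho>) * y"
      using y(2) assms(2,3) by (simp add: field_simps)
    then have "c / (2 * \<rho>) * y + B \<le> 2 * (c / (2 * \<rho>) * y) - c * A / \<rho>" by simp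
    also have "2 * (c / (2 * \<rho>) * y) - c * A / \<rho> = c * x"
      using assms(3) by (simp add: y_def field_simps)
    finally show ?case by (simp add: y_def)
  qed
qed

text \<open>If every step multiplied by more than \<open>q\<close>, then
  \<open>a n >= q ^ n\<close>, so \<open>n * ln q\<close> would be bounded by
  \<open>B + (A + n * \<rho>) powr s\<close> with \<open>s < 1\<close>. This is how the bound on the
  hyper-order acts on steps of fixed length.\<close>

lemma exists_slow_step:
  fixes a :: "nat \<Rightarrow> real"
  assumes a: "\<And>n. a n \<ge> 1" and q: "q > 1" and s: "s < 1" and \<rho>: "\<rho> > 0"
    and up: "\<And>n. ln (a n) \<le> B + (A + real n * \<rho>) powr s"
  obtains n where "a (Suc n) \<le> q * a n"
proof -
  have "\<exists>n. a (Suc n) \<le> q * a n"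
  proof (rule ccontr)
    assume "\<not> ?thesis"
    then have step: "q * a n < a (Suc n)" for n by (auto simp: not_le)
    have ge: "q ^ n \<le> a n" for n
    proof (induction n)
      case (Suc n)
      have "q ^ Suc n \<le> q * a n" using Suc q by simp
      then show ?case using step[of n] by simp
    qed (use a in auto)
    have "real n * ln q \<le> B + (A + real n * \<rho>) powr s" for n
    proof -
      have "real n * ln q = ln (q ^ n)" using q by (simp add: ln_realpow)
      also have "\<dots> \<le> ln (a n)" using q ge[of n] by (intro ln_mono) auto
      finally show ?thesis using up[of n] by simp
    qed
    moreover have "\<forall>\<^sub>F n in sequentially. (A + real n * \<rho>) powr s + B < ln q * real n"
      by (rule eventually_compose_filterlim[OF sublinear_powr filterlim_real_sequentially])
         (use s q \<rho> in auto)
    then obtain n :: nat where n: "(A + real n * \<rho>) powr s + B < ln q * real n"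
      using eventually_happens'[OF sequentially_bot] by blast
    have "real n * ln q \<le> B + (A + real n * \<rho>) powr s" by fact
    with n show False by (simp add: mult.commute)
  qed
  then show ?thesis using that by blast
qed

lemma finite_uniform_bound:
  fixes P :: "'a \<Rightarrow> real \<Rightarrow> bool"
  assumes "finite A" "\<And>x. x \<in> A \<Longrightarrow> \<exists>C. P x C"
    and mono: "\<And>x C D. x \<in> A \<Longrightarrow> P x C \<Longrightarrow> C \<le> D \<Longrightarrow> P x D"
  obtains C where "C \<ge> c0" "\<And>x. x \<in> A \<Longrightarrow> P x C"
proof -
  have "\<exists>C\<ge>c0. \<forall>x\<in>A. P x C"
    using assms
  proof (induction A)
    case (insert x A)
    obtain C where C: "C \<ge> c0" "\<forall>y\<in>A. P y C" using insert by blast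
    obtain D where D: "P x D" using insert by blast
    have "P x (max C D)" using insert.prems(2)[of x D "max C D"] D by simp
    moreover have "P y (max C D)" if "y \<in> A" for y
      using insert.prems(2)[of y C "max C D"] C that by simp
    ultimately show ?case using C(1) by (intro exI[of _ "max C D"]) auto
  qed auto
  then show ?thesis using that by blast
qed

section \<open>Circles without zeros\<close>

definition zerofree_circle :: "(complex \<Rightarrow> complex) \<Rightarrow> real \<Rightarrow> bool" where
  "zerofree_circle X r \<longleftrightarrow> (\<forall>z\<in>sphere 0 r. X z \<noteq> 0)"

text \<open>Countably many zeros and steps exclude only countably many starting radii from an
  uncountable interval.\<close>

lemma exists_generic_start:
  assumes fin: "finite F" and hol: "\<And>X. X \<in> F \<Longrightarrow> X holomorphic_on UNIV" and nz: "\<And>X. X \<in> F \<Longrightarrow> \<exists>z. X z \<noteq> 0"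
  obtains r0 where "r0 \<ge> R" "\<And>X n. X \<in> F \<Longrightarrow> zerofree_circle X (r0 + real n * \<rho>)"
proof -
  define N where "N = (\<Union>X\<in>F. \<Union>n. (\<lambda>z. norm z - real n * \<rho>) ` {z\<in>UNIV. X z = 0})"
  have zeros: "countable {z\<in>UNIV. X z = 0}" if X: "X \<in> F" for X
  proof (cases "X constant_on UNIV")
    case True
    moreover obtain z1 where "X z1 \<noteq> 0" using nz[OF X] by blast
    ultimately have "X z \<noteq> 0" for z unfolding constant_on_def by force
    then have "{z\<in>UNIV. X z = 0} = {}" by blast
    then show ?thesis by simp
  next
    case False
    show ?thesis
      by (rule holomorphic_countable_zeros[OF hol[OF X] open_UNIV connected_UNIV fsigma_UNIV False])
  qed
  have "countable N"
    unfolding N_def using countable_finite[OF fin] by (intro countable_UN countable_image zeros) auto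
  moreover have "\<not> countable {R..R + 1}"
    by (simp add: uncountable_closed_interval)
  ultimately have "\<not> {R..R + 1} \<subseteq> N"
    by (meson countable_subset)
  then obtain r0 where r0: "r0 \<in> {R..R + 1}" "r0 \<notin> N" by blast
  show ?thesis
  proof (rule that[of r0])
    show "r0 \<ge> R" using r0 by simp
    fix X n assume X: "X \<in> F"
    show "zerofree_circle X (r0 + real n * \<rho>)"
      unfolding zerofree_circle_def
    proof
      fix z :: complex assume z: "z \<in> sphere 0 (r0 + real n * \<rho>)"
      show "X z \<noteq> 0"
      proof
        assume "X z = 0"
        moreover have "r0 = norm z - real n * \<rho>" using z by simp
        ultimately have "r0 \<in> N" unfolding N_def using X by blast
        then show False using r0 by simp
      qed
    qed
  qed
qed

text \<open>On a zero-free circle a small level truncates nothing, so the facts about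
  \<open>lmax\<close> pass to \<open>ln |X|\<close> itself.\<close>

lemma zerofree_circle_lmax:
  assumes hol: "X holomorphic_on UNIV" and zf: "zerofree_circle X r"
  obtains \<epsilon>0 where "\<epsilon>0 > 0" "\<epsilon>0 \<le> 1"
    "\<And>\<epsilon> z. 0 < \<epsilon> \<Longrightarrow> \<epsilon> \<le> \<epsilon>0 \<Longrightarrow> z \<in> sphere 0 r \<Longrightarrow> lmax \<epsilon> X z = ln (norm (X z))"
proof (cases "sphere (0::complex) r = {}")
  case True
  then show ?thesis using that[of 1] by auto
next
  case False
  have cont: "continuous_on (sphere 0 r) (\<lambda>z. norm (X z))"
    by (intro continuous_on_norm holomorphic_on_imp_continuous_on holomorphic_on_subset[OF hol]) auto
  obtain w where w: "w \<in> sphere 0 r" "\<And>z. z \<in> sphere 0 r \<Longrightarrow> norm (X w) \<le> norm (X z)"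
    using continuous_attains_inf[OF compact_sphere False cont] by blast
  show ?thesis
  proof (rule that[of "min (norm (X w)) 1"])
    show "min (norm (X w)) 1 > 0" using w(1) zf by (auto simp: zerofree_circle_def)
    fix \<epsilon> and z :: complex assume "\<epsilon> \<le> min (norm (X w)) 1" "z \<in> sphere 0 r"
    then have "\<epsilon> \<le> norm (X z)" using w(2)[of z] by simp
    then show "lmax \<epsilon> X z = ln (norm (X z))" by (simp add: lmax_def max_def)
  qed simp
qed

definition lognorm :: "(complex \<Rightarrow> complex) \<Rightarrow> complex \<Rightarrow> real" where
  "lognorm X z = ln (norm (X z))"

lemma continuous_on_lognorm:
  assumes "X holomorphic_on UNIV" "zerofree_circle X r"
  shows "continuous_on (sphere 0 r) (lognorm X)"
proof -
  have "continuous_on (sphere 0 r) X"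
    by (intro holomorphic_on_imp_continuous_on holomorphic_on_subset[OF assms(1)]) auto
  then show ?thesis
    unfolding lognorm_def[abs_def] using assms(2)
    by (intro continuous_intros) (auto simp: zerofree_circle_def)
qed

lemma lognorm_mean_mono:
  assumes hol: "X holomorphic_on UNIV" and zf: "zerofree_circle X r" "zerofree_circle X R" and r: "0 \<le> r" "r \<le> R"
  shows "cmean (lognorm X) 0 r \<le> cmean (lognorm X) 0 R"
proof -
  obtain e1 where e1: "e1 > 0" "e1 \<le> 1"
    "\<And>\<epsilon> z. 0 < \<epsilon> \<Longrightarrow> \<epsilon> \<le> e1 \<Longrightarrow> z \<in> sphere 0 r \<Longrightarrow> lmax \<epsilon> X z = ln (norm (X z))"
    using zerofree_circle_lmax[OF hol zf(1)] by blast
  obtain e2 where e2: "e2 > 0" "e2 \<le> 1"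
    "\<And>\<epsilon> z. 0 < \<epsilon> \<Longrightarrow> \<epsilon> \<le> e2 \<Longrightarrow> z \<in> sphere 0 R \<Longrightarrow> lmax \<epsilon> X z = ln (norm (X z))"
    using zerofree_circle_lmax[OF hol zf(2)] by blast
  have "cmean (lognorm X) 0 r = cmean (lmax (min e1 e2) X) 0 r"
    using r e1 e2 by (intro cmean_cong) (auto simp: lognorm_def)
  also have "\<dots> \<le> cmean (lmax (min e1 e2) X) 0 R"
    using r e1 e2 by (intro lmax_mono_radius_entire hol) auto
  also have "\<dots> = cmean (lognorm X) 0 R"
    using r e1 e2 by (intro cmean_cong) (auto simp: lognorm_def)
  finally show ?thesis .
qed

lemma lognorm_mean_le_charT:
  assumes hol: "X holomorphic_on UNIV" and zf: "zerofree_circle X r" and r: "0 \<le> r"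
  shows "cmean (lognorm X) 0 r \<le> charT X r"
proof (rule cmean_mono)
  fix w :: complex assume "w \<in> sphere 0 r"
  then have "X w \<noteq> 0" using zf by (simp add: zerofree_circle_def)
  then show "lognorm X w \<le> lmax 1 X w"
    unfolding lognorm_def lmax_def by (intro ln_mono) auto
qed (use r hol zf in \<open>auto intro: continuous_on_lognorm continuous_on_lmax_entire\<close>)

text \<open>A form of the lemma on the logarithmic derivative which also covers shifts.\<close>

lemma log_quotient_majorant:
  assumes hol: "X holomorphic_on UNIV" and zf: "zerofree_circle X r" "zerofree_circle X (r + \<rho>)"
    and C: "\<And>t \<epsilon>. t \<ge> 1 \<Longrightarrow> \<epsilon> > 0 \<Longrightarrow> - C \<le> cmean (lmax \<epsilon> X) 0 t"
    and K: "0 < K" "K < \<rho>" and r: "r \<ge> \<rho> + 1"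
  obtains e where "continuous_on (sphere 0 r) e" "\<And>z. z \<in> sphere 0 r \<Longrightarrow> 0 \<le> e z"
    "\<And>z v. z \<in> sphere 0 r \<Longrightarrow> norm v \<le> K \<Longrightarrow> norm (X (z + v)) \<le> exp (e z) * norm (X z)"
    "cmean e 0 r \<le> cmean (lognorm X) 0 (r + \<rho>) - cmean (lognorm X) 0 r
        + 2 * K / (\<rho> - K) * (2 * charT X (r + \<rho>) + C)"
proof -
  obtain e1 where e1: "e1 > 0" "e1 \<le> 1"
    "\<And>\<epsilon> z. 0 < \<epsilon> \<Longrightarrow> \<epsilon> \<le> e1 \<Longrightarrow> z \<in> sphere 0 r \<Longrightarrow> lmax \<epsilon> X z = ln (norm (X z))"
    using zerofree_circle_lmax[OF hol zf(1)] by blast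
  obtain e2 where e2: "e2 > 0" "e2 \<le> 1"
    "\<And>\<epsilon> z. 0 < \<epsilon> \<Longrightarrow> \<epsilon> \<le> e2 \<Longrightarrow> z \<in> sphere 0 (r + \<rho>) \<Longrightarrow> lmax \<epsilon> X z = ln (norm (X z))"
    using zerofree_circle_lmax[OF hol zf(2)] by blast
  define \<epsilon> where "\<epsilon> = min e1 e2"
  have e: "\<epsilon> > 0" "\<epsilon> \<le> 1" "\<epsilon> \<le> e1" "\<epsilon> \<le> e2" using e1 e2 by (auto simp: \<epsilon>_def)
  define u where "u = lmax \<epsilon> X"
  define \<delta> where "\<delta> = 2 * K / (\<rho> - K)"
  have \<delta>: "\<delta> \<ge> 0" using K by (simp add: \<delta>_def)
  have cu: "continuous_on A u" for A unfolding u_def by (rule continuous_on_lmax_entire[OF hol e(1)])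
  have cau: "continuous_on A (\<lambda>w. \<bar>u w\<bar>)" for A by (intro continuous_intros cu)
  have cA: "continuous_on A (\<lambda>z. cmean u z \<rho>)" "continuous_on A (\<lambda>z. \<delta> * cmean (\<lambda>w. \<bar>u w\<bar>) z \<rho>)" for A
    by (intro continuous_intros continuous_on_cmean cu cau)+
  have cL: "continuous_on (sphere 0 r) (lognorm X)" by (rule continuous_on_lognorm[OF hol zf(1)])
  have r0: "0 \<le> r" "0 \<le> \<rho>" "r + \<rho> \<ge> 1" using r K by linarith+
  \<comment> \<open>The Harnack majorant of \<open>ln |X (z + v)|\<close> minus
    \<open>ln |X z|\<close>: the mean of the first term is bounded on the circle of radius
    \<open>r + \<rho>\<close>, so an increment of means remains.\<close>
  define E where "E = (\<lambda>z. cmean u z \<rho> + \<delta> * cmean (\<lambda>w. \<bar>u w\<bar>) z \<rho> - lognorm X z)"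
  have main: "norm (X (z + v)) \<le> exp (E z) * norm (X z)" if z: "z \<in> sphere 0 r" and v: "norm v \<le> K" for z v
  proof -
    have "X z \<noteq> 0" using zf(1) z by (simp add: zerofree_circle_def)
    have "norm (X (z + v)) \<le> exp (u (z + v))" unfolding u_def using e by (simp add: exp_lmax)
    also have "u (z + v) \<le> cmean u z \<rho> + \<delta> * cmean (\<lambda>w. \<bar>u w\<bar>) z \<rho>"
      unfolding u_def \<delta>_def by (rule lmax_le_cmean[OF hol e(1) v K(2)])
    also have "\<dots> = E z + lognorm X z" by (simp add: E_def)
    also have "exp (E z + lognorm X z) = exp (E z) * norm (X z)"
      using \<open>X z \<noteq> 0\<close> by (simp add: exp_add lognorm_def)
    finally show ?thesis by simp
  qed
  show ?thesis
  proof (rule that[of E])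
    show "continuous_on (sphere 0 r) E"
      unfolding E_def by (intro continuous_intros cA cL)
    show "norm (X (z + v)) \<le> exp (E z) * norm (X z)" if "z \<in> sphere 0 r" "norm v \<le> K" for z v
      by (rule main[OF that])
    \<comment> \<open>Taking \<open>v = 0\<close> in the comparison gives
      \<open>exp (E z) >= 1\<close>.\<close>
    show "0 \<le> E z" if z: "z \<in> sphere 0 r" for z
    proof -
      have "X z \<noteq> 0" using zf(1) z by (simp add: zerofree_circle_def)
      have "1 * norm (X z) \<le> exp (E z) * norm (X z)" using main[OF z, of 0] K by simp
      then have "1 \<le> exp (E z)" by (rule mult_right_le_imp_le) (use \<open>X z \<noteq> 0\<close> in simp)
      then show ?thesis by simp
    qed
    have "cmean E 0 r = cmean (\<lambda>z. cmean u z \<rho>) 0 r + \<delta> * cmean (\<lambda>z. cmean (\<lambda>w. \<bar>u w\<bar>) z \<rho>) 0 r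
            - cmean (lognorm X) 0 r"
    proof -
      have "cmean E 0 r = cmean (\<lambda>z. cmean u z \<rho> + \<delta> * cmean (\<lambda>w. \<bar>u w\<bar>) z \<rho>) 0 r - cmean (lognorm X) 0 r"
        unfolding E_def by (intro cmean_diff continuous_intros cA cL r0)
      also have "cmean (\<lambda>z. cmean u z \<rho> + \<delta> * cmean (\<lambda>w. \<bar>u w\<bar>) z \<rho>) 0 r
          = cmean (\<lambda>z. cmean u z \<rho>) 0 r + cmean (\<lambda>z. \<delta> * cmean (\<lambda>w. \<bar>u w\<bar>) z \<rho>) 0 r"
        by (intro cmean_add cA r0)
      finally show ?thesis by (simp add: cmean_cmult)
    qed
    also have "cmean (\<lambda>z. cmean u z \<rho>) 0 r \<le> cmean (lognorm X) 0 (r + \<rho>)"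
    proof (rule cmean_cmean_le[OF cu r0(2,1)])
      fix s assume "\<bar>r - \<rho>\<bar> \<le> s" "s \<le> r + \<rho>"
      then have "cmean u 0 s \<le> cmean u 0 (r + \<rho>)"
        unfolding u_def using e by (intro lmax_mono_radius_entire hol) auto
      also have "\<dots> = cmean (lognorm X) 0 (r + \<rho>)"
        using r0 e e2(3) by (intro cmean_cong) (auto simp: u_def lognorm_def)
      finally show "cmean u 0 s \<le> cmean (lognorm X) 0 (r + \<rho>)" .
    qed
    also have "\<delta> * cmean (\<lambda>z. cmean (\<lambda>w. \<bar>u w\<bar>) z \<rho>) 0 r \<le> \<delta> * (2 * charT X (r + \<rho>) + C)"
    proof (intro mult_left_mono \<delta> cmean_cmean_le[OF cau r0(2,1)])
      fix s assume s: "\<bar>r - \<rho>\<bar> \<le> s" "s \<le> r + \<rho>"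
      \<comment> \<open>From \<open>r >= \<rho> + 1\<close>: all inner radii stay in the range of
        the lower bound \<open>C\<close>.\<close>
      then have s1: "s \<ge> 1" using r by linarith
      have cl: "continuous_on (sphere 0 s) (lmax 1 X)" by (intro continuous_on_lmax_entire hol) simp
      have "cmean (\<lambda>w. \<bar>u w\<bar>) 0 s \<le> cmean (\<lambda>w. 2 * lmax 1 X w - u w) 0 s"
        using s1 e by (intro cmean_mono cau continuous_intros cl cu) (auto simp: u_def abs_lmax_le)
      also have "\<dots> = 2 * charT X s - cmean u 0 s"
        using s1 by (subst cmean_diff) (auto intro!: continuous_intros cl cu simp: cmean_cmult)
      also have "\<dots> \<le> 2 * charT X (r + \<rho>) + C"
        using C[OF s1 e(1)] lmax_mono_radius_entire[OF hol, of 1 s "r + \<rho>"] s s1 by (simp add: u_def)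
      finally show "cmean (\<lambda>w. \<bar>u w\<bar>) 0 s \<le> 2 * charT X (r + \<rho>) + C" .
    qed
    finally show "cmean E 0 r \<le> cmean (lognorm X) 0 (r + \<rho>) - cmean (lognorm X) 0 r
        + 2 * K / (\<rho> - K) * (2 * charT X (r + \<rho>) + C)"
      by (simp add: \<delta>_def)
  qed
qed

lemma lognorm_mean_ge:
  assumes hol: "X holomorphic_on UNIV" and zf: "zerofree_circle X r" and r: "1 \<le> r"
    and C: "\<And>t \<epsilon>. t \<ge> 1 \<Longrightarrow> \<epsilon> > 0 \<Longrightarrow> - C \<le> cmean (lmax \<epsilon> X) 0 t"
  shows "- C \<le> cmean (lognorm X) 0 r"
proof -
  obtain e1 where e1: "e1 > 0" "e1 \<le> 1"
    "\<And>\<epsilon> z. 0 < \<epsilon> \<Longrightarrow> \<epsilon> \<le> e1 \<Longrightarrow> z \<in> sphere 0 r \<Longrightarrow> lmax \<epsilon> X z = ln (norm (X z))"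
    using zerofree_circle_lmax[OF hol zf] by blast
  have "cmean (lognorm X) 0 r = cmean (lmax e1 X) 0 r"
    using r e1 by (intro cmean_cong) (auto simp: lognorm_def)
  then show ?thesis using C[OF r e1(1)] by simp
qed

text \<open>One total collects the characteristic of \<open>f\<close> and, for every
  \<open>X\<close> in \<open>F\<close>, the characteristic of \<open>X\<close> and the mean of
  \<open>ln |X|\<close>. A step of length \<open>\<rho>\<close> over which the total hardly grows is
  good for all of them simultaneously, and \<open>log_quotient_majorant\<close> then applies to each
  \<open>X\<close>.\<close>

lemma regular_radius:
  assumes f: "f holomorphic_on UNIV" "\<not> f constant_on UNIV"
    and s: "s < 1" "\<forall>\<^sub>F r in at_top. ln (charT f r) \<le> r powr s"
    and F: "finite F" "\<And>X. X \<in> F \<Longrightarrow> growth_le f X" "\<And>X. X \<in> F \<Longrightarrow> \<exists>z. X z \<noteq> 0"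
    and \<eta>: "\<eta> > 0" and K: "K > 0"
  obtains r e where "r \<ge> R0" "r \<ge> 1" "charT f r \<ge> M"
    "continuous_on (sphere 0 r) e" "\<And>z. z \<in> sphere 0 r \<Longrightarrow> 0 \<le> e z"
    "cmean e 0 r \<le> \<eta> * charT f r"
    "\<And>X z. X \<in> F \<Longrightarrow> z \<in> sphere 0 r \<Longrightarrow> X z \<noteq> 0"
    "\<And>X z v. X \<in> F \<Longrightarrow> z \<in> sphere 0 r \<Longrightarrow> norm v \<le> K \<Longrightarrow> norm (X (z + v)) \<le> exp (e z) * norm (X z)"
proof -
  define N where "N = real (card F)"
  have N: "N \<ge> 0" by (simp add: N_def)
  have hol: "X holomorphic_on UNIV" if "X \<in> F" for X using F(2)[OF that] by (rule growth_le_hol)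
  define P where "P = (\<lambda>X C. C \<ge> 0 \<and> (\<forall>r\<ge>1. charT X r \<le> C * (charT f (r + C) + 1))
      \<and> (\<forall>t\<ge>1. \<forall>\<epsilon>>0. - C \<le> cmean (lmax \<epsilon> X) 0 t))"
  have P_mono: "P X D" if P: "P X C" and CD: "C \<le> D" for X C D
    unfolding P_def
  proof (intro conjI allI impI)
    have C: "C \<ge> 0" using P by (simp add: P_def)
    then show "D \<ge> 0" using CD by simp
    fix r :: real assume r: "r \<ge> 1"
    have "charT X r \<le> C * (charT f (r + C) + 1)" using P r by (simp add: P_def)
    also have "\<dots> \<le> D * (charT f (r + D) + 1)"
    proof (rule mult_mono)
      show "charT f (r + C) + 1 \<le> charT f (r + D) + 1"
        using lmax_mono_radius_entire[OF f(1), of 1 "r + C" "r + D"] r C CD by simp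
      show "0 \<le> charT f (r + C) + 1"
        using charT_nonneg[OF f(1), of "r + C"] r C by simp
    qed (use C CD in auto)
    finally show "charT X r \<le> D * (charT f (r + D) + 1)" .
  next
    fix t \<epsilon> :: real assume "t \<ge> 1" "\<epsilon> > 0"
    then have "- C \<le> cmean (lmax \<epsilon> X) 0 t" using P by (simp add: P_def)
    then show "- D \<le> cmean (lmax \<epsilon> X) 0 t" using CD by simp
  qed
  have P_ex: "\<exists>C. P X C" if X: "X \<in> F" for X
  proof -
    obtain C1 where C1: "C1 \<ge> 0" "\<And>r. r \<ge> 1 \<Longrightarrow> charT X r \<le> C1 * (charT f (r + C1) + 1)"
      using F(2)[OF X] by (auto simp: growth_le_def)
    obtain z1 where "X z1 \<noteq> 0" using F(3)[OF X] by blast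
    then obtain C2 where C2: "C2 \<ge> 0" "\<And>r \<epsilon>. r \<ge> 1 \<Longrightarrow> \<epsilon> > 0 \<Longrightarrow> - C2 \<le> cmean (lmax \<epsilon> X) 0 r"
      using cmean_lmax_ge[OF hol[OF X]] by metis
    define D where "D = max C1 C2"
    have "charT X r \<le> D * (charT f (r + D) + 1)" if r: "r \<ge> 1" for r
    proof -
      have "charT X r \<le> C1 * (charT f (r + C1) + 1)" by (rule C1(2)[OF r])
      also have "\<dots> \<le> D * (charT f (r + D) + 1)"
      proof (rule mult_mono)
        show "charT f (r + C1) + 1 \<le> charT f (r + D) + 1"
          using lmax_mono_radius_entire[OF f(1), of 1 "r + C1" "r + D"] r C1 by (simp add: D_def)
        show "0 \<le> charT f (r + C1) + 1"
          using charT_nonneg[OF f(1), of "r + C1"] r C1 by simp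
      qed (use C1 in \<open>auto simp: D_def\<close>)
      finally show ?thesis .
    qed
    moreover have "- D \<le> cmean (lmax \<epsilon> X) 0 t" if "t \<ge> 1" "\<epsilon> > 0" for t \<epsilon>
      using C2(2)[OF that] by (simp add: D_def)
    moreover have "D \<ge> 0" using C1 by (simp add: D_def)
    ultimately show ?thesis unfolding P_def by blast
  qed
  obtain C where C: "C \<ge> 1" "\<And>X. X \<in> F \<Longrightarrow> P X C"
    by (rule finite_uniform_bound[OF F(1) P_ex P_mono]) auto
  have C_up: "charT X r \<le> C * (charT f (r + C) + 1)" if "X \<in> F" "r \<ge> 1" for X r
    using C(2)[OF that(1)] that(2) by (simp add: P_def)
  have C_lo: "- C \<le> cmean (lmax \<epsilon> X) 0 t" if "X \<in> F" "t \<ge> 1" "\<epsilon> > 0" for X t \<epsilon>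
    using C(2)[OF that(1)] that(2,3) by (simp add: P_def)
  \<comment> \<open>\<open>a n <= D * (charT f (R n + C) + 1)\<close>: one share for
    \<open>f\<close>, and two shares of \<open>C\<close> for each of the \<open>N\<close>
    functions.\<close>
  define D where "D = 1 + 2 * N * C"
  \<comment> \<open>The tolerance is split into shares \<open>\<eta> / (N + 1)\<close>, half for the
    increment of the means and half for the Harnack error. The first bound in \<open>\<eta>'\<close>
    absorbs \<open>A\<close> into \<open>a n\<close>, the second yields the half share from
    \<open>a n <= 4 * D * T\<close>; in \<open>\<delta>0\<close> the factor \<open>9 * C + 4\<close>
    anticipates \<open>TX\<close>.\<close>
  define \<eta>' where "\<eta>' = min (1 / (2 * D)) (\<eta> / (8 * D * (N + 1)))"
  define \<delta>0 where "\<delta>0 = \<eta> / (2 * (N + 1) * (9 * C + 4))"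
  \<comment> \<open>The terms with \<open>K\<close> make the Harnack factor
    \<open>2 * K / (\<rho> - K)\<close> at most \<open>\<delta>0\<close>; the term \<open>C\<close>
    puts the radius \<open>r + C\<close> from \<open>growth_le\<close> inside the next
    circle.\<close>
  define \<rho> where "\<rho> = K + 2 * K / \<delta>0 + C + 1"
  have D: "D \<ge> 1" using N C(1) by (simp add: D_def)
  have \<eta>': "\<eta>' > 0" "\<eta>' * D \<le> 1 / 2" "\<eta>' * (8 * D * (N + 1)) \<le> \<eta>"
  proof -
    show "\<eta>' > 0" using \<eta> D N by (simp add: \<eta>'_def)
    have "\<eta>' \<le> 1 / (2 * D)" by (simp add: \<eta>'_def)
    then show "\<eta>' * D \<le> 1 / 2" using D by (simp add: field_simps)
    have "\<eta>' \<le> \<eta> / (8 * D * (N + 1))" by (simp add: \<eta>'_def)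
    then show "\<eta>' * (8 * D * (N + 1)) \<le> \<eta>" using D N by (simp add: pos_le_divide_eq)
  qed
  have \<delta>0: "\<delta>0 > 0" "\<delta>0 * (2 * (N + 1) * (9 * C + 4)) = \<eta>"
    using \<eta> N C(1) by (auto simp: \<delta>0_def add_nonneg_eq_0_iff)
  have q0: "2 * K / \<delta>0 > 0" using K \<delta>0 by simp
  have \<rho>: "K < \<rho>" "\<rho> > 0" "\<rho> \<ge> C" using K q0 C(1) unfolding \<rho>_def by linarith+
  have \<delta>: "2 * K / (\<rho> - K) \<le> \<delta>0"
  proof -
    have "2 * K / \<delta>0 \<le> \<rho> - K" using C(1) by (simp add: \<rho>_def)
    then have "2 * K \<le> (\<rho> - K) * \<delta>0" using \<delta>0(1) by (simp add: pos_divide_le_eq)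
    then show ?thesis using \<rho> by (simp add: pos_divide_le_eq mult.commute)
  qed
  have \<delta>_nn: "0 \<le> 2 * K / (\<rho> - K)" using K \<rho> by simp
  \<comment> \<open>The amount \<open>N * C\<close> offsets the possibly negative means of
    \<open>ln |X|\<close>, so that the total is at least 1.\<close>
  obtain R1 where R1: "R1 \<ge> 1" "\<And>r. r \<ge> R1 \<Longrightarrow> charT f r \<ge> max M (N * C + 1)"
    using charT_at_top[OF f, of "max M (N * C + 1)"] by metis
  obtain R2 where R2: "\<And>r. r \<ge> R2 \<Longrightarrow> ln (charT f r) \<le> r powr s"
    using s(2) unfolding eventually_at_top_linorder by blast
  obtain r0 where r0: "r0 \<ge> max (max R0 R1) (max R2 (\<rho> + 1))"
    "\<And>X n. X \<in> F \<Longrightarrow> zerofree_circle X (r0 + real n * \<rho>)"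
    using exists_generic_start[OF F(1) hol F(3), of "max (max R0 R1) (max R2 (\<rho> + 1))" \<rho>] by metis
  define R where "R = (\<lambda>n. r0 + real n * \<rho>)"
  have Rn: "R n \<ge> r0" for n using \<rho> by (simp add: R_def)
  have Rn': "R n \<ge> R0" "R n \<ge> R1" "R n \<ge> R2" "R n \<ge> \<rho> + 1" for n using Rn[of n] r0(1) by auto
  have RS: "R (Suc n) = R n + \<rho>" for n by (simp add: R_def algebra_simps)
  have Rn1: "R n \<ge> 1" for n using Rn'(2)[of n] R1(1) by simp
  have zf: "zerofree_circle X (R n)" if "X \<in> F" for X n using r0(2)[OF that] by (simp add: R_def)
  define J where "J = (\<lambda>X r. cmean (lognorm X) 0 r)"
  have J_lo: "- C \<le> J X (R n)" if X: "X \<in> F" for X n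
    unfolding J_def by (rule lognorm_mean_ge[OF hol[OF X] zf[OF X] Rn1 C_lo[OF X]])
  have J_up: "J X (R n) \<le> charT X (R n)" if X: "X \<in> F" for X n
    unfolding J_def by (rule lognorm_mean_le_charT[OF hol[OF X] zf[OF X]]) (use Rn1[of n] in simp)
  \<comment> \<open>All summands are nondecreasing along the radii, so a small increment of the
    total bounds the increment of each.\<close>
  define \<Phi> where "\<Phi> = (\<lambda>r. charT f r + (\<Sum>X\<in>F. charT X r + J X r))"
  define a where "a = (\<lambda>n. \<Phi> (R n))"
  have T1: "charT f (R n) \<ge> N * C + 1" "charT f (R n) \<ge> M" for n using R1(2)[OF Rn'(2)] by auto
  have T1': "charT f (R n) \<ge> 1" for n using T1(1)[of n] N C(1) by (smt (verit) mult_nonneg_nonneg)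
  have a1: "a n \<ge> 1" for n
  proof -
    have "(\<Sum>X\<in>F. - C) \<le> (\<Sum>X\<in>F. charT X (R n) + J X (R n))"
    proof (rule sum_mono)
      fix X assume X: "X \<in> F"
      have "charT X (R n) \<ge> 0" by (rule charT_nonneg[OF hol[OF X]]) (use Rn1[of n] in simp)
      then show "- C \<le> charT X (R n) + J X (R n)" using J_lo[OF X, of n] by simp
    qed
    then show ?thesis using T1(1)[of n] by (simp add: a_def \<Phi>_def N_def)
  qed
  have a_up: "a n \<le> D * (charT f (R n + C) + 1)" for n
  proof -
    define t where "t = charT f (R n + C) + 1"
    have "(\<Sum>X\<in>F. charT X (R n) + J X (R n)) \<le> (\<Sum>X\<in>F. 2 * (C * t))"
    proof (rule sum_mono)
      fix X assume X: "X \<in> F"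
      show "charT X (R n) + J X (R n) \<le> 2 * (C * t)"
        using C_up[OF X Rn1[of n]] J_up[OF X, of n] by (simp add: t_def)
    qed
    moreover have "charT f (R n) \<le> t"
      using lmax_mono_radius_entire[OF f(1), of 1 "R n" "R n + C"] Rn1[of n] C(1) by (simp add: t_def)
    ultimately have "a n \<le> t + N * (2 * (C * t))" by (simp add: a_def \<Phi>_def N_def)
    also have "\<dots> = D * t" by (simp add: D_def algebra_simps)
    finally show ?thesis by (simp add: t_def)
  qed
  have up: "ln (a n) \<le> ln (2 * D) + (r0 + C + real n * \<rho>) powr s" for n
  proof -
    have t1: "charT f (R n + C) \<ge> 1"
      using lmax_mono_radius_entire[OF f(1), of 1 "R n" "R n + C"] Rn1[of n] C(1) T1'[of n] by simp
    have "a n \<le> 2 * D * charT f (R n + C)"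
      using order_trans[OF a_up[of n], of "D * (2 * charT f (R n + C))"] t1 D by simp
    then have "ln (a n) \<le> ln (2 * D * charT f (R n + C))" using a1[of n] by (intro ln_mono) auto
    also have "\<dots> = ln (2 * D) + ln (charT f (R n + C))" using D t1 by (intro ln_mult_pos) auto
    also have "ln (charT f (R n + C)) \<le> (R n + C) powr s" by (rule R2) (use Rn'(3)[of n] C(1) in linarith)
    finally show ?thesis by (simp add: R_def add_ac)
  qed
  obtain n where n: "a (Suc n) \<le> (1 + \<eta>') * a n"
    by (rule exists_slow_step[OF a1 _ s(1) \<rho>(2) up, of "1 + \<eta>'"]) (use \<eta>' in auto)
  define r where "r = R n"
  have r: "r \<ge> 1" "r \<ge> R0" "r \<ge> \<rho> + 1" "r + \<rho> = R (Suc n)" using Rn1 Rn' RS by (auto simp: r_def)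
  define T where "T = charT f r"
  define A where "A = \<eta>' * a n"
  have T: "T \<ge> 1" "T \<ge> M" using T1' T1(2) by (auto simp: T_def r_def)
  have incT: "charT X r \<le> charT X (r + \<rho>)" if "X holomorphic_on UNIV" for X
    by (rule lmax_mono_radius_entire[OF that]) (use r \<rho> in auto)
  have incJ: "J X r \<le> J X (r + \<rho>)" if X: "X \<in> F" for X
    unfolding J_def by (rule lognorm_mean_mono[OF hol[OF X]]) (use zf[OF X] r \<rho> in \<open>auto simp: r_def\<close>)
  have tot: "(charT f (r + \<rho>) - charT f r) + (\<Sum>X\<in>F. (charT X (r + \<rho>) - charT X r) + (J X (r + \<rho>) - J X r)) \<le> A"
  proof -
    have "a (Suc n) - a n \<le> A" using n by (simp add: A_def algebra_simps)
    moreover have "a (Suc n) = \<Phi> (r + \<rho>)" unfolding r(4) a_def ..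
    moreover have "a n = \<Phi> r" unfolding r_def a_def ..
    ultimately have "\<Phi> (r + \<rho>) - \<Phi> r \<le> A" by simp
    moreover have "\<Phi> (r + \<rho>) - \<Phi> r = (charT f (r + \<rho>) - charT f r)
        + (\<Sum>X\<in>F. (charT X (r + \<rho>) - charT X r) + (J X (r + \<rho>) - J X r))"
      by (simp add: \<Phi>_def sum.distrib sum_subtractf)
    ultimately show ?thesis by simp
  qed
  have sum_nn: "0 \<le> (\<Sum>X\<in>F. (charT X (r + \<rho>) - charT X r) + (J X (r + \<rho>) - J X r))"
    by (intro sum_nonneg) (use incT hol incJ in fastforce)
  have iT: "charT f (r + \<rho>) \<le> T + A" using tot sum_nn by (simp add: T_def)
  have iX: "charT X (r + \<rho>) - charT X r \<le> A \<and> J X (r + \<rho>) - J X r \<le> A" if X: "X \<in> F" for X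
  proof -
    have "(charT X (r + \<rho>) - charT X r) + (J X (r + \<rho>) - J X r)
        \<le> (\<Sum>X\<in>F. (charT X (r + \<rho>) - charT X r) + (J X (r + \<rho>) - J X r))"
      by (rule member_le_sum[OF X _ F(1)]) (use incT hol incJ in fastforce)
    then have "(charT X (r + \<rho>) - charT X r) + (J X (r + \<rho>) - J X r) \<le> A"
      using tot incT[OF f(1)] by simp
    then show ?thesis using incT[OF hol[OF X]] incJ[OF X] by simp
  qed
  have TC: "charT f (r + C) \<le> T + A"
  proof -
    have "charT f (r + C) \<le> charT f (r + \<rho>)"
      by (rule lmax_mono_radius_entire[OF f(1)]) (use r \<rho> C(1) in auto)
    then show ?thesis using iT by simp
  qed
  \<comment> \<open>\<open>a n\<close> reappears on the right through \<open>A\<close>, but with a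
    factor \<open>\<eta>' * D <= 1 / 2\<close>, and is absorbed.\<close>
  have an: "a n \<le> 4 * D * T"
  proof -
    have "a n \<le> D * (charT f (r + C) + 1)" using a_up[of n] by (simp add: r_def)
    also have "\<dots> \<le> D * (T + A + 1)" using TC D by (intro mult_left_mono) auto
    also have "\<dots> = D * T + D + (\<eta>' * D) * a n" by (simp add: A_def algebra_simps)
    also have "(\<eta>' * D) * a n \<le> 1 / 2 * a n" using \<eta>'(2) a1[of n] by (intro mult_right_mono) auto
    finally have "a n \<le> 2 * (D * T) + 2 * D" by simp
    also have "2 * D \<le> 2 * (D * T)" using D T by simp
    finally show ?thesis by simp
  qed
  have A2: "A \<le> 2 * T"
  proof -
    have "A \<le> \<eta>' * (4 * D * T)" unfolding A_def using an \<eta>'(1) by (intro mult_left_mono) auto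
    also have "\<dots> = 4 * T * (\<eta>' * D)" by (simp add: mult_ac)
    also have "\<dots> \<le> 4 * T * (1 / 2)" using \<eta>'(2) T by (intro mult_left_mono) auto
    finally show ?thesis by simp
  qed
  have A3: "A \<le> \<eta> / (2 * (N + 1)) * T"
  proof -
    have "A \<le> \<eta>' * (4 * D * T)" unfolding A_def using an \<eta>'(1) by (intro mult_left_mono) auto
    also have "\<dots> = (\<eta>' * (8 * D * (N + 1))) * T / (2 * (N + 1))" using N by (simp add: field_simps)
    also have "\<dots> \<le> \<eta> * T / (2 * (N + 1))"
      using \<eta>'(3) T N by (intro divide_right_mono mult_right_mono) auto
    finally show ?thesis by simp
  qed
  \<comment> \<open>\<open>T + A + 1 <= 4 * T\<close> gives \<open>charT X r <= 4 * C * T\<close>;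
    the step to \<open>r + \<rho>\<close> adds \<open>A <= 2 * T\<close>, and
    \<open>C <= C * T\<close>.\<close>
  have TX: "2 * charT X (r + \<rho>) + C \<le> (9 * C + 4) * T" if X: "X \<in> F" for X
  proof -
    have "charT X r \<le> C * (charT f (r + C) + 1)" by (rule C_up[OF X r(1)])
    also have "\<dots> \<le> C * (4 * T)" using TC A2 T C(1) by (intro mult_left_mono) auto
    finally have "charT X (r + \<rho>) \<le> 4 * (C * T) + 2 * T" using iX[OF X] A2 by linarith
    moreover have "C \<le> C * T" using C(1) T by simp
    ultimately have "2 * charT X (r + \<rho>) + C \<le> 9 * (C * T) + 4 * T" by linarith
    then show ?thesis by (simp add: algebra_simps)
  qed
  have "\<exists>e. continuous_on (sphere 0 r) e \<and> (\<forall>z\<in>sphere 0 r. 0 \<le> e z) \<and>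
    (\<forall>z\<in>sphere 0 r. \<forall>v. norm v \<le> K \<longrightarrow> norm (X (z + v)) \<le> exp (e z) * norm (X z)) \<and>
    cmean e 0 r \<le> \<eta> / (N + 1) * T" if X: "X \<in> F" for X
  proof -
    have zf1: "zerofree_circle X r" "zerofree_circle X (r + \<rho>)" using zf[OF X] r(4) by (auto simp: r_def)
    obtain e where e: "continuous_on (sphere 0 r) e" "\<And>z. z \<in> sphere 0 r \<Longrightarrow> 0 \<le> e z"
      "\<And>z v. z \<in> sphere 0 r \<Longrightarrow> norm v \<le> K \<Longrightarrow> norm (X (z + v)) \<le> exp (e z) * norm (X z)"
      "cmean e 0 r \<le> cmean (lognorm X) 0 (r + \<rho>) - cmean (lognorm X) 0 r
          + 2 * K / (\<rho> - K) * (2 * charT X (r + \<rho>) + C)"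
      using log_quotient_majorant[OF hol[OF X] zf1 C_lo[OF X] K \<rho>(1) r(3)] by metis
    have "2 * K / (\<rho> - K) * (2 * charT X (r + \<rho>) + C) \<le> 2 * K / (\<rho> - K) * ((9 * C + 4) * T)"
      using TX[OF X] \<delta>_nn by (rule mult_left_mono)
    also have "\<dots> \<le> \<delta>0 * ((9 * C + 4) * T)"
      using \<delta> C(1) T by (intro mult_right_mono) auto
    also have "\<dots> = (\<delta>0 * (2 * (N + 1) * (9 * C + 4))) * T / (2 * (N + 1))"
      using N by (simp add: field_simps)
    also have "\<dots> = \<eta> / (2 * (N + 1)) * T" by (simp only: \<delta>0(2)) simp
    finally have "cmean e 0 r \<le> A + \<eta> / (2 * (N + 1)) * T"
      using e(4) iX[OF X] by (simp add: J_def)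
    also have "\<dots> \<le> \<eta> / (2 * (N + 1)) * T + \<eta> / (2 * (N + 1)) * T" by (rule add_right_mono[OF A3])
    also have "\<dots> = \<eta> / (N + 1) * T"
    proof -
      have "\<eta> / (2 * m) * T + \<eta> / (2 * m) * T = \<eta> / m * T" for m by simp
      then show ?thesis .
    qed
    finally show ?thesis using e by blast
  qed
  then obtain e where e: "\<And>X. X \<in> F \<Longrightarrow> continuous_on (sphere 0 r) (e X)"
    "\<And>X z. X \<in> F \<Longrightarrow> z \<in> sphere 0 r \<Longrightarrow> 0 \<le> e X z"
    "\<And>X z v. X \<in> F \<Longrightarrow> z \<in> sphere 0 r \<Longrightarrow> norm v \<le> K \<Longrightarrow> norm (X (z + v)) \<le> exp (e X z) * norm (X z)"
    "\<And>X. X \<in> F \<Longrightarrow> cmean (e X) 0 r \<le> \<eta> / (N + 1) * T"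
    by metis
  define E where "E = (\<lambda>z. \<Sum>X\<in>F. e X z)"
  show ?thesis
  proof (rule that[of r E])
    show "continuous_on (sphere 0 r) E" unfolding E_def by (intro continuous_intros e(1))
    show "0 \<le> E z" if "z \<in> sphere 0 r" for z
      unfolding E_def by (intro sum_nonneg e(2) that)
    have "cmean E 0 r = (\<Sum>X\<in>F. cmean (e X) 0 r)"
      unfolding E_def by (rule cmean_sum[OF F(1) e(1)]) (use r in auto)
    also have "\<dots> \<le> (\<Sum>X\<in>F. \<eta> / (N + 1) * T)" by (intro sum_mono e(4))
    also have "\<dots> = N / (N + 1) * (\<eta> * T)" by (simp add: N_def)
    also have "\<dots> \<le> 1 * (\<eta> * T)" using N \<eta> T by (intro mult_right_mono) (auto simp: divide_le_eq)
    finally show "cmean E 0 r \<le> \<eta> * charT f r" by (simp add: T_def)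
    show "X z \<noteq> 0" if "X \<in> F" "z \<in> sphere 0 r" for X z
      using zf[OF that(1), of n] that(2) by (simp add: zerofree_circle_def r_def)
    show "norm (X (z + v)) \<le> exp (E z) * norm (X z)"
      if X: "X \<in> F" and z: "z \<in> sphere 0 r" and v: "norm v \<le> K" for X z v
    proof -
      have "e X z \<le> E z" unfolding E_def by (rule member_le_sum[OF X _ F(1)]) (use e(2) z in auto)
      then have "exp (e X z) * norm (X z) \<le> exp (E z) * norm (X z)" by (intro mult_right_mono) auto
      then show ?thesis using e(3)[OF X z v] by simp
    qed
  qed (use r T in \<open>auto simp: T_def\<close>)
qed

text \<open>The functions \<open>e k\<close> play the part of Nevanlinna's error term
  \<open>S(r, f)\<close>, as pointwise data along a sequence of circles.\<close>

definition admissible :: "(complex \<Rightarrow> complex) \<Rightarrow> (nat \<Rightarrow> real) \<Rightarrow> (nat \<Rightarrow> complex \<Rightarrow> real) \<Rightarrow> bool" where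
  "admissible f r e \<longleftrightarrow>
     (\<forall>k. r k \<ge> 1 \<and> continuous_on (sphere 0 (r k)) (e k) \<and> (\<forall>z\<in>sphere 0 (r k). 0 \<le> e k z)) \<and>
     filterlim (\<lambda>k. charT f (r k)) at_top sequentially \<and>
     (\<lambda>k. cmean (e k) 0 (r k) / charT f (r k)) \<longlonglongrightarrow> 0"

lemma regular_circles:
  assumes f: "f holomorphic_on UNIV" "\<not> f constant_on UNIV" "hyper_order f < 1"
    and F: "finite F" "\<And>X. X \<in> F \<Longrightarrow> growth_le f X"
    and K: "K > 0"
  obtains r e where "admissible f r e"
    "\<And>X k z w. X \<in> F \<Longrightarrow> z \<in> sphere 0 (r k) \<Longrightarrow> X w \<noteq> 0 \<Longrightarrow> X z \<noteq> 0"
    "\<And>X k z v. X \<in> F \<Longrightarrow> z \<in> sphere 0 (r k) \<Longrightarrow> norm v \<le> K \<Longrightarrow>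
       norm (X (z + v)) \<le> exp (e k z) * norm (X z)"
proof -
  obtain s where s: "s < 1" "\<forall>\<^sub>F r in at_top. ln (charT f r) \<le> r powr s"
    using hyper_order_less_1[OF f(1,3)] by blast
  \<comment> \<open>Identically vanishing members, such as \<open>exp_deriv_rest\<close> at index 0,
    have no zero-free circles but satisfy the comparison trivially.\<close>
  define G where "G = {X\<in>F. \<exists>z. X z \<noteq> 0}"
  have G: "finite G" "\<And>X. X \<in> G \<Longrightarrow> growth_le f X" "\<And>X. X \<in> G \<Longrightarrow> \<exists>z. X z \<noteq> 0"
    using F by (auto simp: G_def)
  have "\<exists>r e. r \<ge> 1 \<and> charT f r \<ge> real k + 1 \<and> continuous_on (sphere 0 r) e \<and> (\<forall>z\<in>sphere 0 r. 0 \<le> e z)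
      \<and> cmean e 0 r \<le> 1 / (real k + 1) * charT f r \<and> (\<forall>X\<in>G. \<forall>z\<in>sphere 0 r. X z \<noteq> 0)
      \<and> (\<forall>X\<in>G. \<forall>z\<in>sphere 0 r. \<forall>v. norm v \<le> K \<longrightarrow> norm (X (z + v)) \<le> exp (e z) * norm (X z))" for k :: nat
  proof -
    have "1 / (real k + 1) > 0" by simp
    then show ?thesis
      using regular_radius[OF f(1,2) s G, of "1 / (real k + 1)" K 1 "real k + 1"] K by (smt (verit, best))
  qed
  then obtain r e where re: "\<And>k. r k \<ge> 1" "\<And>k. charT f (r k) \<ge> real k + 1" "\<And>k. continuous_on (sphere 0 (r k)) (e k)"
    "\<And>k z. z \<in> sphere 0 (r k) \<Longrightarrow> 0 \<le> e k z" "\<And>k. cmean (e k) 0 (r k) \<le> 1 / (real k + 1) * charT f (r k)"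
    "\<And>k X z. X \<in> G \<Longrightarrow> z \<in> sphere 0 (r k) \<Longrightarrow> X z \<noteq> 0"
    "\<And>k X z v. X \<in> G \<Longrightarrow> z \<in> sphere 0 (r k) \<Longrightarrow> norm v \<le> K \<Longrightarrow> norm (X (z + v)) \<le> exp (e k z) * norm (X z)"
    by metis
  have top: "filterlim (\<lambda>k. charT f (r k)) at_top sequentially"
  proof (rule filterlim_at_top_mono[OF filterlim_real_sequentially])
    have "real k \<le> charT f (r k)" for k using re(2)[of k] by simp
    then show "\<forall>\<^sub>F k in sequentially. real k \<le> charT f (r k)" by simp
  qed
  have "(\<lambda>k. cmean (e k) 0 (r k) / charT f (r k)) \<longlonglongrightarrow> 0"
  proof (rule tendsto_sandwich[OF _ _ tendsto_const])
    have T: "charT f (r k) > 0" for k using re(2)[of k] by simp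
    have "0 \<le> cmean (e k) 0 (r k)" for k using re(1)[of k] by (intro cmean_nonneg re(3,4)) auto
    then show "\<forall>\<^sub>F k in sequentially. 0 \<le> cmean (e k) 0 (r k) / charT f (r k)"
      using T by (simp add: less_imp_le)
    have "cmean (e k) 0 (r k) / charT f (r k) \<le> 1 / real (Suc k)" for k
      using re(5)[of k] T[of k] by (simp add: pos_divide_le_eq add.commute)
    then show "\<forall>\<^sub>F k in sequentially. cmean (e k) 0 (r k) / charT f (r k) \<le> 1 / real (Suc k)" by simp
    show "(\<lambda>k. 1 / real (Suc k)) \<longlonglongrightarrow> 0" by (rule LIMSEQ_Suc[OF lim_1_over_n])
  qed
  then have adm: "admissible f r e" using re(1,3,4) top by (simp add: admissible_def)
  show ?thesis
  proof (rule that[OF adm])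
    fix X k and z :: complex assume X: "X \<in> F" and z: "z \<in> sphere 0 (r k)"
    show "X z \<noteq> 0" if "X w \<noteq> 0" for w
      using re(6)[of X z k] X z that by (auto simp: G_def)
    show "norm (X (z + v)) \<le> exp (e k z) * norm (X z)" if "norm v \<le> K" for v
    proof (cases "X \<in> G")
      case False
      then have "X w = 0" for w using X by (simp add: G_def)
      then show ?thesis by simp
    qed (use re(7) z that in auto)
  qed
qed

section \<open>Comparison on the regular circles\<close>

locale circles =
  fixes r :: "nat \<Rightarrow> real" and e :: "nat \<Rightarrow> complex \<Rightarrow> real"
  assumes e_nonneg: "z \<in> sphere 0 (r k) \<Longrightarrow> 0 \<le> e k z"
begin

text \<open>Comparison up to factors whose logarithm is \<open>O(1 + e)\<close>, hence \<open>o(T(r, f))\<close> in the mean if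
  \<open>admissible f r e\<close>.\<close>

definition dominated :: "(complex \<Rightarrow> real) \<Rightarrow> (complex \<Rightarrow> real) \<Rightarrow> bool" (infix "\<preceq>" 50) where
  "g \<preceq> h \<longleftrightarrow> (\<exists>C\<ge>0. \<forall>k. \<forall>z\<in>sphere 0 (r k). g z \<le> exp (C * (1 + e k z)) * h z)"

lemma domE:
  assumes "g \<preceq> h"
  obtains C where "C \<ge> 0" "\<And>k z. z \<in> sphere 0 (r k) \<Longrightarrow> g z \<le> exp (C * (1 + e k z)) * h z"
  using assms unfolding dominated_def by blast

lemma domI:
  assumes "C \<ge> 0" "\<And>k z. z \<in> sphere 0 (r k) \<Longrightarrow> g z \<le> exp (C * (1 + e k z)) * h z"
  shows "g \<preceq> h"
  using assms unfolding dominated_def by blast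

lemma dom_le:
  assumes "\<And>z. g z \<le> h z"
  shows "g \<preceq> h"
  by (rule domI[of 0]) (use assms in auto)

lemma dom_trans [trans]:
  assumes "g \<preceq> h" "h \<preceq> u"
  shows "g \<preceq> u"
proof -
  obtain C where C: "C \<ge> 0" "\<And>k z. z \<in> sphere 0 (r k) \<Longrightarrow> g z \<le> exp (C * (1 + e k z)) * h z"
    using assms(1) by (rule domE) blast
  obtain D where D: "D \<ge> 0" "\<And>k z. z \<in> sphere 0 (r k) \<Longrightarrow> h z \<le> exp (D * (1 + e k z)) * u z"
    using assms(2) by (rule domE) blast
  show ?thesis
  proof (rule domI[of "C + D"])
    fix k and z :: complex assume z: "z \<in> sphere 0 (r k)"
    have "g z \<le> exp (C * (1 + e k z)) * h z" by (rule C(2)[OF z])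
    also have "\<dots> \<le> exp (C * (1 + e k z)) * (exp (D * (1 + e k z)) * u z)"
      by (intro mult_left_mono D(2)[OF z]) auto
    also have "\<dots> = exp ((C + D) * (1 + e k z)) * u z"
      by (simp add: distrib_right exp_add mult.assoc)
    finally show "g z \<le> exp ((C + D) * (1 + e k z)) * u z" .
  qed (use C D in auto)
qed

lemma dom_mult:
  assumes "g \<preceq> h" "g' \<preceq> h'" "\<And>z. 0 \<le> g z" "\<And>z. 0 \<le> g' z"
  shows "(\<lambda>z. g z * g' z) \<preceq> (\<lambda>z. h z * h' z)"
proof -
  obtain C where C: "C \<ge> 0" "\<And>k z. z \<in> sphere 0 (r k) \<Longrightarrow> g z \<le> exp (C * (1 + e k z)) * h z"
    using assms(1) by (rule domE) blast
  obtain D where D: "D \<ge> 0" "\<And>k z. z \<in> sphere 0 (r k) \<Longrightarrow> g' z \<le> exp (D * (1 + e k z)) * h' z"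
    using assms(2) by (rule domE) blast
  show ?thesis
  proof (rule domI[of "C + D"])
    fix k and z :: complex assume z: "z \<in> sphere 0 (r k)"
    have "0 \<le> exp (C * (1 + e k z)) * h z" using C(2)[OF z] assms(3)[of z] by linarith
    then have "g z * g' z \<le> (exp (C * (1 + e k z)) * h z) * (exp (D * (1 + e k z)) * h' z)"
      by (intro mult_mono C(2)[OF z] D(2)[OF z] assms)
    also have "\<dots> = exp ((C + D) * (1 + e k z)) * (h z * h' z)"
      by (simp add: distrib_right exp_add mult_ac)
    finally show "g z * g' z \<le> exp ((C + D) * (1 + e k z)) * (h z * h' z)" .
  qed (use C D in auto)
qed

lemma dom_add:
  assumes "g \<preceq> h" "g' \<preceq> h" "\<And>z. 0 \<le> h z"
  shows "(\<lambda>z. g z + g' z) \<preceq> h"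
proof -
  obtain C where C: "C \<ge> 0" "\<And>k z. z \<in> sphere 0 (r k) \<Longrightarrow> g z \<le> exp (C * (1 + e k z)) * h z"
    using assms(1) by (rule domE) blast
  obtain D where D: "D \<ge> 0" "\<And>k z. z \<in> sphere 0 (r k) \<Longrightarrow> g' z \<le> exp (D * (1 + e k z)) * h z"
    using assms(2) by (rule domE) blast
  show ?thesis
  proof (rule domI[of "C + D + 1"])
    fix k and z :: complex assume z: "z \<in> sphere 0 (r k)"
    define x where "x = 1 + e k z"
    have x: "x \<ge> 1" using e_nonneg[OF z] by (simp add: x_def)
    have le: "exp (C * x) \<le> exp ((C + D) * x)" "exp (D * x) \<le> exp ((C + D) * x)"
      using C(1) D(1) x by auto
    \<comment> \<open>The summand 1 in \<open>1 + e k z\<close> pays for the factor 2 from adding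
      two bounds.\<close>
    have two: "2 \<le> exp x" using exp_ge_add_one_self[of x] x by linarith
    have "g z + g' z \<le> (exp (C * x) + exp (D * x)) * h z"
      using C(2)[OF z] D(2)[OF z] by (simp add: x_def distrib_right)
    also have "exp (C * x) + exp (D * x) \<le> 2 * exp ((C + D) * x)" using le by linarith
    then have "(exp (C * x) + exp (D * x)) * h z \<le> (2 * exp ((C + D) * x)) * h z"
      using assms(3) by (rule mult_right_mono)
    also have "\<dots> \<le> (exp x * exp ((C + D) * x)) * h z"
      using two assms(3) by (intro mult_right_mono) auto
    also have "exp x * exp ((C + D) * x) = exp ((C + D + 1) * x)"
      by (simp add: algebra_simps flip: exp_add)
    finally show "g z + g' z \<le> exp ((C + D + 1) * (1 + e k z)) * h z" by (simp add: x_def)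
  qed (use C D in auto)
qed

lemma dom_const: "(\<lambda>_. c) \<preceq> (\<lambda>_. 1)"
proof (rule domI[of "\<bar>c\<bar>"])
  fix k and z :: complex assume z: "z \<in> sphere 0 (r k)"
  have "c \<le> exp \<bar>c\<bar>" using exp_ge_add_one_self[of "\<bar>c\<bar>"] by linarith
  also have "\<dots> \<le> exp (\<bar>c\<bar> * (1 + e k z))" using e_nonneg[OF z] by (simp add: distrib_left)
  finally show "c \<le> exp (\<bar>c\<bar> * (1 + e k z)) * 1" by simp
qed auto

lemma dom_cmult:
  assumes "g \<preceq> h" "c \<ge> 0" "\<And>z. 0 \<le> g z"
  shows "(\<lambda>z. c * g z) \<preceq> h"
  using dom_mult[OF dom_const[of c] assms(1)] assms(2,3) by simp

lemma dom_sum: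
  assumes "finite I" "\<And>i. i \<in> I \<Longrightarrow> g i \<preceq> h" "\<And>z. 0 \<le> h z"
  shows "(\<lambda>z. \<Sum>i\<in>I. g i z) \<preceq> h"
  using assms
proof (induction I)
  case empty
  then show ?case using dom_le[of "\<lambda>_. 0" h] by simp
next
  case (insert i I)
  then show ?case using dom_add[of "g i" h "\<lambda>z. \<Sum>i\<in>I. g i z"] by simp
qed

lemma dom_power:
  assumes "g \<preceq> h" "\<And>z. 0 \<le> g z"
  shows "(\<lambda>z. g z ^ n) \<preceq> (\<lambda>z. h z ^ n)"
proof (induction n)
  case 0
  then show ?case using dom_le[of "\<lambda>_. 1" "\<lambda>_. 1"] by simp
next
  case (Suc n)
  then show ?case using dom_mult[OF assms(1) Suc] assms(2) by simp
qed

lemma dom_prod_one: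
  assumes "finite I" "\<And>i. i \<in> I \<Longrightarrow> g i \<preceq> (\<lambda>_. 1)" "\<And>i z. 0 \<le> g i z"
  shows "(\<lambda>z. \<Prod>i\<in>I. g i z) \<preceq> (\<lambda>_. 1)"
  using assms
proof (induction I)
  case empty
  then show ?case using dom_le[of "\<lambda>_. 1" "\<lambda>_. 1"] by simp
next
  case (insert i I)
  then show ?case using dom_mult[of "g i" "\<lambda>_. 1" "\<lambda>z. \<Prod>i\<in>I. g i z" "\<lambda>_. 1"]
    by (simp add: prod_nonneg)
qed

lemma dom_cong_sphere:
  assumes "g \<preceq> h" "\<And>k z. z \<in> sphere 0 (r k) \<Longrightarrow> g' z \<le> g z" "\<And>k z. z \<in> sphere 0 (r k) \<Longrightarrow> h z \<le> h' z"
  shows "g' \<preceq> h'"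
proof -
  obtain C where C: "C \<ge> 0" "\<And>k z. z \<in> sphere 0 (r k) \<Longrightarrow> g z \<le> exp (C * (1 + e k z)) * h z"
    using assms(1) by (rule domE) blast
  show ?thesis
  proof (rule domI[OF C(1)])
    fix k and z :: complex assume z: "z \<in> sphere 0 (r k)"
    have "g' z \<le> exp (C * (1 + e k z)) * h z" using C(2)[OF z] assms(2)[OF z] by linarith
    also have "\<dots> \<le> exp (C * (1 + e k z)) * h' z" by (intro mult_left_mono assms(3)[OF z]) auto
    finally show "g' z \<le> exp (C * (1 + e k z)) * h' z" .
  qed
qed

text \<open>On the circles \<open>ln |X| <= C * (1 + e) - lmax 1 f\<close>. The mean of the right
  side is bounded below because \<open>X\<close> is not zero, so \<open>charT f\<close> would be
  \<open>o(charT f) + O(1)\<close>.\<close>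

lemma dom_contradiction:
  assumes adm: "admissible f r e" and f: "f holomorphic_on UNIV"
    and X: "X holomorphic_on UNIV" "X z1 \<noteq> 0"
    and dom: "(\<lambda>z. norm (X z) * max (norm (f z)) 1) \<preceq> (\<lambda>_. 1)"
  shows False
proof -
  obtain C where C: "C \<ge> 0" "\<And>k z. z \<in> sphere 0 (r k) \<Longrightarrow> norm (X z) * max (norm (f z)) 1 \<le> exp (C * (1 + e k z)) * 1"
    using dom by (rule domE) blast
  obtain D where D: "\<And>r v. r \<ge> 1 \<Longrightarrow> continuous_on (sphere 0 r) v \<Longrightarrow>
    (\<And>z. z \<in> sphere 0 r \<Longrightarrow> norm (X z) \<le> exp (v z)) \<Longrightarrow> - D \<le> cmean v 0 r"
    using cmean_majorant_ge[OF X] by blast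
  have rk: "r k \<ge> 1" "continuous_on (sphere 0 (r k)) (e k)" for k using adm by (auto simp: admissible_def)
  have cl: "continuous_on (sphere 0 (r k)) (lmax 1 f)" for k by (intro continuous_on_lmax_entire f) simp
  have main: "charT f (r k) \<le> C * cmean (e k) 0 (r k) + (C + D)" for k
  proof -
    have "- D \<le> cmean (\<lambda>z. C * (1 + e k z) - lmax 1 f z) 0 (r k)"
    proof (rule D[OF rk(1)])
      show "continuous_on (sphere 0 (r k)) (\<lambda>z. C * (1 + e k z) - lmax 1 f z)"
        by (intro continuous_intros rk cl)
      fix z :: complex assume z: "z \<in> sphere 0 (r k)"
      have "exp (lmax 1 f z) = max (norm (f z)) 1" by (simp add: exp_lmax)
      then show "norm (X z) \<le> exp (C * (1 + e k z) - lmax 1 f z)"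
        using C(2)[OF z] by (simp add: exp_diff pos_le_divide_eq less_max_iff_disj)
    qed
    also have "\<dots> = C * (1 + cmean (e k) 0 (r k)) - charT f (r k)"
    proof -
      have r0: "0 \<le> r k" using rk(1)[of k] by simp
      have "cmean (\<lambda>z. C * (1 + e k z) - lmax 1 f z) 0 (r k)
          = cmean (\<lambda>z. C * (1 + e k z)) 0 (r k) - charT f (r k)"
        by (intro cmean_diff continuous_intros rk cl r0)
      also have "cmean (\<lambda>z. C * (1 + e k z)) 0 (r k) = C * (1 + cmean (e k) 0 (r k))"
        by (subst cmean_cmult, subst cmean_add) (auto intro: rk r0)
      finally show ?thesis .
    qed
    finally show ?thesis by (simp add: algebra_simps)
  qed
  have top: "filterlim (\<lambda>k. charT f (r k)) at_top sequentially"
    and lim: "(\<lambda>k. cmean (e k) 0 (r k) / charT f (r k)) \<longlonglongrightarrow> 0"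
    using adm by (auto simp: admissible_def)
  have "\<forall>\<^sub>F k in sequentially. cmean (e k) 0 (r k) / charT f (r k) < 1 / (2 * (C + 1))"
    using lim by (rule order_tendstoD) (use C(1) in simp)
  moreover have "\<forall>\<^sub>F k in sequentially. charT f (r k) \<ge> max 1 (2 * (C + D) + 1)"
    using top unfolding filterlim_at_top by blast
  ultimately have "\<forall>\<^sub>F k in sequentially. False"
  proof eventually_elim
    case (elim k)
    define T where "T = charT f (r k)"
    have T: "T \<ge> 1" "T \<ge> 2 * (C + D) + 1" using elim(2) by (auto simp: T_def)
    have "cmean (e k) 0 (r k) < 1 / (2 * (C + 1)) * T"
      using elim(1) T(1) by (simp add: T_def[symmetric] pos_divide_less_eq)
    then have "C * cmean (e k) 0 (r k) \<le> C * (1 / (2 * (C + 1)) * T)"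
      using C(1) by (intro mult_left_mono) auto
    also have "\<dots> = C / (C + 1) * (T / 2)" using C(1) by (simp add: field_simps)
    also have "\<dots> \<le> 1 * (T / 2)" using C(1) T by (intro mult_right_mono) (auto simp: divide_le_eq)
    finally show False using main[of k] T by (simp add: T_def[symmetric])
  qed
  then show False by simp
qed

end

text \<open>If \<open>Q\<close> is small in the sense of \<open>dominated\<close>, so is
  \<open>1 / Q\<close>, as in the first fundamental theorem: \<open>C * (1 + e) - ln |Q|\<close> is
  nonnegative, and its mean is controlled since the mean of \<open>ln |Q|\<close> is bounded below.
  Adding it to \<open>e\<close> makes \<open>1 / |Q|\<close> a permitted factor.\<close>

lemma admissible_enlarge:
  assumes adm: "admissible f r e" and Q: "Q holomorphic_on UNIV" "Q z1 \<noteq> 0"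
    and zf: "\<And>k z. z \<in> sphere 0 (r k) \<Longrightarrow> Q z \<noteq> 0"
    and C: "C \<ge> 0" "\<And>k z. z \<in> sphere 0 (r k) \<Longrightarrow> norm (Q z) \<le> exp (C * (1 + e k z))"
  obtains e' where "admissible f r e'" "\<And>k z. z \<in> sphere 0 (r k) \<Longrightarrow> e k z \<le> e' k z"
    "\<And>k z. z \<in> sphere 0 (r k) \<Longrightarrow> 1 \<le> exp (e' k z) * norm (Q z)"
proof -
  obtain D where D: "\<And>r v. r \<ge> 1 \<Longrightarrow> continuous_on (sphere 0 r) v \<Longrightarrow>
    (\<And>z. z \<in> sphere 0 r \<Longrightarrow> norm (Q z) \<le> exp (v z)) \<Longrightarrow> - D \<le> cmean v 0 r"
    using cmean_majorant_ge[OF Q] by blast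
  have rk: "r k \<ge> 1" "continuous_on (sphere 0 (r k)) (e k)" "\<And>z. z \<in> sphere 0 (r k) \<Longrightarrow> 0 \<le> e k z" for k
    using adm by (auto simp: admissible_def)
  have cQ: "continuous_on (sphere 0 (r k)) (lognorm Q)" for k
    by (rule continuous_on_lognorm[OF Q(1)]) (use zf in \<open>auto simp: zerofree_circle_def\<close>)
  have expQ: "exp (lognorm Q z) = norm (Q z)" if "z \<in> sphere 0 (r k)" for k z
    using zf[OF that] by (simp add: lognorm_def)
  have Qle: "lognorm Q z \<le> C * (1 + e k z)" if "z \<in> sphere 0 (r k)" for k z
    using C(2)[OF that] expQ[OF that] by (metis exp_le_cancel_iff)
  define e' where "e' = (\<lambda>k z. e k z + (C * (1 + e k z) - lognorm Q z))"
  have ce': "continuous_on (sphere 0 (r k)) (e' k)" for k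
    unfolding e'_def by (intro continuous_intros rk cQ)
  have ge: "e k z \<le> e' k z" if "z \<in> sphere 0 (r k)" for k z
    using Qle[OF that] by (simp add: e'_def)
  have nn: "0 \<le> e' k z" if "z \<in> sphere 0 (r k)" for k z
    using ge[OF that] rk(3)[OF that] by simp
  have one: "1 \<le> exp (e' k z) * norm (Q z)" if z: "z \<in> sphere 0 (r k)" for k z
  proof -
    have "1 \<le> exp (e k z + C * (1 + e k z))" using rk(3)[OF z] C(1) by simp
    also have "\<dots> = exp (e' k z) * norm (Q z)"
      by (simp add: e'_def flip: expQ[OF z] exp_add)
    finally show ?thesis .
  qed
  have mean: "cmean (e' k) 0 (r k) \<le> (1 + C) * cmean (e k) 0 (r k) + (C + D)" for k
  proof -
    have r0: "0 \<le> r k" using rk(1)[of k] by simp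
    have "cmean (e' k) 0 (r k) = cmean (e k) 0 (r k) + (cmean (\<lambda>z. C * (1 + e k z)) 0 (r k) - cmean (lognorm Q) 0 (r k))"
      unfolding e'_def
      by (subst cmean_add, (intro continuous_intros rk cQ r0)+, subst cmean_diff, (intro continuous_intros rk cQ r0)+) simp
    also have "cmean (\<lambda>z. C * (1 + e k z)) 0 (r k) = C * (1 + cmean (e k) 0 (r k))"
      by (subst cmean_cmult, subst cmean_add) (auto intro: rk r0)
    finally have "cmean (e' k) 0 (r k) = cmean (e k) 0 (r k) + (C * (1 + cmean (e k) 0 (r k)) - cmean (lognorm Q) 0 (r k))" .
    moreover have "- D \<le> cmean (lognorm Q) 0 (r k)"
      by (rule D[OF rk(1) cQ]) (simp add: expQ)
    ultimately show ?thesis by (simp add: algebra_simps)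
  qed
  have top: "filterlim (\<lambda>k. charT f (r k)) at_top sequentially"
    and lim: "(\<lambda>k. cmean (e k) 0 (r k) / charT f (r k)) \<longlonglongrightarrow> 0"
    using adm by (auto simp: admissible_def)
  have ev: "\<forall>\<^sub>F k in sequentially. charT f (r k) > 0"
    using top by (rule filterlim_at_top_dense[THEN iffD1, rule_format])
  have "(\<lambda>k. cmean (e' k) 0 (r k) / charT f (r k)) \<longlonglongrightarrow> 0"
  proof (rule tendsto_sandwich[OF _ _ tendsto_const])
    have nn': "0 \<le> cmean (e' k) 0 (r k)" for k using rk(1)[of k] by (intro cmean_nonneg ce' nn) auto
    show "\<forall>\<^sub>F k in sequentially. 0 \<le> cmean (e' k) 0 (r k) / charT f (r k)"
      using ev by eventually_elim (simp add: nn' less_imp_le)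
    show "\<forall>\<^sub>F k in sequentially. cmean (e' k) 0 (r k) / charT f (r k)
        \<le> (1 + C) * (cmean (e k) 0 (r k) / charT f (r k)) + (C + D) / charT f (r k)"
      using ev
    proof eventually_elim
      case (elim k)
      then show ?case using divide_right_mono[OF mean[of k], of "charT f (r k)"]
        by (simp add: add_divide_distrib)
    qed
    have "(\<lambda>k. (C + D) / charT f (r k)) \<longlonglongrightarrow> 0"
      by (rule real_tendsto_divide_at_top[OF tendsto_const top])
    from tendsto_add[OF tendsto_mult[OF tendsto_const lim] this]
    show "(\<lambda>k. (1 + C) * (cmean (e k) 0 (r k) / charT f (r k)) + (C + D) / charT f (r k)) \<longlonglongrightarrow> 0"
      by simp
  qed
  then have "admissible f r e'" using rk(1) ce' nn top by (simp add: admissible_def)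
  then show ?thesis using that ge one by blast
qed

section \<open>Local behaviour at shared points\<close>

lemma entire_shift:
  assumes "X holomorphic_on UNIV"
  shows "(\<lambda>z. X (z + c)) holomorphic_on UNIV"
proof -
  have "(X \<circ> (\<lambda>z. z + c)) holomorphic_on UNIV"
    by (intro holomorphic_on_compose_gen[OF _ assms] holomorphic_intros) auto
  then show ?thesis by (simp add: o_def)
qed

lemma entire_tendsto: "X holomorphic_on UNIV \<Longrightarrow> X \<midarrow>z0\<rightarrow> X z0"
  by (rule isContD[OF analytic_at_imp_isCont[OF entire_imp_analytic_at]])

lemma entire_DERIV: "X holomorphic_on UNIV \<Longrightarrow> (X has_field_derivative deriv X z) (at z)"
  by (rule holomorphic_derivI[of X UNIV]) auto

lemma deriv_entire: "X holomorphic_on UNIV \<Longrightarrow> deriv X holomorphic_on UNIV"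
  by (intro holomorphic_deriv) auto

lemma deriv_diff_const: "X holomorphic_on UNIV \<Longrightarrow> deriv (\<lambda>z. X z - a) = deriv X"
  by (intro ext DERIV_imp_deriv) (auto intro!: derivative_eq_intros entire_DERIV)

text \<open>The residue of \<open>X' / X\<close>, written as a limit, which lets orders be compared
  by uniqueness of limits.\<close>

lemma zero_order_log_deriv:
  assumes "zero_order m z0 X"
  shows "(\<lambda>z. (z - z0) * deriv X z / X z) \<midarrow>z0\<rightarrow> of_nat m"
proof -
  obtain h where h: "h analytic_on {z0}" "h z0 \<noteq> 0" "\<forall>\<^sub>F z in nhds z0. X z = (z - z0) ^ m * h z"
    using assms by (auto simp: zero_order_def)
  obtain r where r: "r > 0" "h holomorphic_on ball z0 r"
    using h(1) analytic_at_ball by blast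
  have "h analytic_on {z}" if "z \<in> ball z0 r" for z
    using that r(2) analytic_at open_ball by blast
  then have an: "\<forall>\<^sub>F z in nhds z0. h analytic_on {z}"
    using r(1) by (auto simp: eventually_nhds intro!: exI[of _ "ball z0 r"])
  have "\<forall>\<^sub>F z in nhds z0. \<forall>\<^sub>F z in nhds z. X z = (z - z0) ^ m * h z"
    using h(3) by (simp add: eventually_eventually)
  then have ev1: "\<forall>\<^sub>F z in at z0. \<forall>\<^sub>F z in nhds z. X z = (z - z0) ^ m * h z"
    by (simp add: eventually_nhds_conv_at)
  have ev2: "\<forall>\<^sub>F z in at z0. h analytic_on {z}" using an by (simp add: eventually_nhds_conv_at)
  have hl: "h \<midarrow>z0\<rightarrow> h z0" by (rule isContD[OF analytic_at_imp_isCont[OF h(1)]])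
  have ev3: "\<forall>\<^sub>F z in at z0. h z \<noteq> 0"
    by (rule tendsto_imp_eventually_ne[OF hl h(2)])
  have ev4: "\<forall>\<^sub>F z in at z0. z \<noteq> z0" by (simp add: eventually_at_filter)
  have "\<forall>\<^sub>F z in at z0. of_nat m + (z - z0) * deriv h z / h z = (z - z0) * deriv X z / X z"
    using ev1 ev2 ev3 ev4
  proof eventually_elim
    case (elim z)
    have "deriv X z = deriv (\<lambda>z. (z - z0) ^ m * h z) z"
      by (rule deriv_cong_ev[OF elim(1) refl])
    also have "\<dots> = of_nat m * (z - z0) ^ (m - 1) * h z + (z - z0) ^ m * deriv h z"
      using elim(2)
      by (intro DERIV_imp_deriv) (auto intro!: derivative_eq_intros analytic_derivI simp: mult_ac)
    finally have 0: "deriv X z = of_nat m * (z - z0) ^ (m - 1) * h z + (z - z0) ^ m * deriv h z" .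
    have 1: "(z - z0) * deriv X z = (z - z0) ^ m * (of_nat m * h z + (z - z0) * deriv h z)"
    proof -
      have "d * (of_nat m * d ^ (m - 1) * x + d ^ m * y) = d ^ m * (of_nat m * x + d * y)" for d x y :: complex
        by (cases m) (simp_all add: distrib_left mult_ac)
      then show ?thesis unfolding 0 .
    qed
    have 2: "X z = (z - z0) ^ m * h z" using elim(1) by (rule eventually_nhds_x_imp_x)
    have "(z - z0) * deriv X z / X z = (of_nat m * h z + (z - z0) * deriv h z) / h z"
      unfolding 1 2 using elim(4) by simp
    then show ?case using elim(3) by (simp add: add_divide_distrib)
  qed
  moreover have "(\<lambda>z. of_nat m + (z - z0) * deriv h z / h z) \<midarrow>z0\<rightarrow> of_nat m + (z0 - z0) * deriv h z0 / h z0"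
  proof (intro tendsto_intros hl h(2))
    show "deriv h \<midarrow>z0\<rightarrow> deriv h z0"
      by (rule isContD[OF analytic_at_imp_isCont[OF analytic_deriv[OF h(1)]]])
  qed
  ultimately have "(\<lambda>z. (z - z0) * deriv X z / X z) \<midarrow>z0\<rightarrow> of_nat m + (z0 - z0) * deriv h z0 / h z0"
    by (simp only: tendsto_cong)
  then show ?thesis by simp
qed

text \<open>Near \<open>z0\<close> the quotient \<open>X' / X\<close> behaves like
  \<open>m / (z - z0)\<close> and \<open>W\<close> like \<open>W' z0 * (z - z0)\<close>, so their
  product tends to \<open>m * W' z0\<close>. With \<open>W = f - g\<close> this evaluates the
  sharing quotient at a shared point in terms of the multiplicity.\<close>

lemma zero_order_residue:
  assumes hol: "A holomorphic_on UNIV" "X holomorphic_on UNIV" "Y holomorphic_on UNIV" "W holomorphic_on UNIV"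
    and eq: "\<And>z. A z * (X z * Y z) = deriv X z * W z"
    and X: "zero_order m z0 X" "X z1 \<noteq> 0" and W: "W z0 = 0"
  shows "A z0 * Y z0 = of_nat m * deriv W z0"
proof -
  have "(\<lambda>z. ((z - z0) * deriv X z / X z) * ((W z - W z0) / (z - z0))) \<midarrow>z0\<rightarrow> of_nat m * deriv W z0"
    by (intro tendsto_mult zero_order_log_deriv X DERIV_D[OF entire_DERIV[OF hol(4)], unfolded has_field_derivative_iff])
       (use entire_DERIV[OF hol(4), of z0] in \<open>simp add: has_field_derivative_iff\<close>)
  moreover have "\<forall>\<^sub>F z in at z0. ((z - z0) * deriv X z / X z) * ((W z - W z0) / (z - z0)) = A z * Y z"
  proof -
    have ne: "\<forall>\<^sub>F z in at z0. z \<noteq> z0" by (simp add: eventually_at_filter)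
    show ?thesis
      using entire_eventually_nonzero[OF hol(2) X(2), of z0] ne
    proof eventually_elim
      case (elim z)
      then show ?case using eq[of z] W by (simp add: field_simps)
    qed
  qed
  ultimately have "(\<lambda>z. A z * Y z) \<midarrow>z0\<rightarrow> of_nat m * deriv W z0"
    by (simp cong: tendsto_cong)
  moreover have "(\<lambda>z. A z * Y z) \<midarrow>z0\<rightarrow> A z0 * Y z0"
    by (intro tendsto_mult entire_tendsto hol)
  ultimately show ?thesis using LIM_unique by blast
qed

text \<open>At a shared point where \<open>f\<close> has multiplicity \<open>m\<close>, the
  derivative \<open>f'\<close> vanishes to order \<open>m - 1\<close> and \<open>f - g\<close> to
  order at least 1, which together cover the denominator.\<close>

lemma share_quotient:
  assumes f: "f holomorphic_on UNIV" and g: "g holomorphic_on UNIV" and a: "a1 \<noteq> a2"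
    and z12: "f z1 \<noteq> a1" "f z2 \<noteq> a2"
    and share: "\<And>z. f z = a1 \<Longrightarrow> g z = a1" "\<And>z. f z = a2 \<Longrightarrow> g z = a2"
  defines "\<alpha> \<equiv> remove_sings (\<lambda>z. (deriv f z * (f z - g z)) / ((f z - a1) * (f z - a2)))"
  shows "\<alpha> holomorphic_on UNIV" "\<alpha> z * ((f z - a1) * (f z - a2)) = deriv f z * (f z - g z)"
proof -
  have hol: "(\<lambda>z. deriv f z * (f z - g z)) holomorphic_on UNIV" "(\<lambda>z. (f z - a1) * (f z - a2)) holomorphic_on UNIV"
    using deriv_entire[OF f] by (auto intro!: holomorphic_intros f g)
  have fa: "(\<lambda>z. f z - b) holomorphic_on UNIV" for b by (intro holomorphic_intros f)
  obtain z3 where z3: "(f z3 - a1) * (f z3 - a2) \<noteq> 0"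
  proof -
    have "\<not> (\<forall>z. (f z - a1) * (f z - a2) = 0)"
      using entire_mult_zero[OF fa[of a1] fa[of a2], of z1 z2] z12 by auto
    then show ?thesis using that by blast
  qed
  have loc: "\<exists>m n. vanishes_to m z0 (\<lambda>z. deriv f z * (f z - g z)) \<and>
      zero_order n z0 (\<lambda>z. (f z - a1) * (f z - a2)) \<and> n \<le> m" if z0: "(f z0 - a1) * (f z0 - a2) = 0" for z0
  proof -
    \<comment> \<open>Stated for an ordered pair \<open>b\<close>, \<open>b'\<close>, so that it
      serves both shared values.\<close>
    have *: ?thesis if "f z0 = b" "g z0 = b" "b' \<noteq> b" and nz: "f z4 \<noteq> b"
        and comm: "(\<lambda>z. (f z - a1) * (f z - a2)) = (\<lambda>z. (f z - b) * (f z - b'))" for b b' z4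
    proof -
      obtain m where m: "zero_order m z0 (\<lambda>z. f z - b)" "m > 0"
        using zero_order_exists[OF fa, of z4 b z0] nz \<open>f z0 = b\<close> by (metis right_minus_eq)
      have "zero_order 0 z0 (\<lambda>z. f z - b')"
        using that by (intro zero_order_0 entire_imp_analytic_at fa) auto
      with m(1) have "zero_order (m + 0) z0 (\<lambda>z. (f z - b) * (f z - b'))" by (rule zero_order_mult)
      moreover have "vanishes_to (m - 1) z0 (deriv f)"
        using vanishes_to_deriv[OF zero_order_imp_vanishes_to[OF m(1)]] by (simp add: deriv_diff_const[OF f])
      moreover have "vanishes_to 1 z0 (\<lambda>z. f z - g z)"
        using that by (intro vanishes_to_zero holomorphic_intros f g) auto
      ultimately show ?thesis
        unfolding comm using m(2) vanishes_to_mult[of "m - 1" z0 "deriv f" 1 "\<lambda>z. f z - g z"] by fastforce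
    qed
    show ?thesis
    proof (cases "f z0 = a1")
      case True
      then show ?thesis using *[of a1 a2 z1] share(1)[of z0] a z12 by auto
    next
      case False
      then have "f z0 = a2" using z0 by simp
      then show ?thesis using *[of a2 a1 z2] share(2)[of z0] a z12 by (auto simp: mult.commute)
    qed
  qed
  show "\<alpha> holomorphic_on UNIV"
    unfolding \<alpha>_def by (rule entire_quotient(1)[OF hol z3 loc])
  show "\<alpha> z * ((f z - a1) * (f z - a2)) = deriv f z * (f z - g z)"
    unfolding \<alpha>_def by (rule entire_quotient(2)[OF hol z3 loc, symmetric])
qed

text \<open>Under \<open>n * M = m * N\<close> the powers have equal orders everywhere, so each
  divides the other. The inverse \<open>V\<close> is produced as well, because a size argument may
  have to be applied to \<open>1 / W\<close>.\<close>

lemma unit_quotient: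
  assumes X: "X holomorphic_on UNIV" "X zx \<noteq> 0" and Y: "Y holomorphic_on UNIV" "Y zy \<noteq> 0"
    and zeros: "\<And>z. X z = 0 \<longleftrightarrow> Y z = 0" and nm: "n > 0" "m > 0"
    and ord: "\<And>z0 M N. X z0 = 0 \<Longrightarrow> zero_order M z0 X \<Longrightarrow> zero_order N z0 Y \<Longrightarrow> n * M = m * N"
  obtains W V where "W holomorphic_on UNIV" "V holomorphic_on UNIV" "\<And>z. W z * V z = 1"
    "\<And>z. X z ^ n = W z * Y z ^ m" "\<And>z. Y z ^ m = V z * X z ^ n"
proof -
  have hp: "(\<lambda>z. X z ^ n) holomorphic_on UNIV" "(\<lambda>z. Y z ^ m) holomorphic_on UNIV"
    by (intro holomorphic_intros X Y)+
  have ords: "\<exists>M. zero_order M z0 (\<lambda>z. X z ^ n) \<and> zero_order M z0 (\<lambda>z. Y z ^ m)" if z0: "X z0 = 0" for z0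
  proof -
    obtain M where M: "zero_order M z0 X" using zero_order_exists[OF X] by blast
    obtain N where N: "zero_order N z0 Y" using zero_order_exists[OF Y] by blast
    have "n * M = m * N" by (rule ord[OF z0 M N])
    then show ?thesis using zero_order_power[OF M, of n] zero_order_power[OF N, of m] by auto
  qed
  define W where "W = remove_sings (\<lambda>z. X z ^ n / Y z ^ m)"
  define V where "V = remove_sings (\<lambda>z. Y z ^ m / X z ^ n)"
  have nz: "Y zy ^ m \<noteq> 0" "X zx ^ n \<noteq> 0" using X Y by auto
  have locW: "\<exists>k l. vanishes_to k z0 (\<lambda>z. X z ^ n) \<and> zero_order l z0 (\<lambda>z. Y z ^ m) \<and> l \<le> k"
    if "Y z0 ^ m = 0" for z0
  proof -
    have "X z0 = 0" using that nm zeros[of z0] by simp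
    then show ?thesis using ords zero_order_imp_vanishes_to by blast
  qed
  have locV: "\<exists>k l. vanishes_to k z0 (\<lambda>z. Y z ^ m) \<and> zero_order l z0 (\<lambda>z. X z ^ n) \<and> l \<le> k"
    if "X z0 ^ n = 0" for z0
  proof -
    have "X z0 = 0" using that nm by simp
    then show ?thesis using ords zero_order_imp_vanishes_to by blast
  qed
  have W: "W holomorphic_on UNIV" "\<And>z. X z ^ n = W z * Y z ^ m"
    unfolding W_def by (rule entire_quotient[OF hp(1) hp(2) nz(1) locW]; assumption)+
  have V: "V holomorphic_on UNIV" "\<And>z. Y z ^ m = V z * X z ^ n"
    unfolding V_def by (rule entire_quotient[OF hp(2) hp(1) nz(2) locV]; assumption)+
  have "W z * V z = 1" for z
  proof -
    have "X z * (W z * V z - 1) = 0" for z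
    proof (cases "X z = 0")
      case False
      have "X z ^ n = W z * (V z * X z ^ n)" using W(2)[of z] V(2)[of z] by simp
      then have "(W z * V z - 1) * X z ^ n = 0" by (simp add: algebra_simps)
      then show ?thesis using False by simp
    qed simp
    moreover have "(\<lambda>z. W z * V z - 1) holomorphic_on UNIV"
      by (intro holomorphic_intros W(1) V(1))
    ultimately have "W z * V z - 1 = 0"
      using entire_mult_zero[of X "\<lambda>z. W z * V z - 1" zx z] X by blast
    then show ?thesis by simp
  qed
  then show ?thesis using that W V by blast
qed

section \<open>Functions sharing two values\<close>

text \<open>Near \<open>z0\<close> the two sides of \<open>eq\<close>, divided by the factors
  vanishing there, are logarithmic derivatives; comparing residues gives the relation of
  orders.\<close>

lemma proportional_zero_orders:
  assumes f: "f holomorphic_on UNIV" and g: "g holomorphic_on UNIV"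
    and eq: "\<And>z. of_nat n * deriv f z * ((g z - b) * (g z - b')) = of_nat m * deriv g z * ((f z - b) * (f z - b'))"
    and bb: "b \<noteq> b'" and z0: "f z0 = b" "g z0 = b"
    and M: "zero_order M z0 (\<lambda>z. f z - b)" and N: "zero_order N z0 (\<lambda>z. g z - b)"
    and nz: "f zf \<noteq> b" "g zg \<noteq> b"
  shows "n * M = m * N"
proof -
  have l1: "(\<lambda>z. (z - z0) * deriv f z / (f z - b)) \<midarrow>z0\<rightarrow> of_nat M"
    using zero_order_log_deriv[OF M] by (simp add: deriv_diff_const[OF f])
  have l2: "(\<lambda>z. (z - z0) * deriv g z / (g z - b)) \<midarrow>z0\<rightarrow> of_nat N"
    using zero_order_log_deriv[OF N] by (simp add: deriv_diff_const[OF g])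
  have L1: "(\<lambda>z. of_nat n * ((z - z0) * deriv f z / (f z - b)) * (g z - b')) \<midarrow>z0\<rightarrow> of_nat n * of_nat M * (g z0 - b')"
    by (intro tendsto_mult l1 tendsto_diff tendsto_const entire_tendsto g)
  have L2: "(\<lambda>z. of_nat m * ((z - z0) * deriv g z / (g z - b)) * (f z - b')) \<midarrow>z0\<rightarrow> of_nat m * of_nat N * (f z0 - b')"
    by (intro tendsto_mult l2 tendsto_diff tendsto_const entire_tendsto f)
  have e1: "\<forall>\<^sub>F z in at z0. f z - b \<noteq> 0"
    by (rule entire_eventually_nonzero[of _ zf]) (use nz in \<open>auto intro!: holomorphic_intros f\<close>)
  have e2: "\<forall>\<^sub>F z in at z0. g z - b \<noteq> 0"
    by (rule entire_eventually_nonzero[of _ zg]) (use nz in \<open>auto intro!: holomorphic_intros g\<close>)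
  have "\<forall>\<^sub>F z in at z0. of_nat n * ((z - z0) * deriv f z / (f z - b)) * (g z - b')
      = of_nat m * ((z - z0) * deriv g z / (g z - b)) * (f z - b')"
    using e1 e2
  proof eventually_elim
    case (elim z)
    have "(of_nat n * deriv f z * (g z - b')) * (g z - b) = (of_nat m * deriv g z * (f z - b')) * (f z - b)"
      using eq[of z] by (simp add: mult_ac)
    then have "(of_nat n * deriv f z * (g z - b')) / (f z - b) = (of_nat m * deriv g z * (f z - b')) / (g z - b)"
      using elim by (simp add: frac_eq_eq)
    then have "(z - z0) * ((of_nat n * deriv f z * (g z - b')) / (f z - b)) = (z - z0) * ((of_nat m * deriv g z * (f z - b')) / (g z - b))"
      by simp
    then show ?case by (simp add: mult_ac)
  qed
  then have "(\<lambda>z. of_nat m * ((z - z0) * deriv g z / (g z - b)) * (f z - b')) \<midarrow>z0\<rightarrow> of_nat n * of_nat M * (g z0 - b')"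
    using L1 by (simp only: tendsto_cong)
  then have "of_nat n * of_nat M * (g z0 - b') = of_nat m * of_nat N * (f z0 - b')"
    using L2 by (rule LIM_unique)
  then have "of_nat n * of_nat M = (of_nat m * of_nat N :: complex)"
    using z0 bb by simp
  then have "of_nat (n * M) = (of_nat (m * N) :: complex)" by simp
  then show ?thesis by (simp only: of_nat_eq_iff)
qed

lemma entire_deriv_zero_const:
  assumes "X holomorphic_on UNIV" "\<And>z. deriv X z = 0"
  shows "X z = X w"
proof -
  have "(X has_field_derivative 0) (at z)" for z
    using entire_DERIV[OF assms(1), of z] assms(2) by simp
  then have "X constant_on UNIV"
    unfolding constant_on_def
    using has_field_derivative_zero_constant[of UNIV X] by simp
  then obtain y where "\<And>x. X x = y" unfolding constant_on_def by blast
  then show ?thesis by simp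
qed

text \<open>By partial fractions \<open>f' / ((f - a1) (f - a2))\<close> is, up to the factor
  \<open>a1 - a2\<close>, the logarithmic derivative of \<open>(f - a1) / (f - a2)\<close>. Hence
  \<open>eq\<close> integrates to a relation between powers of these quotients, with integration
  constant \<open>\<theta>\<close>.\<close>

lemma proportional_structure:
  assumes f: "f holomorphic_on UNIV" and g: "g holomorphic_on UNIV"
    and eq: "\<And>z. of_nat n * deriv f z * ((g z - a1) * (g z - a2)) = of_nat m * deriv g z * ((f z - a1) * (f z - a2))"
    and a: "a1 \<noteq> a2" and nm: "n > 0" "m > 0"
    and share: "\<And>z. f z = a1 \<longleftrightarrow> g z = a1" "\<And>z. f z = a2 \<longleftrightarrow> g z = a2"
    and nz: "f z1 \<noteq> a1" "f z2 \<noteq> a2"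
  obtains W V \<theta> where "W holomorphic_on UNIV" "V holomorphic_on UNIV" "\<And>z. W z * V z = 1" "\<theta> \<noteq> 0"
    "\<And>z. (f z - a1) ^ n = \<theta> * W z * (g z - a1) ^ m" "\<And>z. (f z - a2) ^ n = W z * (g z - a2) ^ m"
proof -
  have hol: "(\<lambda>z. f z - b) holomorphic_on UNIV" "(\<lambda>z. g z - b) holomorphic_on UNIV" for b
    by (intro holomorphic_intros f g)+
  have nzg: "g z1 \<noteq> a1" "g z2 \<noteq> a2" using nz share by auto
  have eq': "of_nat n * deriv f z * ((g z - a2) * (g z - a1)) = of_nat m * deriv g z * ((f z - a2) * (f z - a1))" for z
    using eq[of z] by (simp only: mult.commute[of "g z - a2"] mult.commute[of "f z - a2"])
  obtain W1 V1 where 1: "W1 holomorphic_on UNIV" "V1 holomorphic_on UNIV" "\<And>z. W1 z * V1 z = 1"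
    "\<And>z. (f z - a1) ^ n = W1 z * (g z - a1) ^ m" "\<And>z. (g z - a1) ^ m = V1 z * (f z - a1) ^ n"
  proof (rule unit_quotient[OF hol(1)[of a1] _ hol(2)[of a1] _ _ nm])
    show "f z1 - a1 \<noteq> 0" "g z1 - a1 \<noteq> 0" using nz nzg by auto
    show "f z - a1 = 0 \<longleftrightarrow> g z - a1 = 0" for z using share by simp
    fix z0 M N assume "f z0 - a1 = 0" "zero_order M z0 (\<lambda>z. f z - a1)" "zero_order N z0 (\<lambda>z. g z - a1)"
    then show "n * M = m * N"
      using share(1)[of z0] by (intro proportional_zero_orders[OF f g eq a _ _ _ _ nz(1) nzg(1)]) auto
  qed blast
  obtain W2 V2 where 2: "W2 holomorphic_on UNIV" "V2 holomorphic_on UNIV" "\<And>z. W2 z * V2 z = 1"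
    "\<And>z. (f z - a2) ^ n = W2 z * (g z - a2) ^ m" "\<And>z. (g z - a2) ^ m = V2 z * (f z - a2) ^ n"
  proof (rule unit_quotient[OF hol(1)[of a2] _ hol(2)[of a2] _ _ nm])
    show "f z2 - a2 \<noteq> 0" "g z2 - a2 \<noteq> 0" using nz nzg by auto
    show "f z - a2 = 0 \<longleftrightarrow> g z - a2 = 0" for z using share by simp
    fix z0 M N assume "f z0 - a2 = 0" "zero_order M z0 (\<lambda>z. f z - a2)" "zero_order N z0 (\<lambda>z. g z - a2)"
    then show "n * M = m * N"
      using share(2)[of z0] by (intro proportional_zero_orders[OF f g eq' a[symmetric] _ _ _ _ nz(2) nzg(2)]) auto
  qed blast
  \<comment> \<open>An entire representative of
    \<open>((f - a1) / (f - a2)) ^ n / ((g - a1) / (g - a2)) ^ m\<close>, to be shown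
    constant.\<close>
  define \<Theta> where "\<Theta> = (\<lambda>z. W1 z * V2 z)"
  have hT: "\<Theta> holomorphic_on UNIV" unfolding \<Theta>_def by (intro holomorphic_intros 1 2)
  define A where "A = (\<lambda>z. (f z - a2) ^ n * (g z - a1) ^ m)"
  define B where "B = (\<lambda>z. (f z - a1) ^ n * (g z - a2) ^ m)"
  have TA: "\<Theta> z * A z = B z" for z
    by (simp add: \<Theta>_def A_def B_def 1(4) 2(5))
  have D0: "deriv \<Theta> z = 0" if z: "f z \<noteq> a1" "f z \<noteq> a2" for z
  proof -
    have zg: "g z \<noteq> a1" "g z \<noteq> a2" using z share by auto
    have pw: "((\<lambda>z. h z ^ k) has_field_derivative h z ^ k * (of_nat k * h' / h z)) (at z)"
      if "(h has_field_derivative h') (at z)" "h z \<noteq> 0" "k > 0" for h h' k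
    proof -
      have "((\<lambda>z. h z ^ k) has_field_derivative of_nat k * h z ^ (k - 1) * h') (at z)"
        using DERIV_power[OF that(1), of k] by (simp add: mult_ac)
      moreover have "of_nat k * h z ^ (k - 1) * h' = h z ^ k * (of_nat k * h' / h z)"
        using that(2,3) by (simp add: power_eq_if)
      ultimately show ?thesis by simp
    qed
    have dfa: "((\<lambda>z. f z - b) has_field_derivative deriv f z) (at z)" for b
      using DERIV_diff[OF entire_DERIV[OF f] DERIV_const[of b]] by simp
    have dga: "((\<lambda>z. g z - b) has_field_derivative deriv g z) (at z)" for b
      using DERIV_diff[OF entire_DERIV[OF g] DERIV_const[of b]] by simp
    define p1 p2 q1 q2 where "p1 = of_nat n * deriv f z / (f z - a1)" and "p2 = of_nat n * deriv f z / (f z - a2)"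
      and "q1 = of_nat m * deriv g z / (g z - a1)" and "q2 = of_nat m * deriv g z / (g z - a2)"
    have P: "((\<lambda>z. (f z - a1) ^ n) has_field_derivative (f z - a1) ^ n * p1) (at z)"
        "((\<lambda>z. (f z - a2) ^ n) has_field_derivative (f z - a2) ^ n * p2) (at z)"
        "((\<lambda>z. (g z - a1) ^ m) has_field_derivative (g z - a1) ^ m * q1) (at z)"
        "((\<lambda>z. (g z - a2) ^ m) has_field_derivative (g z - a2) ^ m * q2) (at z)"
      unfolding p1_def p2_def q1_def q2_def by (intro pw dfa dga nm; use z zg in simp)+
    have dA: "(A has_field_derivative A z * (p2 + q1)) (at z)"
      unfolding A_def using DERIV_mult[OF P(2) P(3)] by (simp add: algebra_simps)
    have dB: "(B has_field_derivative B z * (p1 + q2)) (at z)"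
      unfolding B_def using DERIV_mult[OF P(1) P(4)] by (simp add: algebra_simps)
    have pq: "p1 - p2 = q1 - q2"
    proof -
      have frac: "d / x - d / y = (y - x) * (d / (x * y))" if "x \<noteq> 0" "y \<noteq> 0" for d x y :: complex
        using that by (simp add: field_simps)
      have "p1 - p2 = (a1 - a2) * (of_nat n * deriv f z / ((f z - a1) * (f z - a2)))"
        unfolding p1_def p2_def using z by (subst frac) auto
      also have "of_nat n * deriv f z / ((f z - a1) * (f z - a2)) = of_nat m * deriv g z / ((g z - a1) * (g z - a2))"
        using eq[of z] z zg by (simp add: frac_eq_eq)
      also have "(a1 - a2) * \<dots> = q1 - q2"
        unfolding q1_def q2_def using zg by (subst frac) auto
      finally show ?thesis .
    qed
    have "((\<lambda>z. \<Theta> z * A z) has_field_derivative deriv \<Theta> z * A z + A z * (p2 + q1) * \<Theta> z) (at z)"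
      by (rule DERIV_mult[OF entire_DERIV[OF hT] dA])
    moreover have "((\<lambda>z. \<Theta> z * A z) has_field_derivative B z * (p1 + q2)) (at z)"
      using dB by (simp add: TA)
    ultimately have "deriv \<Theta> z * A z + A z * (p2 + q1) * \<Theta> z = B z * (p1 + q2)"
      by (rule DERIV_unique)
    moreover have "p1 + q2 = p2 + q1" using pq by (simp add: algebra_simps)
    moreover have "A z * (p2 + q1) * \<Theta> z = B z * (p2 + q1)" using TA[of z] by (simp add: mult_ac)
    ultimately have "deriv \<Theta> z * A z = 0" by simp
    moreover have "A z \<noteq> 0" using z zg by (simp add: A_def)
    ultimately show ?thesis by simp
  qed
  have "deriv \<Theta> z = 0" for z
  proof -
    \<comment> \<open>The computation in \<open>D0\<close> divides by values that vanish at shared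
      points; multiplying by these factors and cancelling them as entire functions removes the
      exception.\<close>
    have d1: "(f z - a1) * ((f z - a2) * deriv \<Theta> z) = 0" for z using D0[of z] by auto
    have hd: "(\<lambda>z. (f z - a2) * deriv \<Theta> z) holomorphic_on UNIV"
      by (intro holomorphic_intros f deriv_entire hT)
    have "(f z - a2) * deriv \<Theta> z = 0" for z
      by (rule entire_mult_zero[OF hol(1)[of a1] hd d1, of z1]) (use nz in simp)
    then show ?thesis
      by (rule entire_mult_zero[OF hol(1)[of a2] deriv_entire[OF hT], of z2]) (use nz in simp)
  qed
  then have const: "\<Theta> z = \<Theta> 0" for z by (rule entire_deriv_zero_const[OF hT])
  have W1: "W1 z = \<Theta> 0 * W2 z" for z
  proof -
    have "W1 z = W1 z * (W2 z * V2 z)" by (simp add: 2(3))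
    also have "\<dots> = \<Theta> z * W2 z" by (simp add: \<Theta>_def mult_ac)
    finally show ?thesis using const[of z] by simp
  qed
  have "\<Theta> 0 \<noteq> 0"
  proof
    assume "\<Theta> 0 = 0"
    then have "W1 0 = 0" using W1 by simp
    then show False using 1(3)[of 0] by simp
  qed
  then show ?thesis using that[OF 2(1,2,3), of "\<Theta> 0"] 1(4) W1 2(4) by simp
qed

lemma add_pow_le:
  fixes x y :: real
  assumes "x \<ge> 0" "y \<ge> 0"
  shows "(x + y) ^ n \<le> 2 ^ n * (x ^ n + y ^ n)"
proof -
  have "(x + y) ^ n \<le> (2 * max x y) ^ n" using assms by (intro power_mono) auto
  also have "\<dots> = 2 ^ n * max x y ^ n" by (simp add: power_mult_distrib)
  also have "max x y ^ n \<le> x ^ n + y ^ n" using assms by (auto simp: max_def)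
  finally show ?thesis by simp
qed

section \<open>Size estimates on the circles for functions sharing two values\<close>

context circles
begin

lemma dom_mult_left:
  assumes "g \<preceq> h" "\<And>z. 0 \<le> c z"
  shows "(\<lambda>z. c z * g z) \<preceq> (\<lambda>z. c z * h z)"
proof -
  obtain C where C: "C \<ge> 0" "\<And>k z. z \<in> sphere 0 (r k) \<Longrightarrow> g z \<le> exp (C * (1 + e k z)) * h z"
    using assms(1) by (rule domE) blast
  show ?thesis
  proof (rule domI[OF C(1)])
    fix k and z :: complex assume z: "z \<in> sphere 0 (r k)"
    have "c z * g z \<le> c z * (exp (C * (1 + e k z)) * h z)" by (intro mult_left_mono C(2)[OF z] assms(2))
    then show "c z * g z \<le> exp (C * (1 + e k z)) * (c z * h z)" by (simp add: mult_ac)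
  qed
qed

lemma dom_divide:
  assumes "g \<preceq> h" "\<And>k z. z \<in> sphere 0 (r k) \<Longrightarrow> 0 < h z"
  shows "(\<lambda>z. g z / h z) \<preceq> (\<lambda>_. 1)"
proof -
  obtain C where C: "C \<ge> 0" "\<And>k z. z \<in> sphere 0 (r k) \<Longrightarrow> g z \<le> exp (C * (1 + e k z)) * h z"
    using assms(1) by (rule domE) blast
  show ?thesis
    by (rule domI[OF C(1)]) (use C(2) assms(2) in \<open>simp add: pos_divide_le_eq\<close>)
qed

text \<open>Since \<open>X2 - X1 = a\<close>, partial fractions give
  \<open>D / (X1 X2) = (D / X1 - D / X2) / a\<close>. So two factors in the denominator still leave
  a small quotient, even after multiplication by \<open>1 + |X1|\<close> and even near zeros of
  \<open>X1\<close> or \<open>X2\<close>.\<close>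

lemma quotient_dom_one:
  assumes X: "\<And>z. X2 z = X1 z + a" and a: "a \<noteq> (0::complex)"
    and nz: "\<And>k z. z \<in> sphere 0 (r k) \<Longrightarrow> X1 z \<noteq> 0" "\<And>k z. z \<in> sphere 0 (r k) \<Longrightarrow> X2 z \<noteq> 0"
    and D: "(\<lambda>z. norm (D z)) \<preceq> (\<lambda>z. norm (X1 z))" "(\<lambda>z. norm (D z)) \<preceq> (\<lambda>z. norm (X2 z))"
  shows "(\<lambda>z. norm (D z) / (norm (X1 z) * norm (X2 z)) * (1 + norm (X1 z))) \<preceq> (\<lambda>_. 1)"
proof -
  have q1: "(\<lambda>z. norm (D z) / norm (X1 z)) \<preceq> (\<lambda>_. 1)" by (rule dom_divide[OF D(1)]) (use nz in simp)
  have q2: "(\<lambda>z. norm (D z) / norm (X2 z)) \<preceq> (\<lambda>_. 1)" by (rule dom_divide[OF D(2)]) (use nz in simp)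
  have s: "(\<lambda>z. (1 / norm a) * (norm (D z) / norm (X1 z) + norm (D z) / norm (X2 z)) + norm (D z) / norm (X2 z)) \<preceq> (\<lambda>_. 1)"
    by (intro dom_add dom_cmult q1 q2) auto
  show ?thesis
  proof (rule dom_cong_sphere[OF s _ order_refl])
    fix k and z :: complex assume z: "z \<in> sphere 0 (r k)"
    define d x1 x2 A where "d = norm (D z)" and "x1 = norm (X1 z)" and "x2 = norm (X2 z)" and "A = norm a"
    have pos: "d \<ge> 0" "x1 > 0" "x2 > 0" "A > 0" using nz[OF z] a by (auto simp: d_def x1_def x2_def A_def)
    have "norm (X2 z - X1 z) \<le> x2 + x1" unfolding x1_def x2_def by (rule norm_triangle_ineq4)
    then have A: "A \<le> x1 + x2" using X[of z] by (simp add: A_def)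
    have "d / (x1 * x2) * A \<le> d / (x1 * x2) * (x1 + x2)" using A pos by (intro mult_left_mono) auto
    also have "\<dots> = d / x1 + d / x2" using pos by (simp add: field_simps)
    finally have "d / (x1 * x2) \<le> 1 / A * (d / x1 + d / x2)" using pos by (simp add: field_simps)
    moreover have "d / (x1 * x2) * (1 + x1) = d / (x1 * x2) + d / x2" using pos by (simp add: field_simps)
    ultimately have "d / (x1 * x2) * (1 + x1) \<le> 1 / A * (d / x1 + d / x2) + d / x2" by simp
    then show "norm (D z) / (norm (X1 z) * norm (X2 z)) * (1 + norm (X1 z))
      \<le> 1 / norm a * (norm (D z) / norm (X1 z) + norm (D z) / norm (X2 z)) + norm (D z) / norm (X2 z)"
      by (simp add: d_def x1_def x2_def A_def)
  qed
qed

text \<open>Smallness of the sharing quotients: the factor \<open>1 + |X1|\<close> gained in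
  \<open>quotient_dom_one\<close> is just what the difference \<open>W\<close> of the two functions
  costs.\<close>

lemma sharing_quotient_dom_one:
  assumes X: "\<And>z. X2 z = X1 z + a" and a: "a \<noteq> (0::complex)"
    and nz: "\<And>k z. z \<in> sphere 0 (r k) \<Longrightarrow> X1 z \<noteq> 0" "\<And>k z. z \<in> sphere 0 (r k) \<Longrightarrow> X2 z \<noteq> 0"
    and D: "(\<lambda>z. norm (D z)) \<preceq> (\<lambda>z. norm (X1 z))" "(\<lambda>z. norm (D z)) \<preceq> (\<lambda>z. norm (X2 z))"
    and W: "(\<lambda>z. norm (W z)) \<preceq> (\<lambda>z. 1 + norm (X1 z))"
    and A: "\<And>z. A z * (X1 z * X2 z) = D z * W z"
  shows "(\<lambda>z. norm (A z)) \<preceq> (\<lambda>_. 1)"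
proof -
  have "(\<lambda>z. norm (D z) / (norm (X1 z) * norm (X2 z)) * norm (W z))
      \<preceq> (\<lambda>z. norm (D z) / (norm (X1 z) * norm (X2 z)) * (1 + norm (X1 z)))"
    by (intro dom_mult W dom_le) auto
  also have "\<dots> \<preceq> (\<lambda>_. 1)" by (rule quotient_dom_one[OF X a nz D])
  finally show ?thesis
  proof (rule dom_cong_sphere[OF _ _ order_refl])
    fix k and z :: complex assume z: "z \<in> sphere 0 (r k)"
    have "norm (A z) * (norm (X1 z) * norm (X2 z)) = norm (D z) * norm (W z)"
      using A[of z] by (metis norm_mult)
    then show "norm (A z) \<le> norm (D z) / (norm (X1 z) * norm (X2 z)) * norm (W z)"
      using nz[OF z] by (simp add: field_simps)
  qed
qed

text \<open>If \<open>f\<close> and \<open>g\<close> have the same size \<open>\<phi>\<close>, the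
  two equations force \<open>|W|\<close> to be about \<open>\<phi> ^ (n - m)\<close>. Then
  \<open>V = 1 / W\<close> for \<open>n > m\<close>, and \<open>W\<close> for \<open>n < m\<close>,
  is a nonzero entire function of size at most \<open>1 / \<phi>\<close>.\<close>

lemma comparable_power_contradiction:
  assumes adm: "admissible f r e" and f: "f holomorphic_on UNIV"
    and WV: "W holomorphic_on UNIV" "V holomorphic_on UNIV" "\<And>z. W z * V z = 1" and th: "\<theta> \<noteq> 0"
    and eq: "\<And>z. (f z - a1) ^ n = \<theta> * W z * (g z - a1) ^ m" "\<And>z. (f z - a2) ^ n = W z * (g z - a2) ^ m"
    and a: "a1 \<noteq> a2" and nm: "n \<noteq> m"
    and gf: "(\<lambda>z. 1 + norm (g z - a1)) \<preceq> (\<lambda>z. 1 + norm (f z - a1))"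
    and fg: "(\<lambda>z. 1 + norm (f z - a1)) \<preceq> (\<lambda>z. 1 + norm (g z - a1))"
  shows False
proof -
  define \<phi> \<gamma> where "\<phi> = (\<lambda>z. 1 + norm (f z - a1))" and "\<gamma> = (\<lambda>z. 1 + norm (g z - a1))"
  have pos: "\<phi> z \<ge> 1" "\<gamma> z \<ge> 1" for z by (simp_all add: \<phi>_def \<gamma>_def)
  then have pos': "\<phi> z > 0" "\<gamma> z > 0" for z by (simp_all add: \<phi>_def \<gamma>_def add_pos_nonneg)
  have pos0: "0 \<le> \<phi> z" "0 \<le> \<gamma> z" for z by (simp_all add: \<phi>_def \<gamma>_def)
  have gf': "\<gamma> \<preceq> \<phi>" and fg': "\<phi> \<preceq> \<gamma>" using gf fg by (simp_all add: \<phi>_def \<gamma>_def)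
  \<comment> \<open>Either of \<open>|x - a1|\<close>, \<open>|x - a2|\<close> may be small, but
    their sum is at least \<open>|a1 - a2|\<close>; hence \<open>1 + |x - a1|\<close> is at most
    \<open>c\<close> times the sum. This is why both equations are used together.\<close>
  define c where "c = 1 / norm (a1 - a2) + 1"
  have c: "c \<ge> 1" using a by (simp add: c_def)
  have sum_ge: "1 + norm (x - a1) \<le> c * (norm (x - a1) + norm (x - a2))" for x
  proof -
    have n: "norm (a1 - a2) > 0" using a by simp
    have "norm (a1 - a2) \<le> norm (x - a1) + norm (x - a2)"
      using norm_triangle_ineq4[of "x - a2" "x - a1"] by simp
    then have "1 \<le> 1 / norm (a1 - a2) * (norm (x - a1) + norm (x - a2))" using n by simp
    then have "1 + norm (x - a1) \<le> 1 / norm (a1 - a2) * (norm (x - a1) + norm (x - a2)) + (norm (x - a1) + norm (x - a2))"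
      by (rule add_mono) simp
    then show ?thesis by (simp only: c_def distrib_right[of _ 1] mult_1)
  qed
  have sum_ge_pow: "(1 + norm (x - a1)) ^ k \<le> (2 * c) ^ k * (norm (x - a1) ^ k + norm (x - a2) ^ k)" for x k
  proof -
    have "(1 + norm (x - a1)) ^ k \<le> (c * (norm (x - a1) + norm (x - a2))) ^ k"
      by (intro power_mono sum_ge) auto
    also have "\<dots> = c ^ k * (norm (x - a1) + norm (x - a2)) ^ k" by (simp add: power_mult_distrib)
    also have "\<dots> \<le> c ^ k * (2 ^ k * (norm (x - a1) ^ k + norm (x - a2) ^ k))"
      using c by (intro mult_left_mono add_pow_le) auto
    also have "\<dots> = (2 * c) ^ k * (norm (x - a1) ^ k + norm (x - a2) ^ k)" by (simp add: power_mult_distrib)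
    finally show ?thesis .
  qed
  define b where "b = 1 + norm (a1 - a2)"
  have x2: "norm (x - a2) \<le> b * (1 + norm (x - a1))" for x
  proof -
    have "norm (x - a2) \<le> norm (x - a1) + norm (a1 - a2)"
      using norm_triangle_ineq[of "x - a1" "a1 - a2"] by simp
    also have "\<dots> \<le> b * (1 + norm (x - a1))"
      using mult_nonneg_nonneg[of "norm (a1 - a2)" "norm (x - a1)"] by (simp add: b_def algebra_simps)
    finally show ?thesis .
  qed
  have b: "b \<ge> 1" by (simp add: b_def)
  have sum_le_pow: "norm (x - a1) ^ k + norm (x - a2) ^ k \<le> 2 * b ^ k * (1 + norm (x - a1)) ^ k" for x k
  proof -
    have "norm (x - a1) ^ k \<le> (b * (1 + norm (x - a1))) ^ k"
      using mult_mono[of 1 b "norm (x - a1)" "1 + norm (x - a1)"] b by (intro power_mono) auto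
    moreover have "norm (x - a2) ^ k \<le> (b * (1 + norm (x - a1))) ^ k" by (intro power_mono x2) auto
    ultimately show ?thesis by (simp add: power_mult_distrib)
  qed
  define T where "T = norm \<theta>"
  have T: "T > 0" using th by (simp add: T_def)
  have n1: "norm (f z - a1) ^ n = T * (norm (W z) * norm (g z - a1) ^ m)" for z
    using arg_cong[OF eq(1)[of z], of norm] by (simp add: norm_mult norm_power T_def)
  have n2: "norm (f z - a2) ^ n = norm (W z) * norm (g z - a2) ^ m" for z
    using arg_cong[OF eq(2)[of z], of norm] by (simp add: norm_mult norm_power)
  have up: "(\<lambda>z. \<phi> z ^ n) \<preceq> (\<lambda>z. norm (W z) * \<gamma> z ^ m)"
  proof -
    have pw: "\<phi> z ^ n \<le> ((2 * c) ^ n * (T + 1) * (2 * b ^ m)) * (norm (W z) * \<gamma> z ^ m)" for z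
    proof -
      have "\<phi> z ^ n \<le> (2 * c) ^ n * (norm (f z - a1) ^ n + norm (f z - a2) ^ n)"
        unfolding \<phi>_def by (rule sum_ge_pow)
      also have "norm (f z - a1) ^ n + norm (f z - a2) ^ n
          \<le> (T + 1) * (norm (W z) * (norm (g z - a1) ^ m + norm (g z - a2) ^ m))"
        unfolding n1 n2 using T by (simp add: algebra_simps)
      also have "(T + 1) * (norm (W z) * (norm (g z - a1) ^ m + norm (g z - a2) ^ m))
          \<le> (T + 1) * (norm (W z) * (2 * b ^ m * \<gamma> z ^ m))"
        unfolding \<gamma>_def using T by (intro mult_left_mono sum_le_pow) auto
      finally show ?thesis using c by (simp add: mult_ac)
    qed
    have "(\<lambda>z. \<phi> z ^ n) \<preceq> (\<lambda>z. ((2 * c) ^ n * (T + 1) * (2 * b ^ m)) * (norm (W z) * \<gamma> z ^ m))"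
      by (rule dom_le[OF pw])
    also have "\<dots> \<preceq> (\<lambda>z. norm (W z) * \<gamma> z ^ m)"
      using c b T pos0 by (intro dom_cmult dom_le) (auto intro!: mult_nonneg_nonneg zero_le_power)
    finally show ?thesis .
  qed
  have lo: "(\<lambda>z. norm (W z) * \<gamma> z ^ m) \<preceq> (\<lambda>z. \<phi> z ^ n)"
  proof -
    have pw: "norm (W z) * \<gamma> z ^ m \<le> ((2 * c) ^ m * (1 / T + 1) * (2 * b ^ n)) * \<phi> z ^ n" for z
    proof -
      have "norm (W z) * \<gamma> z ^ m \<le> norm (W z) * ((2 * c) ^ m * (norm (g z - a1) ^ m + norm (g z - a2) ^ m))"
        unfolding \<gamma>_def by (intro mult_left_mono sum_ge_pow) auto
      also have "\<dots> = (2 * c) ^ m * (1 / T * norm (f z - a1) ^ n + norm (f z - a2) ^ n)"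
        unfolding n1 n2 using T by (simp add: algebra_simps)
      also have "\<dots> \<le> (2 * c) ^ m * ((1 / T + 1) * (norm (f z - a1) ^ n + norm (f z - a2) ^ n))"
        using c T by (intro mult_left_mono) (auto simp: algebra_simps)
      also have "\<dots> \<le> (2 * c) ^ m * ((1 / T + 1) * (2 * b ^ n * \<phi> z ^ n))"
        unfolding \<phi>_def using c T by (intro mult_left_mono sum_le_pow) auto
      finally show ?thesis by (simp add: mult_ac)
    qed
    have "(\<lambda>z. norm (W z) * \<gamma> z ^ m) \<preceq> (\<lambda>z. ((2 * c) ^ m * (1 / T + 1) * (2 * b ^ n)) * \<phi> z ^ n)"
      by (rule dom_le[OF pw])
    also have "\<dots> \<preceq> (\<lambda>z. \<phi> z ^ n)"
      using c b T pos0 by (intro dom_cmult dom_le) (auto intro!: mult_nonneg_nonneg zero_le_power)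
    finally show ?thesis .
  qed
  have fle: "(\<lambda>z. max (norm (f z)) 1) \<preceq> \<phi>"
  proof -
    have pw: "max (norm (f z)) 1 \<le> (1 + norm a1) * \<phi> z" for z
    proof -
      have "norm (f z) \<le> norm (f z - a1) + norm a1" using norm_triangle_ineq[of "f z - a1" a1] by simp
      moreover have "0 \<le> norm a1 * norm (f z - a1)" by simp
      moreover have "(1 + norm a1) * \<phi> z = 1 + norm a1 + norm (f z - a1) + norm a1 * norm (f z - a1)"
        by (simp add: \<phi>_def algebra_simps)
      ultimately show ?thesis using norm_ge_zero[of a1] norm_ge_zero[of "f z - a1"] by (intro max.boundedI) linarith+
    qed
    have "(\<lambda>z. max (norm (f z)) 1) \<preceq> (\<lambda>z. (1 + norm a1) * \<phi> z)" by (rule dom_le[OF pw])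
    also have "\<dots> \<preceq> \<phi>" using pos' by (intro dom_cmult dom_le) (auto intro: less_imp_le)
    finally show ?thesis .
  qed
  have nWV: "norm (W z) * norm (V z) = 1" for z using WV(3)[of z] by (metis norm_mult norm_one)
  have Wnz: "W 0 \<noteq> 0" "V 0 \<noteq> 0" using WV(3)[of 0] by auto
  show False
  proof (cases "n > m")
    case True
    then obtain d where d: "n = m + Suc d" using less_imp_Suc_add by force
    have "(\<lambda>z. \<phi> z ^ n) \<preceq> (\<lambda>z. norm (W z) * \<gamma> z ^ m)" by (rule up)
    also have "\<dots> \<preceq> (\<lambda>z. norm (W z) * \<phi> z ^ m)"
      by (intro dom_mult_left dom_power gf' pos0) auto
    finally have "(\<lambda>z. (norm (V z) / \<phi> z ^ m) * \<phi> z ^ n) \<preceq> (\<lambda>z. (norm (V z) / \<phi> z ^ m) * (norm (W z) * \<phi> z ^ m))"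
      by (rule dom_mult_left) (use pos0 in auto)
    moreover have "(norm (V z) / \<phi> z ^ m) * (norm (W z) * \<phi> z ^ m) = 1" for z
      using pos'(1)[of z] nWV[of z] by (simp add: mult.commute)
    ultimately have 1: "(\<lambda>z. (norm (V z) / \<phi> z ^ m) * \<phi> z ^ n) \<preceq> (\<lambda>_. 1)" by simp
    have "(\<lambda>z. norm (V z) * max (norm (f z)) 1) \<preceq> (\<lambda>z. norm (V z) * \<phi> z)"
      by (intro dom_mult dom_le fle) auto
    also have "\<dots> \<preceq> (\<lambda>z. (norm (V z) / \<phi> z ^ m) * \<phi> z ^ n)"
    proof (rule dom_le)
      fix z
      have "\<phi> z * 1 \<le> \<phi> z * \<phi> z ^ d" using pos(1)[of z] by (intro mult_left_mono one_le_power) auto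
      also have "\<dots> = \<phi> z ^ n / \<phi> z ^ m" using pos'(1)[of z] by (simp add: d power_add)
      finally have "norm (V z) * \<phi> z \<le> norm (V z) * (\<phi> z ^ n / \<phi> z ^ m)" by (intro mult_left_mono) auto
      then show "norm (V z) * \<phi> z \<le> (norm (V z) / \<phi> z ^ m) * \<phi> z ^ n" by simp
    qed
    also note 1
    finally show False by (rule dom_contradiction[OF adm f WV(2) Wnz(2)])
  next
    case False
    then have "n < m" using nm by simp
    then obtain d where d: "m = n + Suc d" using less_imp_Suc_add by force
    have "(\<lambda>z. norm (W z) * \<phi> z ^ m) \<preceq> (\<lambda>z. norm (W z) * \<gamma> z ^ m)"
      by (intro dom_mult_left dom_power fg' pos0) auto
    also note lo
    finally have "(\<lambda>z. norm (W z) * \<phi> z ^ m / \<phi> z ^ n) \<preceq> (\<lambda>_. 1)"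
      by (rule dom_divide) (use pos' in simp)
    moreover have "norm (W z) * \<phi> z ^ m / \<phi> z ^ n = norm (W z) * \<phi> z ^ Suc d" for z
      using pos'(1)[of z] by (simp add: d power_add)
    ultimately have 1: "(\<lambda>z. norm (W z) * \<phi> z ^ Suc d) \<preceq> (\<lambda>_. 1)" by simp
    have "(\<lambda>z. norm (W z) * max (norm (f z)) 1) \<preceq> (\<lambda>z. norm (W z) * \<phi> z)"
      by (intro dom_mult dom_le fle) auto
    also have "\<dots> \<preceq> (\<lambda>z. norm (W z) * \<phi> z ^ Suc d)"
    proof (rule dom_le)
      fix z
      have "\<phi> z * 1 \<le> \<phi> z * \<phi> z ^ d" using pos(1)[of z] by (intro mult_left_mono one_le_power) auto
      then show "norm (W z) * \<phi> z \<le> norm (W z) * \<phi> z ^ Suc d" by (intro mult_left_mono) auto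
    qed
    also note 1
    finally show False by (rule dom_contradiction[OF adm f WV(1) Wnz(1)])
  qed
qed

text \<open>By \<open>gf\<close> and \<open>fg\<close> a single size
  \<open>\<phi> = 1 + |f - a1|\<close> measures both functions, so the estimates for
  \<open>\<alpha>\<close> and \<open>\<beta>\<close> are symmetric. It remains to exclude two
  situations: every factor of \<open>E\<close> is nonzero, or one factor is identically
  zero.\<close>

lemma comparable_contradiction:
  assumes adm: "admissible f r e" and f: "f holomorphic_on UNIV" "\<not> f constant_on UNIV" and g: "g holomorphic_on UNIV"
    and a: "a1 \<noteq> a2" and share: "\<And>z. f z = a1 \<longleftrightarrow> g z = a1" "\<And>z. f z = a2 \<longleftrightarrow> g z = a2"
    and ne: "f z0 \<noteq> g z0"
    and nz: "\<And>k z. z \<in> sphere 0 (r k) \<Longrightarrow> f z \<noteq> a1" "\<And>k z. z \<in> sphere 0 (r k) \<Longrightarrow> f z \<noteq> a2"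
    and df: "(\<lambda>z. norm (deriv f z)) \<preceq> (\<lambda>z. norm (f z - a1))" "(\<lambda>z. norm (deriv f z)) \<preceq> (\<lambda>z. norm (f z - a2))"
    and dg: "(\<lambda>z. norm (deriv g z)) \<preceq> (\<lambda>z. norm (g z - a1))" "(\<lambda>z. norm (deriv g z)) \<preceq> (\<lambda>z. norm (g z - a2))"
    and gf: "(\<lambda>z. 1 + norm (g z - a1)) \<preceq> (\<lambda>z. 1 + norm (f z - a1))"
    and fg: "(\<lambda>z. 1 + norm (f z - a1)) \<preceq> (\<lambda>z. 1 + norm (g z - a1))"
  shows False
proof -
  obtain z1 z2 where z12: "f z1 \<noteq> a1" "f z2 \<noteq> a2" using f(2) unfolding constant_on_def by blast
  have gz12: "g z1 \<noteq> a1" "g z2 \<noteq> a2" using z12 share by auto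
  have nzg: "g z \<noteq> a1" "g z \<noteq> a2" if "z \<in> sphere 0 (r k)" for z k using nz[OF that] share by auto
  have fb: "(\<lambda>z. f z - b) holomorphic_on UNIV" and gb: "(\<lambda>z. g z - b) holomorphic_on UNIV" for b
    by (intro holomorphic_intros f g)+
  define \<phi> where "\<phi> = (\<lambda>z. 1 + norm (f z - a1))"
  have \<phi>: "\<phi> z \<ge> 1" "\<phi> z > 0" for z by (simp_all add: \<phi>_def add_pos_nonneg)
  have \<phi>0: "0 \<le> \<phi> z" for z by (simp add: \<phi>_def)
  have gf': "(\<lambda>z. 1 + norm (g z - a1)) \<preceq> \<phi>" using gf by (simp add: \<phi>_def)
  have d_f1: "(\<lambda>z. norm (f z - a1)) \<preceq> \<phi>" by (rule dom_le) (simp add: \<phi>_def)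
  have d_g1: "(\<lambda>z. norm (g z - a1)) \<preceq> \<phi>" by (rule dom_trans[OF dom_le gf']) simp
  have d_one: "(\<lambda>_. 1) \<preceq> \<phi>" by (rule dom_le) (simp add: \<phi>)
  have d_c: "(\<lambda>_. c) \<preceq> \<phi>" for c by (rule dom_trans[OF dom_const d_one])
  have d_fb: "(\<lambda>z. norm (f z - b)) \<preceq> \<phi>" for b
  proof -
    have "norm (f z - b) \<le> norm (f z - a1) + norm (a1 - b)" for z
      using norm_triangle_ineq[of "f z - a1" "a1 - b"] by simp
    then have "(\<lambda>z. norm (f z - b)) \<preceq> (\<lambda>z. norm (f z - a1) + norm (a1 - b))" by (rule dom_le)
    also have "\<dots> \<preceq> \<phi>" by (intro dom_add d_f1 d_c \<phi>0)
    finally show ?thesis .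
  qed
  have d_gb: "(\<lambda>z. norm (g z - b)) \<preceq> \<phi>" for b
  proof -
    have "norm (g z - b) \<le> norm (g z - a1) + norm (a1 - b)" for z
      using norm_triangle_ineq[of "g z - a1" "a1 - b"] by simp
    then have "(\<lambda>z. norm (g z - b)) \<preceq> (\<lambda>z. norm (g z - a1) + norm (a1 - b))" by (rule dom_le)
    also have "\<dots> \<preceq> \<phi>" by (intro dom_add d_g1 d_c \<phi>0)
    finally show ?thesis .
  qed
  have d_fmax: "(\<lambda>z. max (norm (f z)) 1) \<preceq> \<phi>"
  proof -
    have "(\<lambda>z. max (norm (f z)) 1) \<preceq> (\<lambda>z. norm (f z - 0) + 1)" by (rule dom_le) auto
    also have "\<dots> \<preceq> \<phi>" by (intro dom_add d_fb d_c \<phi>0)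
    finally show ?thesis .
  qed
  have d_w: "(\<lambda>z. norm (f z - g z)) \<preceq> (\<lambda>z. 1 + norm (f z - a1))"
  proof -
    have "norm (f z - g z) \<le> norm (f z - a1) + norm (g z - a1)" for z
      using norm_triangle_ineq4[of "f z - a1" "g z - a1"] by simp
    then have "(\<lambda>z. norm (f z - g z)) \<preceq> (\<lambda>z. norm (f z - a1) + norm (g z - a1))" by (rule dom_le)
    also have "\<dots> \<preceq> \<phi>" by (intro dom_add d_f1 d_g1 \<phi>0)
    finally show ?thesis by (simp add: \<phi>_def)
  qed
  have d_w': "(\<lambda>z. norm (g z - f z)) \<preceq> (\<lambda>z. 1 + norm (g z - a1))"
    using dom_trans[OF d_w fg] by (simp add: norm_minus_commute)

  obtain \<alpha> where \<alpha>: "\<alpha> holomorphic_on UNIV" "\<And>z. \<alpha> z * ((f z - a1) * (f z - a2)) = deriv f z * (f z - g z)"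
  proof (rule that)
    have s: "\<And>z. f z = a1 \<Longrightarrow> g z = a1" "\<And>z. f z = a2 \<Longrightarrow> g z = a2" using share by simp_all
    note sq = share_quotient[OF f(1) g a z12 s]
    show "remove_sings (\<lambda>z. (deriv f z * (f z - g z)) / ((f z - a1) * (f z - a2))) holomorphic_on UNIV"
      by (rule sq(1))
    show "remove_sings (\<lambda>z. (deriv f z * (f z - g z)) / ((f z - a1) * (f z - a2))) z * ((f z - a1) * (f z - a2))
      = deriv f z * (f z - g z)" for z by (rule sq(2))
  qed
  obtain \<beta> where \<beta>: "\<beta> holomorphic_on UNIV" "\<And>z. \<beta> z * ((g z - a1) * (g z - a2)) = deriv g z * (g z - f z)"
  proof (rule that)
    have s: "\<And>z. g z = a1 \<Longrightarrow> f z = a1" "\<And>z. g z = a2 \<Longrightarrow> f z = a2" using share by simp_all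
    note sq = share_quotient[OF g f(1) a gz12 s]
    show "remove_sings (\<lambda>z. (deriv g z * (g z - f z)) / ((g z - a1) * (g z - a2))) holomorphic_on UNIV"
      by (rule sq(1))
    show "remove_sings (\<lambda>z. (deriv g z * (g z - f z)) / ((g z - a1) * (g z - a2))) z * ((g z - a1) * (g z - a2))
      = deriv g z * (g z - f z)" for z by (rule sq(2))
  qed
  have d_\<alpha>: "(\<lambda>z. norm (\<alpha> z)) \<preceq> (\<lambda>_. 1)"
    by (rule sharing_quotient_dom_one[of "\<lambda>z. f z - a2" "\<lambda>z. f z - a1" "a1 - a2" "deriv f" "\<lambda>z. f z - g z"])
       (use a nz df d_w \<alpha>(2) in auto)
  have d_\<beta>: "(\<lambda>z. norm (\<beta> z)) \<preceq> (\<lambda>_. 1)"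
    by (rule sharing_quotient_dom_one[of "\<lambda>z. g z - a2" "\<lambda>z. g z - a1" "a1 - a2" "deriv g" "\<lambda>z. g z - f z"])
       (use a nzg dg d_w' \<beta>(2) in auto)

  define L where "L = (\<lambda>(m::nat, n::nat) z. of_nat n * \<alpha> z + of_nat m * \<beta> z)"
  \<comment> \<open>Contains every pair of positive orders with sum below 5, the pairs for which the
    quotient needs help from \<open>E\<close>.\<close>
  define I where "I = {1..4::nat} \<times> {1..4::nat}"
  have hL: "L p holomorphic_on UNIV" for p
    unfolding L_def by (cases p) (auto intro!: holomorphic_intros \<alpha>(1) \<beta>(1))
  have fin: "finite I" by (simp add: I_def)
  show False
  proof (cases "\<forall>p\<in>I. \<exists>z. L p z \<noteq> 0")
    case True
    define E where "E = (\<lambda>z. \<Prod>p\<in>I. L p z)"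
    have hE: "E holomorphic_on UNIV" unfolding E_def by (intro holomorphic_intros hL)
    obtain zE where zE: "E zE \<noteq> 0"
    proof -
      have "\<exists>z. (\<Prod>p\<in>I. L p z) \<noteq> 0"
        by (rule entire_prod_nonzero[OF fin]) (use True hL in auto)
      then show ?thesis using that unfolding E_def by blast
    qed
    have d_E: "(\<lambda>z. norm (E z)) \<preceq> (\<lambda>_. 1)"
    proof -
      have "(\<lambda>z. norm (L p z)) \<preceq> (\<lambda>_. 1)" for p
      proof -
        obtain m n where p: "p = (m, n)" by (cases p)
        have "norm (L p z) \<le> real n * norm (\<alpha> z) + real m * norm (\<beta> z)" for z
          using norm_triangle_ineq[of "of_nat n * \<alpha> z" "of_nat m * \<beta> z"] by (simp add: p L_def norm_mult)
        then have "(\<lambda>z. norm (L p z)) \<preceq> (\<lambda>z. real n * norm (\<alpha> z) + real m * norm (\<beta> z))" by (rule dom_le)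
        also have "\<dots> \<preceq> (\<lambda>_. 1)" by (intro dom_add dom_cmult d_\<alpha> d_\<beta>) auto
        finally show ?thesis .
      qed
      then show ?thesis unfolding E_def prod_norm[symmetric] by (intro dom_prod_one fin) auto
    qed
    txt \<open>The quotient \<open>Num / Den\<close> is regular at a common \<open>a1\<close>- or \<open>a2\<close>-point of multiplicities \<open>M\<close> for
      \<open>f\<close> and \<open>N\<close> for \<open>g\<close>: either \<open>M, N \<le> 4\<close> and \<open>E\<close> vanishes there, or \<open>5 (M - 1) + N \<ge> 4 M\<close>.\<close>
    define Num where "Num = (\<lambda>z. (deriv f z * E z) ^ 5 * ((g z - a1) * (g z - a2)))"
    define Den where "Den = (\<lambda>z. ((f z - a1) * (f z - a2)) ^ 4)"
    have hNum: "Num holomorphic_on UNIV" and hDen: "Den holomorphic_on UNIV"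
      unfolding Num_def Den_def by (intro holomorphic_intros f(1) g deriv_entire hE)+
    have loc: "\<exists>k l. vanishes_to k z3 Num \<and> zero_order l z3 Den \<and> l \<le> k" if z3: "Den z3 = 0" for z3
    proof -
      have *: ?thesis if b: "f z3 = b" "g z3 = b" "b' \<noteq> b" and nzb: "f z4 \<noteq> b" "g z4 \<noteq> b"
        and \<alpha>eq: "\<And>z. \<alpha> z * ((f z - b) * (f z - b')) = deriv f z * (f z - g z)"
        and \<beta>eq: "\<And>z. \<beta> z * ((g z - b) * (g z - b')) = deriv g z * (g z - f z)"
        and Num: "Num = (\<lambda>z. (deriv f z * E z) ^ 5 * ((g z - b) * (g z - b')))"
        and Den: "Den = (\<lambda>z. ((f z - b) * (f z - b')) ^ 4)" for b b' z4
      proof -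
        obtain M where M: "zero_order M z3 (\<lambda>z. f z - b)" "M > 0"
          using zero_order_exists[OF fb, of z4 b z3] nzb b by (metis right_minus_eq)
        obtain N where N: "zero_order N z3 (\<lambda>z. g z - b)" "N > 0"
          using zero_order_exists[OF gb, of z4 b z3] nzb b by (metis right_minus_eq)
        have "zero_order 0 z3 (\<lambda>z. f z - b')"
          using b by (intro zero_order_0 entire_imp_analytic_at fb) auto
        from zero_order_power[OF zero_order_mult[OF M(1) this], of 4]
        have oD: "zero_order (4 * M) z3 Den" by (simp add: Den)
        have vf: "vanishes_to (M - 1) z3 (deriv f)"
          using vanishes_to_deriv[OF zero_order_imp_vanishes_to[OF M(1)]] by (simp add: deriv_diff_const[OF f(1)])
        have vg: "vanishes_to (N + 0) z3 (\<lambda>z. (g z - b) * (g z - b'))"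
          by (intro vanishes_to_mult zero_order_imp_vanishes_to[OF N(1)] vanishes_to_0 entire_imp_analytic_at gb)
        have vN: "vanishes_to (5 * ((M - 1) + j) + (N + 0)) z3 Num" if "vanishes_to j z3 E" for j
          unfolding Num by (intro vanishes_to_mult vanishes_to_power vf vg that)
        have "\<exists>j. vanishes_to j z3 E \<and> 4 * M \<le> 5 * ((M - 1) + j) + (N + 0)"
        proof (cases "M \<le> 4 \<and> N \<le> 4")
          case True
          define w' where "w' = deriv (\<lambda>z. f z - g z) z3"
          have hw: "(\<lambda>z. f z - g z) holomorphic_on UNIV" "(\<lambda>z. g z - f z) holomorphic_on UNIV"
            by (intro holomorphic_intros f(1) g)+
          have w2: "deriv (\<lambda>z. g z - f z) z3 = - w'"
          proof -
            have "((\<lambda>z. - (f z - g z)) has_field_derivative - w') (at z3)"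
              unfolding w'_def by (intro DERIV_minus entire_DERIV hw)
            then have "((\<lambda>z. g z - f z) has_field_derivative - w') (at z3)" by simp
            then show ?thesis by (rule DERIV_imp_deriv)
          qed
          \<comment> \<open>At the shared point \<open>\<alpha>\<close> and \<open>\<beta>\<close>
            are \<open>M\<close> and \<open>N\<close> times the same derivative with opposite signs,
            up to the common factor \<open>b - b'\<close>; the weights \<open>N\<close> and
            \<open>M\<close> in \<open>L\<close> make them cancel.\<close>
          have 1: "\<alpha> z3 * (f z3 - b') = of_nat M * w'"
            unfolding w'_def
            by (rule zero_order_residue[OF \<alpha>(1) fb[of b] fb[of b'] hw(1) _ M(1), of z4])
               (use \<alpha>eq nzb b in \<open>auto simp: deriv_diff_const[OF f(1)]\<close>)
          have 2: "\<beta> z3 * (g z3 - b') = of_nat N * - w'"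
            unfolding w2[symmetric]
            by (rule zero_order_residue[OF \<beta>(1) gb[of b] gb[of b'] hw(2) _ N(1), of z4])
               (use \<beta>eq nzb b in \<open>auto simp: deriv_diff_const[OF g]\<close>)
          have "L (M, N) z3 * (b - b') = of_nat N * (\<alpha> z3 * (f z3 - b')) + of_nat M * (\<beta> z3 * (g z3 - b'))"
            using b by (simp add: L_def algebra_simps)
          also have "\<dots> = 0" unfolding 1 2 by simp
          finally have "L (M, N) z3 = 0" using b by simp
          moreover have "(M, N) \<in> I" using True M(2) N(2) by (auto simp: I_def)
          ultimately have "E z3 = 0" unfolding E_def using fin by (meson prod_zero)
          then have "vanishes_to 1 z3 E" by (rule vanishes_to_zero[OF hE])
          moreover have "4 * M \<le> 5 * ((M - 1) + 1) + (N + 0)" using M(2) by simp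
          ultimately show ?thesis by blast
        next
          case False
          then have "5 \<le> M + N" using M(2) N(2) by linarith
          then have "4 * M \<le> 5 * ((M - 1) + 0) + (N + 0)" using M(2) by arith
          then show ?thesis using vanishes_to_0[OF entire_imp_analytic_at[OF hE]] by blast
        qed
        then show ?thesis using vN oD by blast
      qed
      show ?thesis
      proof (cases "f z3 = a1")
        case True
        show ?thesis
          by (rule *[of a1 a2 z1]) (use True share(1)[of z3] a z12 gz12 \<alpha>(2) \<beta>(2) in \<open>auto simp: Num_def Den_def\<close>)
      next
        case False
        then have "f z3 = a2" using z3 by (simp add: Den_def)
        then show ?thesis
          by (intro *[of a2 a1 z2])
             (use share(2)[of z3] a z12 gz12 \<alpha>(2) \<beta>(2) in \<open>auto simp: Num_def Den_def mult.commute\<close>)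
      qed
    qed
    define F where "F = remove_sings (\<lambda>z. Num z / Den z)"
    have ev: "\<forall>\<^sub>F z in at 0. deriv f z \<noteq> 0 \<and> E z \<noteq> 0 \<and> g z - a1 \<noteq> 0 \<and> g z - a2 \<noteq> 0 \<and> f z - a1 \<noteq> 0 \<and> f z - a2 \<noteq> 0"
    proof -
      obtain z5 where z5: "deriv f z5 \<noteq> 0"
      proof -
        have "\<not> (\<forall>z. deriv f z = 0)"
        proof
          assume "\<forall>z. deriv f z = 0"
          then have "f z = f 0" for z by (intro entire_deriv_zero_const[OF f(1)]) simp
          then show False using f(2) unfolding constant_on_def by blast
        qed
        then show ?thesis using that by blast
      qed
      show ?thesis
        by (intro eventually_conj entire_eventually_nonzero[OF deriv_entire[OF f(1)] z5] entire_eventually_nonzero[OF hE zE]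
            entire_eventually_nonzero[OF gb, of z1] entire_eventually_nonzero[OF gb, of z2]
            entire_eventually_nonzero[OF fb, of z1] entire_eventually_nonzero[OF fb, of z2])
           (use z12 gz12 in auto)
    qed
    then obtain z6 where z6: "deriv f z6 \<noteq> 0" "E z6 \<noteq> 0" "g z6 - a1 \<noteq> 0" "g z6 - a2 \<noteq> 0" "f z6 - a1 \<noteq> 0" "f z6 - a2 \<noteq> 0"
      using eventually_happens'[OF at_neq_bot ev] by blast
    have Den6: "Den z6 \<noteq> 0" and Num6: "Num z6 \<noteq> 0" using z6 by (simp_all add: Num_def Den_def)
    have hF: "F holomorphic_on UNIV" unfolding F_def by (rule entire_quotient(1)[OF hNum hDen Den6 loc])
    have eqF: "Num z = F z * Den z" for z unfolding F_def by (rule entire_quotient(2)[OF hNum hDen Den6 loc])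
    have F6: "F z6 \<noteq> 0" using eqF[of z6] Num6 by auto
    \<comment> \<open>\<open>Den\<close> has no lower bound by a power of \<open>\<phi>\<close> near
      points where \<open>f\<close> is close to \<open>a1\<close> or \<open>a2\<close>. Keeping its
      factors inside \<open>\<kappa>\<close> gives an estimate valid there too.\<close>
    define \<kappa> where "\<kappa> = (\<lambda>z. norm (deriv f z) / (norm (f z - a1) * norm (f z - a2)) * (1 + norm (f z - a1)))"
    have d_\<kappa>: "\<kappa> \<preceq> (\<lambda>_. 1)"
      unfolding \<kappa>_def by (rule quotient_dom_one[where a = "a1 - a2"]) (use a nz df in auto)
    have \<kappa>0: "0 \<le> \<kappa> z" for z by (simp add: \<kappa>_def)
    have d_q: "(\<lambda>z. norm (f z - b) / \<phi> z) \<preceq> (\<lambda>_. 1)" "(\<lambda>z. norm (g z - b) / \<phi> z) \<preceq> (\<lambda>_. 1)" for b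
      by (intro dom_divide d_fb d_gb \<phi>)+
    have one_mult: "(\<lambda>z. u z * v z) \<preceq> (\<lambda>_. 1)" if "u \<preceq> (\<lambda>_. 1)" "v \<preceq> (\<lambda>_. 1)" "\<And>z. 0 \<le> u z" "\<And>z. 0 \<le> v z" for u v
      using dom_mult[OF that] by simp
    have one_pow: "(\<lambda>z. u z ^ n) \<preceq> (\<lambda>_. 1)" if "u \<preceq> (\<lambda>_. 1)" "\<And>z. 0 \<le> u z" for u and n :: nat
      using dom_power[OF that, of n] by simp
    \<comment> \<open>The fifth power of \<open>\<kappa>\<close> uses \<open>f - a1\<close> and
      \<open>f - a2\<close> five times each, once more than \<open>Den\<close> does; the surplus is
      paired with \<open>\<phi>\<close>, as are the two factors with \<open>g\<close>. The powers of
      \<open>\<phi>\<close> leave \<open>5 - 4 = 1\<close>, so this bounds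
      \<open>|F| * \<phi>\<close>.\<close>
    define Pr where "Pr = (\<lambda>z. \<kappa> z ^ 5 * (norm (E z) ^ 5 * ((norm (g z - a1) / \<phi> z * (norm (g z - a2) / \<phi> z))
        * (norm (f z - a1) / \<phi> z * (norm (f z - a2) / \<phi> z)))))"
    have d_Pr: "Pr \<preceq> (\<lambda>_. 1)"
      unfolding Pr_def
      by (intro one_mult one_pow d_\<kappa> d_E d_q) (auto intro!: mult_nonneg_nonneg divide_nonneg_nonneg \<phi>0 \<kappa>0)
    have "(\<lambda>z. norm (F z) * \<phi> z) \<preceq> (\<lambda>_. 1)"
    proof (rule dom_cong_sphere[OF d_Pr _ order_refl])
      fix k and z :: complex assume z: "z \<in> sphere 0 (r k)"
      define d E' x1 x2 y1 y2 p where "d = norm (deriv f z)" and "E' = norm (E z)" and "x1 = norm (f z - a1)"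
        and "x2 = norm (f z - a2)" and "y1 = norm (g z - a1)" and "y2 = norm (g z - a2)" and "p = \<phi> z"
      have pos: "x1 > 0" "x2 > 0" "p > 0" using nz[OF z] \<phi> by (auto simp: x1_def x2_def p_def)
      have "(d * E') ^ 5 * (y1 * y2) = norm (F z) * (x1 * x2) ^ 4"
        using arg_cong[OF eqF[of z], of norm]
        by (simp add: Num_def Den_def norm_mult norm_power d_def E'_def x1_def x2_def y1_def y2_def)
      then have "norm (F z) = (d * E') ^ 5 * (y1 * y2) / (x1 * x2) ^ 4" using pos by simp
      also have "\<dots> * p = (d / (x1 * x2) * p) ^ 5 * (E' ^ 5 * ((y1 / p * (y2 / p)) * (x1 / p * (x2 / p))))"
      proof -
        define q where "q = x1 * x2"
        have q: "q > 0" using pos by (simp add: q_def)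
        have 1: "(y1 / p * (y2 / p)) * (x1 / p * (x2 / p)) = y1 * y2 * q / p ^ 4"
          by (simp add: q_def eval_nat_numeral)
        have 2: "(d / q * p) ^ 5 = d ^ 5 * (p * p ^ 4) / (q * q ^ 4)"
          by (simp add: power_mult_distrib power_divide eval_nat_numeral)
        have 3: "d5 * (p * p4) / (q * q4) * (e5 * (y * q / p4)) = d5 * e5 * y / q4 * p"
          if "p4 > 0" "q4 > 0" for d5 p4 q4 e5 y :: real
          using that q by (simp add: field_simps)
        show ?thesis
          unfolding q_def[symmetric] 1 2 power_mult_distrib[of d E']
          by (rule 3[symmetric]) (use pos q in auto)
      qed
      finally show "norm (F z) * \<phi> z \<le> Pr z"
        by (simp add: Pr_def \<kappa>_def \<phi>_def d_def E'_def x1_def x2_def y1_def y2_def p_def)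
    qed
    then have "(\<lambda>z. norm (F z) * max (norm (f z)) 1) \<preceq> (\<lambda>_. 1)"
      using dom_trans[OF dom_mult_left[OF d_fmax, of "\<lambda>z. norm (F z)"]] by simp
    then show False by (rule dom_contradiction[OF adm f(1) hF F6])
  next
    case False
    then obtain m n where mn: "(m, n) \<in> I" "\<And>z. L (m, n) z = 0" by fastforce
    have pos: "n > 0" "m > 0" using mn(1) by (auto simp: I_def)
    have eq: "of_nat n * deriv f z * ((g z - a1) * (g z - a2)) = of_nat m * deriv g z * ((f z - a1) * (f z - a2))" for z
    proof -
      define X where "X = (\<lambda>z. of_nat n * deriv f z * ((g z - a1) * (g z - a2)) - of_nat m * deriv g z * ((f z - a1) * (f z - a2)))"
      have hX: "X holomorphic_on UNIV" unfolding X_def by (intro holomorphic_intros f(1) g deriv_entire)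
      \<comment> \<open>The factor \<open>f - g\<close> turns the two terms of \<open>X\<close> into
        \<open>\<alpha>\<close> and \<open>\<beta>\<close>; it is cancelled afterwards because
        \<open>f\<close> and \<open>g\<close> differ at \<open>z0\<close>.\<close>
      have "(f z - g z) * X z = 0" for z
      proof -
        have "(f z - g z) * X z = of_nat n * (deriv f z * (f z - g z)) * ((g z - a1) * (g z - a2))
            + of_nat m * (deriv g z * (g z - f z)) * ((f z - a1) * (f z - a2))"
          by (simp add: X_def algebra_simps)
        also have "\<dots> = L (m, n) z * (((f z - a1) * (f z - a2)) * ((g z - a1) * (g z - a2)))"
          unfolding \<alpha>(2)[symmetric] \<beta>(2)[symmetric] by (simp only: L_def split distrib_right distrib_left mult_ac)
        finally show ?thesis using mn(2) by simp
      qed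
      then have "X z = 0"
        by (intro entire_mult_zero[of "\<lambda>z. f z - g z" X z0]) (use ne hX in \<open>auto intro!: holomorphic_intros f(1) g\<close>)
      then show ?thesis by (simp add: X_def)
    qed
    show False
    proof (cases "n = m")
      case False
      obtain W V \<theta> where "W holomorphic_on UNIV" "V holomorphic_on UNIV" "\<And>z. W z * V z = 1" "\<theta> \<noteq> 0"
        "\<And>z. (f z - a1) ^ n = \<theta> * W z * (g z - a1) ^ m" "\<And>z. (f z - a2) ^ n = W z * (g z - a2) ^ m"
        by (rule proportional_structure[OF f(1) g eq a pos share z12]) blast
      then show False by (rule comparable_power_contradiction[OF adm f(1) _ _ _ _ _ _ a False gf fg])
    next
      case True
      \<comment> \<open>Equal weights cancel, so the relation can be integrated with exponents 1
        instead of \<open>n\<close>.\<close>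
      have eq1: "of_nat 1 * deriv f z * ((g z - a1) * (g z - a2)) = of_nat 1 * deriv g z * ((f z - a1) * (f z - a2))" for z
        using eq[of z] pos True by (simp add: mult.assoc)
      obtain W V \<theta> where WV: "W holomorphic_on UNIV" "V holomorphic_on UNIV" "\<And>z. W z * V z = 1" "\<theta> \<noteq> 0"
        "\<And>z. (f z - a1) ^ 1 = \<theta> * W z * (g z - a1) ^ 1" "\<And>z. (f z - a2) ^ 1 = W z * (g z - a2) ^ 1"
        by (rule proportional_structure[OF f(1) g eq1 a zero_less_one zero_less_one share z12]) blast
      define A where "A = a1 - a2"
      have A: "A \<noteq> 0" using a by (simp add: A_def)
      \<comment> \<open>Here \<open>g\<close> is a Moebius transform of \<open>f\<close>. In this
        form one sees that for \<open>\<theta> \<noteq> 1\<close> the two functions cannot be large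
        at the same point.\<close>
      have cross: "(\<theta> - 1) * ((f z - a1) * (g z - a1)) = A * (f z - a1) - \<theta> * A * (g z - a1)" for z
      proof -
        have "(f z - a1) * (g z - a2) = \<theta> * ((f z - a2) * (g z - a1))"
          using WV(5)[of z] WV(6)[of z] by (simp add: mult_ac)
        moreover have "f z - a2 = (f z - a1) + A" "g z - a2 = (g z - a1) + A" by (simp_all add: A_def)
        ultimately show ?thesis by (simp add: algebra_simps)
      qed
      show False
      proof (cases "\<theta> = 1")
        case True
        then have "A * (f z0 - a1) = A * (g z0 - a1)" using cross[of z0] by simp
        then show False using A ne by simp
      next
        case False
        define C where "C = norm A * (1 + norm \<theta>) / norm (\<theta> - 1)"
        have nA: "norm A > 0" "norm (\<theta> - 1) > 0" using A False by auto
        have C: "C > 0" unfolding C_def using nA by (intro divide_pos_pos mult_pos_pos add_pos_nonneg) auto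
        have xy: "norm (f z - a1) * norm (g z - a1) \<le> C * (norm (f z - a1) + norm (g z - a1))" for z
        proof -
          define x y where "x = norm (f z - a1)" and "y = norm (g z - a1)"
          have xy0: "x \<ge> 0" "y \<ge> 0" by (simp_all add: x_def y_def)
          have "norm (\<theta> - 1) * (x * y) = norm (A * (f z - a1) - \<theta> * A * (g z - a1))"
            by (simp flip: cross add: norm_mult x_def y_def)
          also have "\<dots> \<le> norm (A * (f z - a1)) + norm (\<theta> * A * (g z - a1))" by (rule norm_triangle_ineq4)
          also have "\<dots> = norm A * x + norm \<theta> * norm A * y" by (simp add: norm_mult x_def y_def)
          also have "\<dots> \<le> norm A * (1 + norm \<theta>) * (x + y)"
            using mult_nonneg_nonneg[of "norm A * norm \<theta>" x] mult_nonneg_nonneg[of "norm A" y] xy0 by (simp add: algebra_simps)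
          finally have "x * y \<le> norm A * (1 + norm \<theta>) * (x + y) / norm (\<theta> - 1)"
            using nA by (simp add: pos_le_divide_eq mult.commute)
          then show ?thesis by (simp add: C_def x_def y_def)
        qed
        obtain D where D: "D \<ge> 0" "\<And>k z. z \<in> sphere 0 (r k) \<Longrightarrow> 1 + norm (f z - a1) \<le> exp (D * (1 + e k z)) * (1 + norm (g z - a1))"
          using fg by (rule domE) blast
        have "\<phi> \<preceq> (\<lambda>_. 1 + 2 * C)"
        proof (rule domI[OF D(1)])
          fix k and z :: complex assume z: "z \<in> sphere 0 (r k)"
          define x y where "x = norm (f z - a1)" and "y = norm (g z - a1)"
          have ex: "exp (D * (1 + e k z)) \<ge> 1" using D(1) e_nonneg[OF z] by simp
          \<comment> \<open>From \<open>x * y <= C * (x + y)\<close>, one of \<open>x\<close>,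
            \<open>y\<close> is at most \<open>2 * C\<close>; if it is \<open>y\<close>, the
            comparison \<open>fg\<close> carries the bound over to \<open>x\<close>.\<close>
          show "\<phi> z \<le> exp (D * (1 + e k z)) * (1 + 2 * C)"
          proof (cases "y \<le> 2 * C")
            case True
            have "\<phi> z \<le> exp (D * (1 + e k z)) * (1 + y)" using D(2)[OF z] by (simp add: \<phi>_def y_def)
            also have "\<dots> \<le> exp (D * (1 + e k z)) * (1 + 2 * C)" using True by (intro mult_left_mono) auto
            finally show ?thesis .
          next
            case False
            have "x * y \<le> C * x + C * y" using xy[of z] by (simp add: x_def y_def distrib_left)
            moreover have "2 * C * x \<le> y * x" using False by (intro mult_right_mono) (auto simp: x_def)
            ultimately have "x * y \<le> 2 * C * y" by (simp add: mult_ac)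
            moreover have "y > 0" using False C by simp
            ultimately have "x \<le> 2 * C" by simp
            then have "\<phi> z \<le> 1 * (1 + 2 * C)" by (simp add: \<phi>_def x_def)
            also have "\<dots> \<le> exp (D * (1 + e k z)) * (1 + 2 * C)" using ex C by (intro mult_right_mono) auto
            finally show ?thesis .
          qed
        qed
        also have "\<dots> \<preceq> (\<lambda>_. 1)" by (rule dom_const)
        finally have "\<phi> \<preceq> (\<lambda>_. 1)" .
        then have "(\<lambda>z. norm (1::complex) * max (norm (f z)) 1) \<preceq> (\<lambda>_. 1)"
          using dom_trans[OF d_fmax] by simp
        then show False
          by (rule dom_contradiction[OF adm f(1), of "\<lambda>_. 1" 0, rotated 2]) auto
      qed
    qed
  qed
qed

end

section \<open>The functions \<open>\<psi>\<close> and the associated differential equation\<close>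

text \<open>If \<open>y' = h y + R\<close>, then the \<open>i\<close>-th derivative of \<open>y\<close> is
  \<open>exp_deriv_factor h i * y + exp_deriv_rest h R i\<close>; the factor for \<open>h = \<psi> 1\<close> is \<open>\<psi> i\<close>.\<close>

primrec exp_deriv_factor :: "(complex \<Rightarrow> complex) \<Rightarrow> nat \<Rightarrow> complex \<Rightarrow> complex" where
  "exp_deriv_factor h 0 = (\<lambda>_. 1)"
| "exp_deriv_factor h (Suc i) = (\<lambda>z. deriv (exp_deriv_factor h i) z + h z * exp_deriv_factor h i z)"

primrec exp_deriv_rest :: "(complex \<Rightarrow> complex) \<Rightarrow> (complex \<Rightarrow> complex) \<Rightarrow> nat \<Rightarrow> complex \<Rightarrow> complex" where
  "exp_deriv_rest h R 0 = (\<lambda>_. 0)"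
| "exp_deriv_rest h R (Suc i) = (\<lambda>z. deriv (exp_deriv_rest h R i) z + exp_deriv_factor h i z * R z)"

lemma exp_deriv_factor_entire:
  "h holomorphic_on UNIV \<Longrightarrow> exp_deriv_factor h i holomorphic_on UNIV"
  by (induction i) (auto intro!: holomorphic_intros deriv_entire)

lemma exp_deriv_rest_entire:
  "h holomorphic_on UNIV \<Longrightarrow> R holomorphic_on UNIV \<Longrightarrow> exp_deriv_rest h R i holomorphic_on UNIV"
  by (induction i) (auto intro!: holomorphic_intros deriv_entire exp_deriv_factor_entire)

lemma higher_deriv_decomposition:
  assumes h: "h holomorphic_on UNIV" and R: "R holomorphic_on UNIV" and X: "X holomorphic_on UNIV"
    and eq: "\<And>z. deriv X z = h z * X z + R z"
  shows "(deriv ^^ i) X = (\<lambda>z. exp_deriv_factor h i z * X z + exp_deriv_rest h R i z)"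
proof (induction i)
  case (Suc i)
  show ?case
  proof
    fix z
    have "((\<lambda>z. exp_deriv_factor h i z * X z + exp_deriv_rest h R i z) has_field_derivative
        (deriv (exp_deriv_factor h i) z * X z + deriv X z * exp_deriv_factor h i z) + deriv (exp_deriv_rest h R i) z) (at z)"
      by (intro DERIV_add DERIV_mult entire_DERIV exp_deriv_factor_entire exp_deriv_rest_entire h R X)
    then have "deriv ((deriv ^^ i) X) z = (deriv (exp_deriv_factor h i) z * X z + deriv X z * exp_deriv_factor h i z)
        + deriv (exp_deriv_rest h R i) z"
      unfolding Suc by (rule DERIV_imp_deriv)
    then show "(deriv ^^ Suc i) X z = exp_deriv_factor h (Suc i) z * X z + exp_deriv_rest h R (Suc i) z"
      by (simp add: eq algebra_simps)
  qed
qed simp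

lemma exp_deriv_rest_zero: "exp_deriv_rest h (\<lambda>_. 0) i = (\<lambda>_. 0)"
  by (induction i) auto

lemma deriv_shift:
  assumes "X holomorphic_on UNIV"
  shows "deriv (\<lambda>z. X (z + c)) z = deriv X (z + c)"
  using entire_DERIV[OF assms, of "z + c"] by (intro DERIV_imp_deriv) (simp add: DERIV_shift)

lemma exp_deriv_factor_shift:
  assumes "h holomorphic_on UNIV"
  shows "exp_deriv_factor (\<lambda>z. h (z + c)) i = (\<lambda>z. exp_deriv_factor h i (z + c))"
  by (induction i) (auto simp: deriv_shift[OF exp_deriv_factor_entire[OF assms]])

lemma higher_deriv_entire: "X holomorphic_on UNIV \<Longrightarrow> (deriv ^^ i) X holomorphic_on UNIV"
  by (intro holomorphic_higher_deriv) auto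

text \<open>Differentiating the equation gives a linear recurrence with constant coefficients for
  the derivatives at 0, so they grow at most geometrically and the Taylor series is dominated by
  that of an exponential.\<close>

lemma linear_ode_growth:
  assumes y: "y holomorphic_on UNIV" and b: "\<exists>i\<le>k. b i \<noteq> (0::complex)"
    and ode: "\<And>z. (\<Sum>i\<le>k. b i * (deriv ^^ i) y z) = 0"
  obtains M \<Lambda> where "M \<ge> 0" "\<Lambda> \<ge> 0" "\<And>z. norm (y z) \<le> M * exp (\<Lambda> * norm z)"
proof -
  define q where "q = Max {i. i \<le> k \<and> b i \<noteq> 0}"
  have "q \<in> {i. i \<le> k \<and> b i \<noteq> 0}" unfolding q_def by (rule Max_in) (use b in auto)
  then have q: "q \<le> k" "b q \<noteq> 0" by auto
  have q_top: "b i = 0" if "i \<le> k" "i > q" for i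
  proof (rule ccontr)
    assume "b i \<noteq> 0"
    then have "i \<le> q" unfolding q_def using that by (intro Max_ge) auto
    then show False using that by simp
  qed
  have sum_q: "(\<Sum>i\<le>k. b i * t i) = (\<Sum>i<q. b i * t i) + b q * t q" for t :: "nat \<Rightarrow> complex"
  proof -
    have "(\<Sum>i\<le>k. b i * t i) = (\<Sum>i\<le>q. b i * t i)"
      by (rule sum.mono_neutral_right) (use q q_top in auto)
    then show ?thesis by (simp add: lessThan_Suc_atMost[symmetric])
  qed
  have dode: "(\<Sum>i\<le>k. b i * (deriv ^^ (n + i)) y z) = 0" for n z
  proof (induction n arbitrary: z)
    case (Suc n)
    have "((\<lambda>z. \<Sum>i\<le>k. b i * (deriv ^^ (n + i)) y z) has_field_derivative
        (\<Sum>i\<le>k. b i * deriv ((deriv ^^ (n + i)) y) z)) (at z)"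
      by (intro DERIV_sum DERIV_cmult entire_DERIV higher_deriv_entire y)
    moreover have "((\<lambda>z. \<Sum>i\<le>k. b i * (deriv ^^ (n + i)) y z) has_field_derivative 0) (at z)"
      by (simp add: Suc)
    ultimately have "(\<Sum>i\<le>k. b i * deriv ((deriv ^^ (n + i)) y) z) = 0" by (rule DERIV_unique)
    then show ?case by simp
  qed (use ode in simp)
  define Y where "Y = (\<lambda>n. norm ((deriv ^^ n) y 0))"
  define B where "B = (\<Sum>i<q. norm (b i / b q))"
  \<comment> \<open>At least \<open>B\<close>, for the recurrence, and at least 1, so that lower
    powers are bounded by the highest one; \<open>M\<close> covers the initial values.\<close>
  define \<Lambda> where "\<Lambda> = 1 + B"
  define M where "M = (\<Sum>i\<le>q. Y i)"
  have B: "B \<ge> 0" unfolding B_def by (intro sum_nonneg) auto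
  have L: "\<Lambda> \<ge> 1" using B by (simp add: \<Lambda>_def)
  have M: "M \<ge> 0" unfolding M_def Y_def by (intro sum_nonneg) auto
  have Yle: "Y n \<le> M * \<Lambda> ^ n" for n
  proof (induction n rule: less_induct)
    case (less n)
    show ?case
    proof (cases "n \<le> q")
      case True
      have "Y n \<le> M" unfolding M_def by (rule member_le_sum) (use True in \<open>auto simp: Y_def\<close>)
      also have "M \<le> M * \<Lambda> ^ n" using M one_le_power[OF L, of n] by (simp add: mult_le_cancel_left1)
      finally show ?thesis .
    next
      case False
      define p where "p = n - q"
      have p: "n = p + q" "p > 0" using False by (auto simp: p_def)
      have "(\<Sum>i<q. b i * (deriv ^^ (p + i)) y 0) + b q * (deriv ^^ (p + q)) y 0 = 0"
        using dode[of p 0] by (simp only: sum_q)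
      then have "b q * (deriv ^^ n) y 0 = - (\<Sum>i<q. b i * (deriv ^^ (p + i)) y 0)"
        by (simp add: p(1) eq_neg_iff_add_eq_0 add.commute)
      then have "(deriv ^^ n) y 0 = - (\<Sum>i<q. b i * (deriv ^^ (p + i)) y 0) / b q"
        using q(2) by (metis nonzero_mult_div_cancel_left)
      also have "\<dots> = - (\<Sum>i<q. (b i / b q) * (deriv ^^ (p + i)) y 0)"
        by (simp add: sum_divide_distrib)
      finally have "Y n = norm (\<Sum>i<q. (b i / b q) * (deriv ^^ (p + i)) y 0)" by (simp add: Y_def)
      also have "\<dots> \<le> (\<Sum>i<q. norm (b i / b q) * Y (p + i))"
        by (rule order_trans[OF norm_sum]) (simp add: Y_def norm_mult norm_divide)
      also have "\<dots> \<le> (\<Sum>i<q. norm (b i / b q) * (M * \<Lambda> ^ (n - 1)))"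
      proof (intro sum_mono mult_left_mono)
        fix i assume i: "i \<in> {..<q}"
        have "Y (p + i) \<le> M * \<Lambda> ^ (p + i)" by (rule less) (use i p in simp)
        also have "\<dots> \<le> M * \<Lambda> ^ (n - 1)"
          using i p M L by (intro mult_left_mono power_increasing) auto
        finally show "Y (p + i) \<le> M * \<Lambda> ^ (n - 1)" .
      qed auto
      also have "\<dots> = B * (M * \<Lambda> ^ (n - 1))" by (simp add: B_def sum_distrib_right)
      also have "\<dots> \<le> \<Lambda> * (M * \<Lambda> ^ (n - 1))"
        using M L by (intro mult_right_mono) (auto simp: \<Lambda>_def)
      also have "\<dots> = M * \<Lambda> ^ n" using p by (simp add: power_eq_if)
      finally show ?thesis .
    qed
  qed
  have "norm (y z) \<le> M * exp (\<Lambda> * norm z)" for z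
  proof (rule norm_sums_le)
    show "(\<lambda>n. (deriv ^^ n) y 0 / fact n * (z - 0) ^ n) sums y z"
      by (rule holomorphic_power_series[of _ _ "norm z + 1"]) (use y holomorphic_on_subset in auto)
    have "(\<lambda>n. (\<Lambda> * norm z) ^ n /\<^sub>R fact n) sums exp (\<Lambda> * norm z)" by (rule exp_converges)
    then show "(\<lambda>n. M * ((\<Lambda> * norm z) ^ n /\<^sub>R fact n)) sums (M * exp (\<Lambda> * norm z))" by (rule sums_mult)
    fix n
    have "norm ((deriv ^^ n) y 0 / fact n * (z - 0) ^ n) = Y n * (norm z ^ n / fact n)"
      by (simp add: norm_mult norm_divide norm_power Y_def)
    also have "\<dots> \<le> (M * \<Lambda> ^ n) * (norm z ^ n / fact n)" by (intro mult_right_mono Yle) auto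
    also have "\<dots> = M * ((\<Lambda> * norm z) ^ n /\<^sub>R fact n)" by (simp add: power_mult_distrib divide_inverse mult_ac)
    finally show "norm ((deriv ^^ n) y 0 / fact n * (z - 0) ^ n) \<le> M * ((\<Lambda> * norm z) ^ n /\<^sub>R fact n)" .
  qed
  then show ?thesis using that[of M \<Lambda>] M L by simp
qed

text \<open>A zero-free solution \<open>exp H\<close> of exponential type has \<open>H'\<close> bounded in the mean: the means of
  \<open>ln |exp H|\<close> over circles about \<open>0\<close> are constant, so the majorant of the logarithmic derivative
  taken with \<open>\<rho>\<close> comparable to \<open>r\<close> stays bounded.\<close>

lemma riccati_solution_constant:
  assumes h: "h holomorphic_on UNIV" and b: "\<exists>i\<le>k. b i \<noteq> (0::complex)"
    and eq: "\<And>z. (\<Sum>i\<le>k. b i * exp_deriv_factor h i z) = 0"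
  shows "h constant_on UNIV"
proof (rule ccontr)
  assume nc: "\<not> h constant_on UNIV"
  obtain H where H: "\<And>z. (H has_field_derivative h z) (at z)"
    using holomorphic_convex_primitive'[of UNIV h] h by auto
  define y where "y = (\<lambda>z. exp (H z))"
  have dy: "(y has_field_derivative h z * y z) (at z)" for z
    unfolding y_def using H[of z] by (auto intro!: derivative_eq_intros)
  have y: "y holomorphic_on UNIV" using dy by (auto simp: holomorphic_on_open)
  have "(\<lambda>_. 0) holomorphic_on UNIV" by simp
  have dec: "(deriv ^^ i) y = (\<lambda>z. exp_deriv_factor h i z * y z)" for i
    using higher_deriv_decomposition[OF h \<open>(\<lambda>_. 0) holomorphic_on UNIV\<close> y, of i] DERIV_imp_deriv[OF dy]
    by (simp add: exp_deriv_rest_zero)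
  have ode: "(\<Sum>i\<le>k. b i * (deriv ^^ i) y z) = 0" for z
  proof -
    have "(\<Sum>i\<le>k. b i * (deriv ^^ i) y z) = (\<Sum>i\<le>k. b i * exp_deriv_factor h i z) * y z"
      by (simp add: dec sum_distrib_right mult.assoc)
    then show ?thesis by (simp add: eq)
  qed
  obtain M \<Lambda> where M: "M \<ge> 0" "\<Lambda> \<ge> 0" "\<And>z. norm (y z) \<le> M * exp (\<Lambda> * norm z)"
    using linear_ode_growth[OF y b ode] by metis
  have ynz: "y z \<noteq> 0" for z by (simp add: y_def)
  then have zf: "zerofree_circle y r" for r by (simp add: zerofree_circle_def)
  obtain C where C: "C \<ge> 0" "\<And>r \<epsilon>. r \<ge> 1 \<Longrightarrow> \<epsilon> > 0 \<Longrightarrow> - C \<le> cmean (lmax \<epsilon> y) 0 r"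
    by (rule cmean_lmax_ge[OF y ynz]) blast
  have Ty: "charT y r \<le> ln (M + 1) + \<Lambda> * r" if r: "r \<ge> 0" for r
  proof -
    have "charT y r \<le> cmean (\<lambda>_. ln (M + 1) + \<Lambda> * r) 0 r"
    proof (rule cmean_mono)
      fix z :: complex assume z: "z \<in> sphere 0 r"
      have L: "0 \<le> \<Lambda> * r" using M r by simp
      have "norm (y z) \<le> (M + 1) * exp (\<Lambda> * r)"
        using order_trans[OF M(3)[of z]] z M by (simp add: mult_right_mono)
      moreover have "1 * 1 \<le> (M + 1) * exp (\<Lambda> * r)" using M(1) L by (intro mult_mono) auto
      ultimately have "max (norm (y z)) 1 \<le> (M + 1) * exp (\<Lambda> * r)" by simp
      then have "lmax 1 y z \<le> ln ((M + 1) * exp (\<Lambda> * r))" unfolding lmax_def by (rule ln_mono) simp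
      also have "\<dots> = ln (M + 1) + \<Lambda> * r" using M(1) by (subst ln_mult_pos) auto
      finally show "lmax 1 y z \<le> ln (M + 1) + \<Lambda> * r" .
    qed (use r y in \<open>auto intro!: continuous_on_lmax_entire\<close>)
    then show ?thesis by simp
  qed
  \<comment> \<open>Monotonicity of the means, applied to the entire function \<open>1 / y\<close>,
    gives the reverse inequality for \<open>y\<close>.\<close>
  have J: "cmean (lognorm y) 0 R \<le> cmean (lognorm y) 0 r" if "0 \<le> r" "r \<le> R" for r R
  proof -
    have hi: "(\<lambda>z. 1 / y z) holomorphic_on UNIV" using y ynz by (intro holomorphic_intros) auto
    have zi: "zerofree_circle (\<lambda>z. 1 / y z) r" for r using ynz by (simp add: zerofree_circle_def)
    have "lognorm (\<lambda>z. 1 / y z) = (\<lambda>z. -1 * lognorm y z)"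
      using ynz by (auto simp: lognorm_def norm_divide ln_div)
    then have "cmean (lognorm (\<lambda>z. 1 / y z)) 0 s = - cmean (lognorm y) 0 s" for s
      by (simp only: cmean_cmult)
    then show ?thesis using lognorm_mean_mono[OF hi zi zi that] by simp
  qed
  define B where "B = 2 * (2 * ln (M + 1) + C) + 16 * \<Lambda>"
  have lnM: "ln (M + 1) \<ge> 0" using M(1) by simp
  have Th: "charT h r \<le> B" if r: "r \<ge> 4" for r
  proof -
    \<comment> \<open>The largest step compatible with the condition \<open>r >= \<rho> + 1\<close>
      of the majorant.\<close>
    define \<rho> where "\<rho> = r - 1"
    obtain e where e: "continuous_on (sphere 0 r) e" "\<And>z. z \<in> sphere 0 r \<Longrightarrow> 0 \<le> e z"
      "\<And>z v. z \<in> sphere 0 r \<Longrightarrow> norm v \<le> 1 \<Longrightarrow> norm (y (z + v)) \<le> exp (e z) * norm (y z)"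
      "cmean e 0 r \<le> cmean (lognorm y) 0 (r + \<rho>) - cmean (lognorm y) 0 r
          + 2 * 1 / (\<rho> - 1) * (2 * charT y (r + \<rho>) + C)"
      by (rule log_quotient_majorant[OF y zf zf C(2), of 1 \<rho> r]) (use r in \<open>auto simp: \<rho>_def\<close>)
    have "charT h r \<le> cmean e 0 r"
    proof (rule cmean_mono)
      fix z :: complex assume z: "z \<in> sphere 0 r"
      obtain v where v: "norm v \<le> 1" "norm ((deriv ^^ 1) y z) \<le> fact 1 * norm (y (z + v))"
        by (rule deriv_le_nearby[OF y])
      have "norm (h z) * norm (y z) = norm (deriv y z)"
        by (simp add: DERIV_imp_deriv[OF dy] norm_mult)
      also have "\<dots> \<le> exp (e z) * norm (y z)" using v(2) e(3)[OF z v(1)] by simp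
      finally have "norm (h z) \<le> exp (e z)" using ynz[of z] by simp
      then have "max (norm (h z)) 1 \<le> exp (e z)" using e(2)[OF z] by simp
      then have "exp (lmax 1 h z) \<le> exp (e z)" by (simp add: exp_lmax)
      then show "lmax 1 h z \<le> e z" by simp
    qed (use r h e in \<open>auto intro!: continuous_on_lmax_entire\<close>)
    also have "\<dots> \<le> 2 / (\<rho> - 1) * (2 * charT y (r + \<rho>) + C)"
      using e(4) J[of r "r + \<rho>"] r by (simp add: \<rho>_def)
    also have "\<dots> \<le> 2 / (\<rho> - 1) * (2 * (ln (M + 1) + \<Lambda> * (r + \<rho>)) + C)"
      using Ty[of "r + \<rho>"] r by (intro mult_left_mono) (auto simp: \<rho>_def)
    also have "\<dots> \<le> B"
    proof -
      define s where "s = r - 2"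
      have s: "s \<ge> 2" "\<rho> - 1 = s" "r + \<rho> = 2 * s + 3" using r by (auto simp: s_def \<rho>_def)
      have "2 * (2 * (ln (M + 1) + \<Lambda> * (2 * s + 3)) + C) \<le> B * s"
      proof -
        have "(2 * ln (M + 1) + C) * 2 \<le> (2 * ln (M + 1) + C) * s * 2"
          using mult_left_mono[OF s(1), of "2 * ln (M + 1) + C"] lnM C(1) by simp
        moreover have "\<Lambda> * 12 \<le> \<Lambda> * s * 8"
          using mult_left_mono[OF s(1), of \<Lambda>] M(2) by simp
        ultimately show ?thesis by (simp add: B_def algebra_simps)
      qed
      then show ?thesis unfolding s(2,3) using s(1) by (simp add: pos_divide_le_eq)
    qed
    finally show ?thesis .
  qed
  obtain R where R: "R \<ge> 1" "\<And>r. r \<ge> R \<Longrightarrow> charT h r \<ge> B + 1"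
    by (rule charT_at_top[OF h nc]) blast
  have "B + 1 \<le> charT h (max R 4)" by (rule R(2)) simp
  also have "\<dots> \<le> B" by (rule Th) simp
  finally show False by simp
qed

section \<open>The shift operator on the regular circles\<close>

context circles
begin

text \<open>Cauchy's estimate replaces the derivative at \<open>z + u\<close> by a value at distance
  at most 1 from there, hence the margin 1 in the condition on \<open>K\<close>.\<close>

lemma dom_nearby:
  assumes X: "X holomorphic_on UNIV"
    and near: "\<And>k z v. z \<in> sphere 0 (r k) \<Longrightarrow> norm v \<le> K \<Longrightarrow> norm (X (z + v)) \<le> exp (e k z) * norm (X z)"
    and u: "norm u + 1 \<le> K"
  shows "(\<lambda>z. norm ((deriv ^^ i) X (z + u))) \<preceq> (\<lambda>z. norm (X z))"
proof (rule domI[of "fact i + 1"])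
  fix k and z :: complex assume z: "z \<in> sphere 0 (r k)"
  obtain v where v: "norm v \<le> 1" "norm ((deriv ^^ i) X (z + u)) \<le> fact i * norm (X (z + u + v))"
    by (rule deriv_le_nearby[OF X])
  have "norm (u + v) \<le> K" using norm_triangle_ineq[of u v] v(1) u by linarith
  then have "norm (X (z + (u + v))) \<le> exp (e k z) * norm (X z)" by (rule near[OF z])
  then have 1: "norm ((deriv ^^ i) X (z + u)) \<le> fact i * (exp (e k z) * norm (X z))"
    using v(2) order_trans[OF _ mult_left_mono[of _ _ "fact i"]] by (fastforce simp: add.assoc)
  have "fact i \<le> exp (fact i :: real)" using exp_ge_add_one_self[of "fact i :: real"] by linarith
  then have "fact i * exp (e k z) \<le> exp (fact i) * exp (e k z)" by (intro mult_right_mono) auto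
  also have "\<dots> = exp (fact i + e k z)" by (simp add: exp_add)
  also have "fact i + e k z \<le> (fact i + 1) * (1 + e k z)"
    using mult_nonneg_nonneg[of "fact i" "e k z"] e_nonneg[OF z] by (simp add: algebra_simps)
  then have "exp (fact i + e k z) \<le> exp ((fact i + 1) * (1 + e k z))" by simp
  finally have "fact i * exp (e k z) * norm (X z) \<le> exp ((fact i + 1) * (1 + e k z)) * norm (X z)"
    by (intro mult_right_mono) auto
  with 1 show "norm ((deriv ^^ i) X (z + u)) \<le> exp ((fact i + 1) * (1 + e k z)) * norm (X z)"
    by (simp add: mult.assoc)
qed simp

text \<open>\<open>R\<close> is small only relative to \<open>1 + |g - a1|\<close>, and this
  suffices: the derivatives of \<open>f - a1\<close> are \<open>exp_deriv_factor\<close> times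
  \<open>f - a1\<close> plus rests of that size. Summing at \<open>z + c\<close> leaves
  \<open>Q\<close> times \<open>f (z + c) - a1\<close>, up to terms of size
  \<open>1 + |g - a1|\<close>.\<close>

lemma shift_operator_comparison:
  fixes \<alpha> f g :: "complex \<Rightarrow> complex" and a1 a2 c :: complex and k :: nat and b :: "nat \<Rightarrow> complex"
  defines "R \<equiv> \<lambda>z. deriv f z - \<alpha> z * (f z - a1)"
  defines "Q \<equiv> \<lambda>z. \<Sum>i\<le>k. b i * exp_deriv_factor \<alpha> i (z + c)"
  assumes f: "f holomorphic_on UNIV" and a: "a1 \<noteq> a2" and \<alpha>: "\<alpha> holomorphic_on UNIV"
    and eq: "\<And>z. \<alpha> z * ((f z - a1) * (f z - a2)) = deriv f z * (f z - g z)"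
    and g: "\<And>z. g z = (\<Sum>i\<le>k. b i * (deriv ^^ i) f (z + c))"
    and nz: "\<And>k z. z \<in> sphere 0 (r k) \<Longrightarrow> f z \<noteq> a1" "\<And>k z. z \<in> sphere 0 (r k) \<Longrightarrow> f z \<noteq> a2"
    and near: "\<And>X k z v. X \<in> F \<Longrightarrow> z \<in> sphere 0 (r k) \<Longrightarrow> norm v \<le> norm c + 1 \<Longrightarrow>
        norm (X (z + v)) \<le> exp (e k z) * norm (X z)"
    and F: "(\<lambda>z. f z - a1) \<in> F" "(\<lambda>z. f z - a2) \<in> F"
      "\<And>i. i \<le> k \<Longrightarrow> exp_deriv_factor \<alpha> i \<in> F" "\<And>i. i \<le> k \<Longrightarrow> exp_deriv_rest \<alpha> R i \<in> F"
  shows "(\<lambda>z. norm (g z - a1)) \<preceq> (\<lambda>z. 1 + norm (f z - a1))" (is ?th1)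
    and "(\<lambda>z. norm (Q z)) \<preceq> (\<lambda>_. 1)" (is ?th2)
    and "(\<lambda>z. norm (Q z) * norm (f (z + c) - a1)) \<preceq> (\<lambda>z. 1 + norm (g z - a1))" (is ?th3)
proof -
  define f1 where "f1 = (\<lambda>z. f z - a1)"
  have f1: "f1 holomorphic_on UNIV" unfolding f1_def by (intro holomorphic_intros f)
  have df1: "deriv f1 = deriv f" unfolding f1_def by (rule deriv_diff_const[OF f])
  \<comment> \<open>Subtracting \<open>a1\<close> affects only the derivative of order 0, whence the
    constant \<open>b 0 * a1\<close> in \<open>g_f1\<close>.\<close>
  have hdf: "(deriv ^^ i) f z = (if i = 0 then f1 z + a1 else (deriv ^^ i) f1 z)" for i z
  proof (cases i)
    case (Suc j)
    have "(deriv ^^ Suc j) f = (deriv ^^ Suc j) f1" by (simp only: funpow_Suc_right o_apply df1)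
    then show ?thesis using Suc by simp
  qed (simp add: f1_def)
  define P where "P = exp_deriv_factor \<alpha>"
  define S where "S = exp_deriv_rest \<alpha> R"
  have hR: "R holomorphic_on UNIV" unfolding R_def by (intro holomorphic_intros f \<alpha> deriv_entire)
  have hP: "P i holomorphic_on UNIV" for i unfolding P_def by (rule exp_deriv_factor_entire[OF \<alpha>])
  have hS: "S i holomorphic_on UNIV" for i unfolding S_def by (rule exp_deriv_rest_entire[OF \<alpha> hR])
  have nb: "(\<lambda>z. norm ((deriv ^^ i) X (z + u))) \<preceq> (\<lambda>z. norm (X z))"
    if "X \<in> F" "X holomorphic_on UNIV" "norm u \<le> norm c" for X i u
    by (rule dom_nearby[OF that(2) near[OF that(1)]]) (use that in auto)
  have d1: "(\<lambda>z. norm (deriv f z)) \<preceq> (\<lambda>z. norm (f1 z))"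
    using nb[of f1 0 1] F(1) f1 by (simp add: df1 f1_def[symmetric])
  have d2: "(\<lambda>z. norm (deriv f z)) \<preceq> (\<lambda>z. norm (f z - a2))"
    using nb[OF F(2), of 0 1] deriv_diff_const[OF f, of a2] by (simp add: f holomorphic_on_diff)
  have dP: "(\<lambda>z. norm ((deriv ^^ j) (P i) (z + u))) \<preceq> (\<lambda>z. norm (P i z))" if "i \<le> k" "norm u \<le> norm c" for i j u
    using nb[of "P i" u j] F(3)[OF that(1)] hP that(2) by (simp add: P_def)
  have dS: "(\<lambda>z. norm ((deriv ^^ j) (S i) (z + u))) \<preceq> (\<lambda>z. norm (S i z))" if "i \<le> k" "norm u \<le> norm c" for i j u
    using nb[of "S i" u j] F(4)[OF that(1)] hS that(2) by (simp add: S_def)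
  define \<phi> \<gamma> where "\<phi> = (\<lambda>z. 1 + norm (f1 z))" and "\<gamma> = (\<lambda>z. 1 + norm (g z - a1))"
  have p0: "0 \<le> \<phi> z" "0 \<le> \<gamma> z" for z by (simp_all add: \<phi>_def \<gamma>_def)
  have one: "(\<lambda>_. 1) \<preceq> \<phi>" "(\<lambda>_. 1) \<preceq> \<gamma>" by (rule dom_le; simp add: \<phi>_def \<gamma>_def)+
  have cst: "(\<lambda>_. x) \<preceq> \<phi>" "(\<lambda>_. x) \<preceq> \<gamma>" for x by (rule dom_trans[OF dom_const one(1)], rule dom_trans[OF dom_const one(2)])

  have g_f1: "g z = (\<Sum>i\<le>k. b i * (deriv ^^ i) f1 (z + c)) + b 0 * a1" for z
  proof -
    have "(\<Sum>i\<le>k. b i * (deriv ^^ i) f (z + c)) = (\<Sum>i\<le>k. b i * (deriv ^^ i) f1 (z + c) + (if i = 0 then b 0 * a1 else 0))"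
      by (intro sum.cong) (auto simp: hdf distrib_left)
    then show ?thesis by (simp add: g sum.distrib)
  qed
  have g_dom: "(\<lambda>z. norm (g z - a1)) \<preceq> \<phi>"
  proof -
    have "norm (g z - a1) \<le> (\<Sum>i\<le>k. norm (b i) * norm ((deriv ^^ i) f1 (z + c))) + norm (b 0 * a1 - a1)" for z
    proof -
      have "g z - a1 = (\<Sum>i\<le>k. b i * (deriv ^^ i) f1 (z + c)) + (b 0 * a1 - a1)" by (simp add: g_f1)
      also have "norm \<dots> \<le> norm (\<Sum>i\<le>k. b i * (deriv ^^ i) f1 (z + c)) + norm (b 0 * a1 - a1)"
        by (rule norm_triangle_ineq)
      also have "norm (\<Sum>i\<le>k. b i * (deriv ^^ i) f1 (z + c)) \<le> (\<Sum>i\<le>k. norm (b i) * norm ((deriv ^^ i) f1 (z + c)))"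
        by (rule order_trans[OF norm_sum]) (simp add: norm_mult)
      finally show ?thesis by simp
    qed
    then have "(\<lambda>z. norm (g z - a1)) \<preceq> (\<lambda>z. (\<Sum>i\<le>k. norm (b i) * norm ((deriv ^^ i) f1 (z + c))) + norm (b 0 * a1 - a1))"
      by (rule dom_le)
    also have "\<dots> \<preceq> \<phi>"
    proof (intro dom_add dom_sum dom_cmult cst p0)
      fix i
      have "(\<lambda>z. norm ((deriv ^^ i) f1 (z + c))) \<preceq> (\<lambda>z. norm (f1 z))"
        using nb[of f1 c i] F(1) f1 by (simp add: f1_def[symmetric])
      also have "\<dots> \<preceq> \<phi>" by (rule dom_le) (simp add: \<phi>_def)
      finally show "(\<lambda>z. norm ((deriv ^^ i) f1 (z + c))) \<preceq> \<phi>" .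
    qed auto
    finally show ?thesis .
  qed
  then show ?th1 by (simp add: \<phi>_def f1_def)

  have w_dom: "(\<lambda>z. norm (f z - g z)) \<preceq> (\<lambda>z. 1 + norm (f1 z))"
  proof -
    have "norm (f z - g z) \<le> norm (f1 z) + norm (g z - a1)" for z
      using norm_triangle_ineq4[of "f z - a1" "g z - a1"] by (simp add: f1_def)
    then have "(\<lambda>z. norm (f z - g z)) \<preceq> (\<lambda>z. norm (f1 z) + norm (g z - a1))" by (rule dom_le)
    also have "\<dots> \<preceq> \<phi>" by (intro dom_add g_dom dom_le p0) (simp add: \<phi>_def)
    finally show ?thesis by (simp add: \<phi>_def)
  qed
  have \<alpha>_dom: "(\<lambda>z. norm (\<alpha> z)) \<preceq> (\<lambda>_. 1)"
    by (rule sharing_quotient_dom_one[of "\<lambda>z. f z - a2" f1 "a1 - a2" "deriv f" "\<lambda>z. f z - g z"])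
       (use a nz d1 d2 w_dom eq in \<open>auto simp: f1_def\<close>)
  have P_dom: "(\<lambda>z. norm (P i z)) \<preceq> (\<lambda>_. 1)" if "i \<le> k" for i
    using that
  proof (induction i)
    case 0
    show ?case by (rule dom_le) (simp add: P_def)
  next
    case (Suc i)
    then have IH: "(\<lambda>z. norm (P i z)) \<preceq> (\<lambda>_. 1)" by simp
    have "norm (P (Suc i) z) \<le> norm (deriv (P i) z) + norm (\<alpha> z) * norm (P i z)" for z
      using norm_triangle_ineq[of "deriv (P i) z" "\<alpha> z * P i z"] by (simp add: P_def norm_mult)
    then have "(\<lambda>z. norm (P (Suc i) z)) \<preceq> (\<lambda>z. norm (deriv (P i) z) + norm (\<alpha> z) * norm (P i z))" by (rule dom_le)
    also have "\<dots> \<preceq> (\<lambda>_. 1)"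
    proof (intro dom_add)
      \<comment> \<open>Each \<open>P i\<close> belongs to the family \<open>F\<close> and dominates
        its own derivative, so the recursion loses only small factors.\<close>
      show "(\<lambda>z. norm (deriv (P i) z)) \<preceq> (\<lambda>_. 1)"
        using dom_trans[OF _ IH, of "\<lambda>z. norm (deriv (P i) z)"] dP[of i 0 1] Suc.prems by simp
      show "(\<lambda>z. norm (\<alpha> z) * norm (P i z)) \<preceq> (\<lambda>_. 1)"
        using dom_mult[OF \<alpha>_dom IH] by simp
    qed simp
    finally show ?case .
  qed
  have Pc_dom: "(\<lambda>z. norm (P i (z + c))) \<preceq> (\<lambda>_. 1)" if "i \<le> k" for i
    using dom_trans[OF _ P_dom[OF that], of "\<lambda>z. norm (P i (z + c))"] dP[OF that, of c 0] by simp
  show ?th2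
  proof -
    have "norm (Q z) \<le> (\<Sum>i\<le>k. norm (b i) * norm (P i (z + c)))" for z
      unfolding Q_def P_def by (rule order_trans[OF norm_sum]) (simp add: norm_mult)
    then have "(\<lambda>z. norm (Q z)) \<preceq> (\<lambda>z. \<Sum>i\<le>k. norm (b i) * norm (P i (z + c)))" by (rule dom_le)
    also have "\<dots> \<preceq> (\<lambda>_. 1)" by (intro dom_sum dom_cmult Pc_dom) auto
    finally show ?thesis .
  qed
  have R_dom: "(\<lambda>z. norm (R z)) \<preceq> \<gamma>"
  proof -
    have q: "(\<lambda>z. norm (deriv f z) / norm (f1 z)) \<preceq> (\<lambda>_. 1)"
      by (rule dom_divide[OF d1]) (use nz in \<open>auto simp: f1_def\<close>)
    have "(\<lambda>z. norm (deriv f z) / norm (f1 z) * norm (g z - a1) + norm (a1 - a2) * norm (\<alpha> z)) \<preceq> \<gamma>"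
    proof (intro dom_add dom_cmult p0)
      have "(\<lambda>z. norm (deriv f z) / norm (f1 z) * norm (g z - a1)) \<preceq> (\<lambda>z. 1 * \<gamma> z)"
        by (intro dom_mult q dom_le) (auto simp: \<gamma>_def)
      then show "(\<lambda>z. norm (deriv f z) / norm (f1 z) * norm (g z - a1)) \<preceq> \<gamma>" by simp
      show "(\<lambda>z. norm (\<alpha> z)) \<preceq> \<gamma>" by (rule dom_trans[OF \<alpha>_dom one(2)])
    qed auto
    then show ?thesis
    proof (rule dom_cong_sphere[OF _ _ order_refl])
      fix k and z :: complex assume z: "z \<in> sphere 0 (r k)"
      have f1nz: "f1 z \<noteq> 0" using nz(1)[OF z] by (simp add: f1_def)
      \<comment> \<open>Insert \<open>f - a2 = f1 + (a1 - a2)\<close> and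
        \<open>f - g = f1 - (g - a1)\<close> into \<open>eq\<close>; what is left of
        \<open>deriv f z * f1 z\<close> after subtracting \<open>\<alpha> z * (f1 z)^2\<close> no
        longer contains \<open>f1\<close> to the second power.\<close>
      have "R z * f1 z = deriv f z * (g z - a1) + (a1 - a2) * \<alpha> z * f1 z"
        using eq[of z] by (simp add: R_def f1_def algebra_simps)
      then have "R z = deriv f z / f1 z * (g z - a1) + (a1 - a2) * \<alpha> z"
        using f1nz by (simp add: field_simps)
      then show "norm (R z) \<le> norm (deriv f z) / norm (f1 z) * norm (g z - a1) + norm (a1 - a2) * norm (\<alpha> z)"
        using norm_triangle_ineq[of "deriv f z / f1 z * (g z - a1)" "(a1 - a2) * \<alpha> z"]
        by (simp add: norm_mult norm_divide)
    qed
  qed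
  have S_dom: "(\<lambda>z. norm (S i z)) \<preceq> \<gamma>" if "i \<le> k" for i
    using that
  proof (induction i)
    case 0
    show ?case by (rule dom_le) (simp add: S_def p0)
  next
    case (Suc i)
    then have IH: "(\<lambda>z. norm (S i z)) \<preceq> \<gamma>" by simp
    have "norm (S (Suc i) z) \<le> norm (deriv (S i) z) + norm (P i z) * norm (R z)" for z
      using norm_triangle_ineq[of "deriv (S i) z" "P i z * R z"] by (simp add: S_def P_def norm_mult)
    then have "(\<lambda>z. norm (S (Suc i) z)) \<preceq> (\<lambda>z. norm (deriv (S i) z) + norm (P i z) * norm (R z))" by (rule dom_le)
    also have "\<dots> \<preceq> \<gamma>"
    proof (intro dom_add p0)
      show "(\<lambda>z. norm (deriv (S i) z)) \<preceq> \<gamma>"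
        using dom_trans[OF _ IH, of "\<lambda>z. norm (deriv (S i) z)"] dS[of i 0 1] Suc.prems by simp
      show "(\<lambda>z. norm (P i z) * norm (R z)) \<preceq> \<gamma>"
        using dom_mult[OF P_dom R_dom, of i] Suc.prems by simp
    qed
    finally show ?case .
  qed
  have Sc_dom: "(\<lambda>z. norm (S i (z + c))) \<preceq> \<gamma>" if "i \<le> k" for i
    using dom_trans[OF _ S_dom[OF that], of "\<lambda>z. norm (S i (z + c))"] dS[OF that, of c 0] by simp
  have dec: "(deriv ^^ i) f1 z = P i z * f1 z + S i z" for i z
  proof -
    have "deriv f1 z = \<alpha> z * f1 z + R z" for z unfolding df1 by (simp add: R_def f1_def)
    from higher_deriv_decomposition[OF \<alpha> hR f1 this] show ?thesis
      unfolding P_def S_def by (rule fun_cong)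
  qed
  have Qf: "Q z * f1 (z + c) = (g z - a1) + (a1 - b 0 * a1) - (\<Sum>i\<le>k. b i * S i (z + c))" for z
  proof -
    have "(\<Sum>i\<le>k. b i * (deriv ^^ i) f1 (z + c)) = Q z * f1 (z + c) + (\<Sum>i\<le>k. b i * S i (z + c))"
      by (simp add: dec Q_def P_def[symmetric] distrib_left sum.distrib sum_distrib_right mult.assoc)
    then show ?thesis by (simp add: g_f1)
  qed
  have "norm (Q z) * norm (f1 (z + c)) \<le> norm (g z - a1) + norm (a1 - b 0 * a1) + (\<Sum>i\<le>k. norm (b i) * norm (S i (z + c)))" for z
  proof -
    have "norm (Q z) * norm (f1 (z + c)) = norm ((g z - a1) + (a1 - b 0 * a1) - (\<Sum>i\<le>k. b i * S i (z + c)))"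
      by (simp only: Qf flip: norm_mult)
    also have "\<dots> \<le> norm ((g z - a1) + (a1 - b 0 * a1)) + norm (\<Sum>i\<le>k. b i * S i (z + c))"
      by (rule norm_triangle_ineq4)
    also have "norm ((g z - a1) + (a1 - b 0 * a1)) \<le> norm (g z - a1) + norm (a1 - b 0 * a1)"
      by (rule norm_triangle_ineq)
    also have "norm (\<Sum>i\<le>k. b i * S i (z + c)) \<le> (\<Sum>i\<le>k. norm (b i) * norm (S i (z + c)))"
      by (rule order_trans[OF norm_sum]) (simp add: norm_mult)
    finally show ?thesis by simp
  qed
  then have "(\<lambda>z. norm (Q z) * norm (f1 (z + c)))
      \<preceq> (\<lambda>z. norm (g z - a1) + norm (a1 - b 0 * a1) + (\<Sum>i\<le>k. norm (b i) * norm (S i (z + c))))"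
    by (rule dom_le)
  also have "\<dots> \<preceq> \<gamma>"
    by (intro dom_add dom_sum dom_cmult cst Sc_dom p0 dom_le) (auto simp: \<gamma>_def)
  finally show ?th3 by (simp add: f1_def \<gamma>_def)
qed

end

text \<open>Carries relations proved for \<open>e\<close> over to the enlarged functions of
  \<open>admissible_enlarge\<close>.\<close>

lemma circles_dominated_mono:
  assumes "circles.dominated r e g h"
    and e: "\<And>k z. z \<in> sphere 0 (r k) \<Longrightarrow> 0 \<le> e k z" "\<And>k z. z \<in> sphere 0 (r k) \<Longrightarrow> e k z \<le> e' k z"
    and h: "\<And>z. 0 \<le> h z"
  shows "circles.dominated r e' g h"
proof -
  interpret A: circles r e by unfold_locales (rule e(1))
  interpret B: circles r e' by unfold_locales (use e in fastforce)
  obtain C where C: "C \<ge> 0" "\<And>k z. z \<in> sphere 0 (r k) \<Longrightarrow> g z \<le> exp (C * (1 + e k z)) * h z"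
    using assms(1) by (rule A.domE) blast
  show ?thesis
  proof (rule B.domI[OF C(1)])
    fix k and z :: complex assume z: "z \<in> sphere 0 (r k)"
    have "C * (1 + e k z) \<le> C * (1 + e' k z)" using C(1) e(2)[OF z] by (intro mult_left_mono) auto
    then have "exp (C * (1 + e k z)) * h z \<le> exp (C * (1 + e' k z)) * h z"
      using h by (intro mult_right_mono) auto
    then show "g z \<le> exp (C * (1 + e' k z)) * h z" using C(2)[OF z] by linarith
  qed
qed

lemma exp_deriv_factor_growth:
  assumes "f holomorphic_on UNIV" "growth_le f h"
  shows "growth_le f (exp_deriv_factor h i)"
  by (induction i)
     (auto intro!: growth_le_const growth_le_add growth_le_mult growth_le_deriv assms)

lemma exp_deriv_rest_growth:
  assumes "f holomorphic_on UNIV" "growth_le f h" "growth_le f R"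
  shows "growth_le f (exp_deriv_rest h R i)"
  by (induction i)
     (auto intro!: growth_le_const growth_le_add growth_le_mult growth_le_deriv exp_deriv_factor_growth assms)

lemma growth_le_higher_deriv:
  assumes "f holomorphic_on UNIV" "growth_le f X"
  shows "growth_le f ((deriv ^^ i) X)"
  by (induction i) (auto intro: growth_le_deriv assms)

text \<open>A nonzero \<open>Q\<close> is small with small reciprocal on suitable circles, so the
  lower estimate for \<open>g\<close> through \<open>Q\<close> times the shift of \<open>f\<close>
  becomes comparability of \<open>f\<close> and \<open>g\<close>, which
  \<open>comparable_contradiction\<close> excludes.\<close>

lemma characteristic_sum_vanishes:
  fixes f g \<alpha> :: "complex \<Rightarrow> complex"
  assumes f: "f holomorphic_on UNIV" "\<not> f constant_on UNIV" "hyper_order f < 1"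
    and a: "a1 \<noteq> a2" and g: "\<And>z. g z = (\<Sum>i\<le>k. b i * (deriv ^^ i) f (z + c))"
    and share: "\<And>z. f z = a1 \<longleftrightarrow> g z = a1" "\<And>z. f z = a2 \<longleftrightarrow> g z = a2"
    and ne: "f z0 \<noteq> g z0"
    and \<alpha>: "\<alpha> holomorphic_on UNIV" "\<And>z. \<alpha> z * ((f z - a1) * (f z - a2)) = deriv f z * (f z - g z)"
  shows "(\<Sum>i\<le>k. b i * exp_deriv_factor \<alpha> i (z + c)) = 0"
proof (rule ccontr)
  define Q where "Q = (\<lambda>z. \<Sum>i\<le>k. b i * exp_deriv_factor \<alpha> i (z + c))"
  define R where "R = (\<lambda>z. deriv f z - \<alpha> z * (f z - a1))"
  assume "(\<Sum>i\<le>k. b i * exp_deriv_factor \<alpha> i (z + c)) \<noteq> 0"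
  then have Qz: "Q z \<noteq> 0" by (simp add: Q_def)
  obtain z1 z2 where z12: "f z1 \<noteq> a1" "f z2 \<noteq> a2" using f(2) unfolding constant_on_def by blast
  note gr = growth_le_const[OF f(1)] growth_le_self[OF f(1)] growth_le_add[OF f(1)] growth_le_diff[OF f(1)]
    growth_le_mult[OF f(1)] growth_le_deriv[OF f(1)] growth_le_shift[OF f(1)] growth_le_sum[OF f(1)]
    growth_le_higher_deriv[OF f(1)]
  have gg: "growth_le f g"
    unfolding g[abs_def] by (intro gr finite_atMost)
  have g_hol: "g holomorphic_on UNIV" by (rule growth_le_hol[OF gg])
  have g\<alpha>: "growth_le f \<alpha>"
  proof -
    have fa: "(\<lambda>z. f z - b') holomorphic_on UNIV" for b' by (intro holomorphic_intros f(1))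
    have "\<not> (\<forall>z. (f z - a1) * (f z - a2) = 0)"
      using entire_mult_zero[OF fa[of a1] fa[of a2], of z1 z2] z12 by auto
    then obtain z3 where z3: "(f z3 - a1) * (f z3 - a2) \<noteq> 0" by blast
    have "growth_le f (\<lambda>z. (f z - a1) * (f z - a2))" "growth_le f (\<lambda>z. deriv f z * (f z - g z))"
      by (intro gr gg)+
    from growth_le_quotient[OF f(1) this(1) z3 this(2) \<alpha>] show ?thesis .
  qed

  have gR: "growth_le f R" unfolding R_def by (intro gr g\<alpha>)
  have gP: "growth_le f (exp_deriv_factor \<alpha> i)" for i by (rule exp_deriv_factor_growth[OF f(1) g\<alpha>])
  have gS: "growth_le f (exp_deriv_rest \<alpha> R i)" for i by (rule exp_deriv_rest_growth[OF f(1) g\<alpha> gR])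
  have gQ: "growth_le f Q" unfolding Q_def by (intro gr gP finite_atMost)
  \<comment> \<open>The family has \<open>f (z + c) - a1\<close> in order to shift back by
    \<open>-c\<close>, \<open>Q\<close> so that the circles avoid its zeros, and the factors and
    rests for the inductive estimates.\<close>
  define F where "F = {\<lambda>z. f z - a1, \<lambda>z. f z - a2, \<lambda>z. g z - a1, \<lambda>z. g z - a2, \<lambda>z. f (z + c) - a1, Q}
      \<union> exp_deriv_factor \<alpha> ` {..k} \<union> exp_deriv_rest \<alpha> R ` {..k}"
  have F_fin: "finite F" by (simp add: F_def)
  have F_gr: "growth_le f X" if "X \<in> F" for X
    using that unfolding F_def by (auto intro!: gr gg gQ gP gS)
  have K: "norm c + 1 > 0" by (simp add: add_nonneg_pos)
  obtain r e where adm: "admissible f r e"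
    and Fnz: "\<And>X k z w. X \<in> F \<Longrightarrow> z \<in> sphere 0 (r k) \<Longrightarrow> X w \<noteq> 0 \<Longrightarrow> X z \<noteq> 0"
    and near: "\<And>X k z v. X \<in> F \<Longrightarrow> z \<in> sphere 0 (r k) \<Longrightarrow> norm v \<le> norm c + 1 \<Longrightarrow>
       norm (X (z + v)) \<le> exp (e k z) * norm (X z)"
  proof (rule regular_circles[OF f F_fin F_gr K])
    fix r e assume "admissible f r e"
      "\<And>X k z w. X \<in> F \<Longrightarrow> z \<in> sphere 0 (r k) \<Longrightarrow> X w \<noteq> 0 \<Longrightarrow> X z \<noteq> 0"
      "\<And>X k z v. X \<in> F \<Longrightarrow> z \<in> sphere 0 (r k) \<Longrightarrow> norm v \<le> norm c + 1 \<Longrightarrow>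
         norm (X (z + v)) \<le> exp (e k z) * norm (X z)"
    then show thesis by (rule that)
  qed
  have e0: "0 \<le> e k z" if "z \<in> sphere 0 (r k)" for k z using adm that by (simp add: admissible_def)
  interpret A: circles r e by unfold_locales (rule e0)
  have memF: "(\<lambda>z. f z - a1) \<in> F" "(\<lambda>z. f z - a2) \<in> F" "(\<lambda>z. g z - a1) \<in> F" "(\<lambda>z. g z - a2) \<in> F"
    "(\<lambda>z. f (z + c) - a1) \<in> F" "Q \<in> F" "\<And>i. i \<le> k \<Longrightarrow> exp_deriv_factor \<alpha> i \<in> F"
    "\<And>i. i \<le> k \<Longrightarrow> exp_deriv_rest \<alpha> R i \<in> F"
    by (auto simp: F_def)
  have nz: "f z \<noteq> a1" "f z \<noteq> a2" if "z \<in> sphere 0 (r k)" for z k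
    using Fnz[OF memF(1) that, of z1] Fnz[OF memF(2) that, of z2] z12 by auto
  have Qnz: "Q w \<noteq> 0" if "w \<in> sphere 0 (r k)" for w k using Fnz[OF memF(6) that Qz] .
  note cmp = A.shift_operator_comparison[OF f(1) a \<alpha> g nz near memF(1,2) memF(7) memF(8)[unfolded R_def]]
  have cmp1: "A.dominated (\<lambda>z. norm (g z - a1)) (\<lambda>z. 1 + norm (f z - a1))" by (rule cmp(1))
  have cmp2: "A.dominated (\<lambda>z. norm (Q z)) (\<lambda>_. 1)" unfolding Q_def by (rule cmp(2))
  have cmp3: "A.dominated (\<lambda>z. norm (Q z) * norm (f (z + c) - a1)) (\<lambda>z. 1 + norm (g z - a1))"
    unfolding Q_def by (rule cmp(3))
  have dn: "A.dominated (\<lambda>z. norm (deriv X z)) (\<lambda>z. norm (X z - b'))"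
    if "(\<lambda>z. X z - b') \<in> F" "X holomorphic_on UNIV" for X b'
  proof -
    have "(\<lambda>z. X z - b') holomorphic_on UNIV" by (intro holomorphic_intros that(2))
    from A.dom_nearby[OF this near[OF that(1)], where u = 0 and i = 1] show ?thesis
      by (simp add: deriv_diff_const[OF that(2)])
  qed
  \<comment> \<open>The shift by \<open>-c\<close> is applied to \<open>f (z + c) - a1\<close>: here
    \<open>f\<close> has to be bounded through its shift, not the other way round.\<close>
  have fsh: "A.dominated (\<lambda>z. norm (f z - a1)) (\<lambda>z. norm (f (z + c) - a1))"
  proof -
    have "(\<lambda>z. f (z + c) - a1) holomorphic_on UNIV" by (intro holomorphic_intros entire_shift f(1))
    from A.dom_nearby[OF this near[OF memF(5)], where u = "-c" and i = 0] show ?thesis by simp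
  qed

  obtain C where C: "C \<ge> 0" "\<And>k z. z \<in> sphere 0 (r k) \<Longrightarrow> norm (Q z) \<le> exp (C * (1 + e k z)) * 1"
    using cmp2 by (rule A.domE) blast
  obtain e' where adm': "admissible f r e'" and ee': "\<And>k z. z \<in> sphere 0 (r k) \<Longrightarrow> e k z \<le> e' k z"
    and Q1: "\<And>k z. z \<in> sphere 0 (r k) \<Longrightarrow> 1 \<le> exp (e' k z) * norm (Q z)"
    by (rule admissible_enlarge[OF adm growth_le_hol[OF gQ] Qz Qnz C(1)]) (use C(2) in auto)
  have e'0: "0 \<le> e' k z" if "z \<in> sphere 0 (r k)" for k z using adm' that by (simp add: admissible_def)
  interpret B: circles r e' by unfold_locales (rule e'0)
  have AB: "B.dominated u v" if "A.dominated u v" "\<And>z. 0 \<le> v z" for u v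
    by (rule circles_dominated_mono[OF that(1) e0 ee' that(2)])
  have Q1': "B.dominated (\<lambda>_. 1) (\<lambda>z. norm (Q z))"
  proof (rule B.domI[of 1])
    fix k and z :: complex assume z: "z \<in> sphere 0 (r k)"
    have "exp (e' k z) * norm (Q z) \<le> exp (1 * (1 + e' k z)) * norm (Q z)"
      by (intro mult_right_mono) auto
    then show "1 \<le> exp (1 * (1 + e' k z)) * norm (Q z)" using Q1[OF z] by linarith
  qed simp
  have B1: "B.dominated (\<lambda>_. 1) (\<lambda>z. 1 + norm (h z - a1))" for h :: "complex \<Rightarrow> complex"
    by (rule B.dom_le) simp
  have gf: "B.dominated (\<lambda>z. 1 + norm (g z - a1)) (\<lambda>z. 1 + norm (f z - a1))"
    by (intro B.dom_add B1 AB cmp1) auto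
  have "B.dominated (\<lambda>z. 1 * norm (f (z + c) - a1)) (\<lambda>z. norm (Q z) * norm (f (z + c) - a1))"
    by (intro B.dom_mult Q1' B.dom_le) auto
  then have "B.dominated (\<lambda>z. norm (f (z + c) - a1)) (\<lambda>z. norm (Q z) * norm (f (z + c) - a1))" by simp
  \<comment> \<open>The chain passes from \<open>f - a1\<close> to its shift, then to
    \<open>Q\<close> times the shift, then to \<open>1 + |g - a1|\<close>; the middle link is where
    the reciprocal of \<open>Q\<close> must be small.\<close>
  from B.dom_trans[OF AB[OF fsh] B.dom_trans[OF this AB[OF cmp3]]]
  have "B.dominated (\<lambda>z. norm (f z - a1)) (\<lambda>z. 1 + norm (g z - a1))" by simp
  then have fg: "B.dominated (\<lambda>z. 1 + norm (f z - a1)) (\<lambda>z. 1 + norm (g z - a1))"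
    by (intro B.dom_add B1) auto
  show False
    by (rule B.comparable_contradiction[OF adm' f(1,2) g_hol a share ne nz
          AB[OF dn[OF memF(1) f(1)]] AB[OF dn[OF memF(2) f(1)]]
          AB[OF dn[OF memF(3) g_hol]] AB[OF dn[OF memF(4) g_hol]] gf fg]) auto
qed

text \<open>For constant values the first term of the numerator disappears. The two sides agree off
  the zeros of the denominator, and everywhere because \<open>remove_sings\<close> takes the limit,
  which continuity of \<open>\<alpha>\<close> provides.\<close>

lemma aux_phi_const_eq:
  assumes f: "f holomorphic_on UNIV" and z12: "f z1 \<noteq> a1" "f z2 \<noteq> a2"
    and \<alpha>: "\<alpha> holomorphic_on UNIV" "\<And>z. \<alpha> z * ((f z - a1) * (f z - a2)) = deriv f z * (f z - g z)"
  shows "aux_phi (\<lambda>_. a1) (\<lambda>_. a2) f g z = - (a1 - a2) * \<alpha> z"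
  unfolding aux_phi_def
proof (rule remove_sings_eqI)
  have fb: "(\<lambda>z. f z - b) holomorphic_on UNIV" for b by (intro holomorphic_intros f)
  have n1: "\<forall>\<^sub>F w in at z. f w - a1 \<noteq> 0"
    by (rule entire_eventually_nonzero[OF fb, of z1]) (use z12 in simp)
  have n2: "\<forall>\<^sub>F w in at z. f w - a2 \<noteq> 0"
    by (rule entire_eventually_nonzero[OF fb, of z2]) (use z12 in simp)
  have ev: "\<forall>\<^sub>F w in at z. - (a1 - a2) * \<alpha> w =
        (((deriv (\<lambda>_. a1) w - deriv (\<lambda>_. a2) w) * (f w - a1) - (a1 - a2) * (deriv f w - deriv (\<lambda>_. a1) w)) * (f w - g w))
          / ((f w - a1) * (f w - a2))"
    using n1 n2
  proof eventually_elim
    case (elim w)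
    then have 1: "\<alpha> w = deriv f w * (f w - g w) / ((f w - a1) * (f w - a2))"
      by (subst eq_divide_eq) (simp add: \<alpha>(2))
    have 2: "((deriv (\<lambda>_. a1) w - deriv (\<lambda>_. a2) w) * (f w - a1) - (a1 - a2) * (deriv f w - deriv (\<lambda>_. a1) w)) * (f w - g w)
        = - (a1 - a2) * (deriv f w * (f w - g w))"
      unfolding deriv_const by (simp add: algebra_simps)
    show ?case unfolding 1 2 by (rule times_divide_eq_right)
  qed
  have lim: "(\<lambda>w. - (a1 - a2) * \<alpha> w) \<midarrow>z\<rightarrow> - (a1 - a2) * \<alpha> z"
    by (rule tendsto_mult_left[OF entire_tendsto[OF \<alpha>(1)]])
  show "(\<lambda>w. (((deriv (\<lambda>_. a1) w - deriv (\<lambda>_. a2) w) * (f w - a1) - (a1 - a2) * (deriv f w - deriv (\<lambda>_. a1) w)) * (f w - g w))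
          / ((f w - a1) * (f w - a2))) \<midarrow>z\<rightarrow> - (a1 - a2) * \<alpha> z"
    by (rule Lim_transform_eventually[OF lim ev])
qed
theorem corollary1p1:
  fixes f \<phi> :: "complex \<Rightarrow> complex" and c a1 a2 :: complex
    and k :: nat and b :: "nat \<Rightarrow> complex" and \<psi> :: "nat \<Rightarrow> complex \<Rightarrow> complex"
  assumes "f holomorphic_on UNIV" and "\<not> f constant_on UNIV"
    and "hyper_order f < 1"
    and "c \<noteq> 0" and "a1 \<noteq> a2"
    and "k \<ge> 1" and "\<exists>i\<le>k. b i \<noteq> 0"
    and "\<phi> = aux_phi (\<lambda>_. a1) (\<lambda>_. a2) f (shift_diff_op k b c f)"
    and "\<psi> 1 = (\<lambda>z. - \<phi> (z + c) / (a1 - a2))"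
    and "\<And>i. i \<in> {1..<k} \<Longrightarrow> \<psi> (i + 1) = (\<lambda>z. deriv (\<psi> i) z + \<psi> 1 z * \<psi> i z)"
    and "share_IM f (shift_diff_op k b c f) a1"
    and "share_IM f (shift_diff_op k b c f) a2"
  shows "(\<forall>z. f z = shift_diff_op k b c f z) \<or>
         (\<psi> 1 constant_on UNIV \<and> (\<forall>z. (\<Sum>i=1..k. b i * \<psi> i z) = - b 0))"
proof (cases "\<forall>z. f z = shift_diff_op k b c f z")
  case True
  then show ?thesis by (rule disjI1)
next
  case False
  then obtain z0 where ne: "f z0 \<noteq> shift_diff_op k b c f z0"
    unfolding not_all by (elim exE)
  define g where "g = shift_diff_op k b c f"
  have g: "g z = (\<Sum>i\<le>k. b i * (deriv ^^ i) f (z + c))" for z by (simp add: g_def shift_diff_op_def)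
  have IM: "f z = b' \<longleftrightarrow> g z = b'" if "share_IM f g b'" for b' z
  proof -
    have "{z. f z - b' = 0} = {z. g z - b' = 0}" using that by (simp only: share_IM_def)
    then have "z \<in> {z. f z - b' = 0} \<longleftrightarrow> z \<in> {z. g z - b' = 0}" by (rule arg_cong)
    then show ?thesis by (simp only: mem_Collect_eq right_minus_eq)
  qed
  have share: "f z = a1 \<longleftrightarrow> g z = a1" "f z = a2 \<longleftrightarrow> g z = a2" for z
    unfolding g_def by (rule IM[unfolded g_def, OF assms(11)], rule IM[unfolded g_def, OF assms(12)])
  have g_hol: "g holomorphic_on UNIV"
  proof -
    have "(\<lambda>z. (deriv ^^ i) f (z + c)) holomorphic_on UNIV" for i
      by (rule entire_shift[OF higher_deriv_entire[OF assms(1)]])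
    then have "(\<lambda>z. \<Sum>i\<le>k. b i * (deriv ^^ i) f (z + c)) holomorphic_on UNIV"
      by (intro holomorphic_on_sum holomorphic_on_mult holomorphic_on_const)
    then show ?thesis by (simp only: g_def shift_diff_op_def)
  qed
  obtain z1 z2 where z12: "f z1 \<noteq> a1" "f z2 \<noteq> a2" using assms(2) unfolding constant_on_def by blast
  define \<alpha> where "\<alpha> = remove_sings (\<lambda>z. (deriv f z * (f z - g z)) / ((f z - a1) * (f z - a2)))"
  have s1: "g z = a1" if "f z = a1" for z by (rule iffD1[OF share(1) that])
  have s2: "g z = a2" if "f z = a2" for z by (rule iffD1[OF share(2) that])
  note sq = share_quotient[OF assms(1) g_hol assms(5) z12 s1 s2]
  have \<alpha>1: "\<alpha> holomorphic_on UNIV" unfolding \<alpha>_def by (rule sq(1))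
  have \<alpha>2: "\<alpha> z * ((f z - a1) * (f z - a2)) = deriv f z * (f z - g z)" for z
    unfolding \<alpha>_def by (rule sq(2))
  note \<alpha> = \<alpha>1 \<alpha>2
  have \<phi>_eq: "\<phi> z = - (a1 - a2) * \<alpha> z" for z
    unfolding assms(8) g_def[symmetric] by (rule aux_phi_const_eq[OF assms(1) z12 \<alpha>])
  \<comment> \<open>The minus signs of \<open>\<phi>_eq\<close> and of the definition of
    \<open>\<psi> 1\<close> cancel, as does \<open>a1 - a2\<close>.\<close>
  have \<psi>1: "\<psi> 1 = (\<lambda>z. \<alpha> (z + c))"
  proof
    fix z
    have "\<psi> 1 z = - \<phi> (z + c) / (a1 - a2)" by (rule fun_cong[OF assms(9)])
    also have "\<phi> (z + c) = - (a1 - a2) * \<alpha> (z + c)" by (rule \<phi>_eq)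
    also have "- (- (a1 - a2) * \<alpha> (z + c)) / (a1 - a2) = \<alpha> (z + c)"
    proof -
      have gen: "- (- d * x) / d = x" if "d \<noteq> 0" for d x :: complex using that by simp
      have "a1 - a2 \<noteq> 0" using assms(5) by simp
      then show ?thesis by (rule gen)
    qed
    finally show "\<psi> 1 z = \<alpha> (z + c)" .
  qed
  have \<psi>: "\<psi> i = exp_deriv_factor (\<psi> 1) i" if "1 \<le> i" "i \<le> k" for i
    using that
  proof (induction i rule: nat_induct_at_least)
    case base
    have one: "exp_deriv_factor h (Suc 0) = h" for h by simp
    show ?case unfolding One_nat_def one ..
  next
    case (Suc i)
    have IH: "\<psi> i = exp_deriv_factor (\<psi> 1) i" by (rule Suc.IH) (use Suc.prems in simp)
    have "\<psi> (Suc i) = (\<lambda>z. deriv (\<psi> i) z + \<psi> 1 z * \<psi> i z)"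
    proof -
      have "i \<in> {1..<k}" using Suc.hyps(1) Suc.prems by auto
      from assms(10)[OF this] show ?thesis unfolding Suc_eq_plus1 .
    qed
    then show ?case unfolding exp_deriv_factor.simps IH[symmetric] .
  qed
  have fac: "exp_deriv_factor (\<psi> 1) i = (\<lambda>z. exp_deriv_factor \<alpha> i (z + c))" for i
    unfolding \<psi>1 by (rule exp_deriv_factor_shift[OF \<alpha>(1)])
  have zero: "(\<Sum>i\<le>k. b i * exp_deriv_factor (\<psi> 1) i z) = 0" for z
  proof -
    have "f z0 \<noteq> g z0" using ne by (simp add: g_def)
    from characteristic_sum_vanishes[OF assms(1-3,5) g share this \<alpha>]
    show ?thesis by (simp only: fac)
  qed
  show ?thesis
  proof (intro disjI2 conjI)
    have "\<psi> 1 holomorphic_on UNIV" unfolding \<psi>1 by (rule entire_shift[OF \<alpha>(1)])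
    then show "\<psi> 1 constant_on UNIV" using assms(7) zero by (rule riccati_solution_constant)
    show "\<forall>z. (\<Sum>i=1..k. b i * \<psi> i z) = - b 0"
    proof
      fix z
      have "(\<Sum>i=1..k. b i * exp_deriv_factor (\<psi> 1) i z) = (\<Sum>i=1..k. b i * \<psi> i z)"
      proof (rule sum.cong[OF refl])
        fix i assume "i \<in> {1..k}"
        then have i: "1 \<le> i" "i \<le> k" by simp_all
        show "b i * exp_deriv_factor (\<psi> 1) i z = b i * \<psi> i z"
          by (rule arg_cong[OF fun_cong[OF \<psi>[OF i, symmetric]]])
      qed
      \<comment> \<open>\<open>exp_deriv_factor\<close> is 1 at index 0, which yields the term
        \<open>b 0\<close>, while \<open>\<psi>\<close> is prescribed from index 1 on.\<close>
      moreover have "{..k} = insert 0 {1..k}" by auto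
      then have "(\<Sum>i\<le>k. b i * exp_deriv_factor (\<psi> 1) i z)
          = b 0 * exp_deriv_factor (\<psi> 1) 0 z + (\<Sum>i=1..k. b i * exp_deriv_factor (\<psi> 1) i z)"
        by (simp only:) (rule sum.insert; simp)
      ultimately have "b 0 + (\<Sum>i=1..k. b i * \<psi> i z) = 0"
        unfolding zero[of z] exp_deriv_factor.simps(1) mult_1_right by (simp only:)
      then show "(\<Sum>i=1..k. b i * \<psi> i z) = - b 0" by (rule minus_unique[symmetric])
    qed
  qed
qed

end
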